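(* Suppose that $g_t$ and $g_t'$ are predictable bounded processes (of functions of the covariates) and that $H_S(g,g')=0$ (the null hypothesis, for every $S$). Suppose that, as $S\to\infty$, $$\frac1S\int_0^S\big[g_t(X(t))-g_t'(X(t))\big]^2\,d\Lambda(t)\to\sigma^2>0$$ in probability. Let $\hat\sigma_S^2:=\frac1S\int_0^S[g_t(X(t))-g_t'(X(t))]^2\,dN(t)$. Then $L_S(g,g')/\sqrt{S\hat\sigma_S^2}$ converges in distribution, as $S\to\infty$, to a standard normal random variable.
   Context: $(N(t))_{t\ge0}$ is a counting process with predictable covariate process $X(t)$ and intensity measure $\Lambda(A)=\int_A\exp\{g_0(X(t))\}\,dt$ for Borel $A\subseteq[0,\infty)$, i.e. $\lim_{s\downarrow0}\Pr(N(t+s)-N(t)=1\mid\mathcal F_t)/s=\exp\{g_0(X(t))\}$, where $\mathcal F_t$ is the sigma-algebra generated by $(N(s),X(s))_{s\le t}$ and $g_0$ is bounded. $\Lambda(t)$ is short for $\Lambda([0,t])$. $g_t$ and $g_t'$ are two competing models for $g_0$, predictable at time $t$ (for example, estimated from earlier data). The out of sample log-likelihood ratio is $$L_S(g,g')=\int_0^S\big[g_t(X(t))-g_t'(X(t))\big]dN(t)-\int_0^S\big[\exp\{g_t(X(t))\}-\exp\{g_t'(X(t))\}\big]dt,$$ and its predictable part is $$H_S(g,g')=\int_0^S\big[g_t(X(t))-g_t'(X(t))\big]d\Lambda(t)-\int_0^S\big[\exp\{g_t(X(t))\}-\exp\{g_t'(X(t))\}\big]dt.$$ *)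

theory Defs
  imports "HOL-Probability.Probability"
begin

text \<open>Time is modelled by the type \<^typ>\<open>real\<close>; only times \<open>t \<ge> 0\<close> matter, and the values of a
  process at negative times are ignored throughout.\<close>

subsection \<open>Filtrations, martingales and predictability\<close>

definition natural_filtration ::
  "'a measure \<Rightarrow> 'x measure \<Rightarrow> (real \<Rightarrow> 'a \<Rightarrow> nat) \<Rightarrow> (real \<Rightarrow> 'a \<Rightarrow> 'x) \<Rightarrow> real \<Rightarrow> 'a measure" where
  "natural_filtration M E N X t = sigma (space M)
     ({N s -` B \<inter> space M | s B. s \<in> {0..t}} \<union>
      {X s -` B \<inter> space M | s B. s \<in> {0..t} \<and> B \<in> sets E})"

definition martingale :: "'a measure \<Rightarrow> (real \<Rightarrow> 'a measure) \<Rightarrow> (real \<Rightarrow> 'a \<Rightarrow> real) \<Rightarrow> bool" where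
  "martingale M F Y \<longleftrightarrow>
     (\<forall>t\<ge>0. Y t \<in> borel_measurable (F t) \<and> integrable M (Y t)) \<and>
     (\<forall>s t. 0 \<le> s \<and> s \<le> t \<longrightarrow> (AE \<omega> in M. real_cond_exp M (F s) (Y t) \<omega> = Y s \<omega>))"

definition predictable_sigma :: "'a measure \<Rightarrow> (real \<Rightarrow> 'a measure) \<Rightarrow> (real \<times> 'a) measure" where
  "predictable_sigma M F = sigma ({0..} \<times> space M)
     ({{0} \<times> A | A. A \<in> sets (F 0)} \<union>
      {{s<..t} \<times> A | s t A. 0 \<le> s \<and> s < t \<and> A \<in> sets (F s)})"

definition predictable_process ::
  "'a measure \<Rightarrow> (real \<Rightarrow> 'a measure) \<Rightarrow> 'x measure \<Rightarrow> (real \<Rightarrow> 'a \<Rightarrow> 'x) \<Rightarrow> bool" where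
  "predictable_process M F E X \<longleftrightarrow> (\<lambda>(t, \<omega>). X t \<omega>) \<in> predictable_sigma M F \<rightarrow>\<^sub>M E"

text \<open>A process whose value \<open>g t \<omega>\<close> is a function on the covariate space \<open>E\<close>; joint measurability
  makes \<open>g t \<omega> (X t \<omega>)\<close> predictable whenever \<open>X\<close> is.\<close>

definition predictable_function_process ::
  "'a measure \<Rightarrow> (real \<Rightarrow> 'a measure) \<Rightarrow> 'x measure \<Rightarrow> (real \<Rightarrow> 'a \<Rightarrow> 'x \<Rightarrow> real) \<Rightarrow> bool" where
  "predictable_function_process M F E g \<longleftrightarrow>
     (\<lambda>((t, \<omega>), x). g t \<omega> x) \<in> predictable_sigma M F \<Otimes>\<^sub>M E \<rightarrow>\<^sub>M borel"

definition bounded_function_process ::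
  "'a measure \<Rightarrow> 'x measure \<Rightarrow> (real \<Rightarrow> 'a \<Rightarrow> 'x \<Rightarrow> real) \<Rightarrow> bool" where
  "bounded_function_process M E g \<longleftrightarrow>
     (\<exists>C. \<forall>t\<ge>0. \<forall>\<omega>\<in>space M. \<forall>x\<in>space E. \<bar>g t \<omega> x\<bar> \<le> C)"

subsection \<open>Modes of convergence\<close>

definition converges_in_prob ::
  "'a measure \<Rightarrow> ('i \<Rightarrow> 'a \<Rightarrow> real) \<Rightarrow> ('a \<Rightarrow> real) \<Rightarrow> 'i filter \<Rightarrow> bool" where
  "converges_in_prob M Y Z F \<longleftrightarrow>
     (\<forall>\<epsilon>>0. ((\<lambda>i. measure M {\<omega> \<in> space M. \<bar>Y i \<omega> - Z \<omega>\<bar> > \<epsilon>}) \<longlongrightarrow> 0) F)"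

text \<open>The library notion \<^const>\<open>weak_conv_m\<close> is for sequences of laws. Convergence as \<open>S \<rightarrow> \<infinity>\<close>
  through the reals means convergence along every sequence of times tending to infinity.\<close>

definition converges_in_dist_at_top ::
  "'a measure \<Rightarrow> (real \<Rightarrow> 'a \<Rightarrow> real) \<Rightarrow> real measure \<Rightarrow> bool" where
  "converges_in_dist_at_top M Y \<nu> \<longleftrightarrow>
     (\<forall>s :: nat \<Rightarrow> real. filterlim s at_top sequentially \<longrightarrow>
        weak_conv_m (\<lambda>n. distr M borel (Y (s n))) \<nu>)"

subsection \<open>Counting processes and their intensity\<close>

definition counting_process :: "'a measure \<Rightarrow> (real \<Rightarrow> 'a \<Rightarrow> nat) \<Rightarrow> bool" where
  "counting_process M N \<longleftrightarrow>
     (\<forall>t\<ge>0. N t \<in> M \<rightarrow>\<^sub>M count_space UNIV) \<and>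
     (\<forall>\<omega>\<in>space M.
        N 0 \<omega> = 0 \<and>
        (\<forall>s t. 0 \<le> s \<and> s \<le> t \<longrightarrow> N s \<omega> \<le> N t \<omega>) \<and>
        (\<forall>t\<ge>0. continuous (at_right t) (\<lambda>u. real (N u \<omega>))) \<and>
        (\<forall>t>0. \<forall>\<^sub>F u in at_left t. N t \<omega> \<le> N u \<omega> + 1))"

text \<open>The Lebesgue--Stieltjes measure \<open>dN\<close>. Freezing the path before time 0 makes it a right-continuous
  monotone function on the whole line, without an atom at 0.\<close>

definition dN :: "(real \<Rightarrow> 'a \<Rightarrow> nat) \<Rightarrow> 'a \<Rightarrow> real measure" where
  "dN N \<omega> = interval_measure (\<lambda>t. real (N (max 0 t) \<omega>))"

definition intensity_measure ::
  "('x \<Rightarrow> real) \<Rightarrow> (real \<Rightarrow> 'a \<Rightarrow> 'x) \<Rightarrow> 'a \<Rightarrow> real measure" where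
  "intensity_measure g0 X \<omega> =
     density lborel (\<lambda>t. indicator {0..} t * ennreal (exp (g0 (X t \<omega>))))"

text \<open>The first conjunct says that \<open>N\<close> has intensity measure \<open>\<Lambda>\<close>, i.e. that \<open>\<Lambda>\<close> is the compensator of
  \<open>N\<close> (as \<open>g0\<close> is bounded there is no difference between local and true martingales here). The
  second is the description of the intensity as an instantaneous conditional jump rate; taken alone
  it would not exclude additional jumps at fixed times. Conditional probabilities are only defined
  up to null sets, and an intensity is determined by the compensator only up to a null set of times,
  so the limit is required in probability, for almost every \<open>t\<close>.\<close>

definition has_intensity ::
  "'a measure \<Rightarrow> (real \<Rightarrow> 'a measure) \<Rightarrow> (real \<Rightarrow> 'a \<Rightarrow> nat) \<Rightarrow> (real \<Rightarrow> 'a \<Rightarrow> 'x) \<Rightarrow> ('x \<Rightarrow> real) \<Rightarrow> bool" where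
  "has_intensity M F N X g0 \<longleftrightarrow>
     martingale M F (\<lambda>t \<omega>. real (N t \<omega>) - measure (intensity_measure g0 X \<omega>) {0..t}) \<and>
     (AE t in lborel. 0 \<le> t \<longrightarrow>
        converges_in_prob M
          (\<lambda>s \<omega>. real_cond_exp M (F t) (indicator {\<omega> \<in> space M. N (t + s) \<omega> - N t \<omega> = 1}) \<omega> / s)
          (\<lambda>\<omega>. exp (g0 (X t \<omega>))) (at_right 0))"

subsection \<open>Likelihood ratio, its predictable part and the variance estimator\<close>

definition loglik_ratio ::
  "(real \<Rightarrow> 'a \<Rightarrow> nat) \<Rightarrow> (real \<Rightarrow> 'a \<Rightarrow> 'x) \<Rightarrow> (real \<Rightarrow> 'a \<Rightarrow> 'x \<Rightarrow> real) \<Rightarrow> (real \<Rightarrow> 'a \<Rightarrow> 'x \<Rightarrow> real) \<Rightarrow>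
    real \<Rightarrow> 'a \<Rightarrow> real" where
  "loglik_ratio N X g g' S \<omega> =
     (LINT t:{0..S}|dN N \<omega>. g t \<omega> (X t \<omega>) - g' t \<omega> (X t \<omega>)) -
     (LINT t:{0..S}|lborel. exp (g t \<omega> (X t \<omega>)) - exp (g' t \<omega> (X t \<omega>)))"

definition predictable_part ::
  "('x \<Rightarrow> real) \<Rightarrow> (real \<Rightarrow> 'a \<Rightarrow> 'x) \<Rightarrow> (real \<Rightarrow> 'a \<Rightarrow> 'x \<Rightarrow> real) \<Rightarrow> (real \<Rightarrow> 'a \<Rightarrow> 'x \<Rightarrow> real) \<Rightarrow>
    real \<Rightarrow> 'a \<Rightarrow> real" where
  "predictable_part g0 X g g' S \<omega> =
     (LINT t:{0..S}|intensity_measure g0 X \<omega>. g t \<omega> (X t \<omega>) - g' t \<omega> (X t \<omega>)) -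
     (LINT t:{0..S}|lborel. exp (g t \<omega> (X t \<omega>)) - exp (g' t \<omega> (X t \<omega>)))"

definition variance_estimator ::
  "(real \<Rightarrow> 'a \<Rightarrow> nat) \<Rightarrow> (real \<Rightarrow> 'a \<Rightarrow> 'x) \<Rightarrow> (real \<Rightarrow> 'a \<Rightarrow> 'x \<Rightarrow> real) \<Rightarrow> (real \<Rightarrow> 'a \<Rightarrow> 'x \<Rightarrow> real) \<Rightarrow>
    real \<Rightarrow> 'a \<Rightarrow> real" where
  "variance_estimator N X g g' S \<omega> =
     1 / S * (LINT t:{0..S}|dN N \<omega>. (g t \<omega> (X t \<omega>) - g' t \<omega> (X t \<omega>))\<^sup>2)"

end

theory Submission
  imports Defs
begin

text \<open>
  Write \<open>h\<close> for \<open>g - g'\<close> along the covariate path, \<open>\<Lambda>\<close> for the intensity measure and \<open>W\<close> for the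
  integral of \<open>h\<close> against \<open>dN - d\<Lambda>\<close>; under the null hypothesis \<open>W\<close> is the log-likelihood ratio.
  By a monotone class argument, \<open>dN\<close> and \<open>d\<Lambda>\<close> have the same mean on bounded predictable integrands.
  Up to an error whose mean is quadratic in the length of the interval, the increments of
  \<open>Z = exp (i \<integral> h dN - \<integral> (exp (i h) - 1) d\<Lambda>)\<close> are integrals of predictable integrands against
  \<open>dN - d\<Lambda>\<close>, so \<open>E Z = 1\<close>. With \<open>u h / sqrt S\<close> in place of \<open>h\<close> this reads
  \<open>E (exp (i u W / sqrt S) exp (- \<Phi>)) = 1\<close>, where \<open>\<Phi>\<close> is bounded and converges in probability to the
  constant \<open>- u\<^sup>2 \<sigma>\<^sup>2 / 2\<close>, which gives the limit of the characteristic function of \<open>W / sqrt S\<close>.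
  Expanding the same identity at \<open>u = 0\<close> yields \<open>E W\<^sup>2 = O(S)\<close>. Applied to \<open>h\<^sup>2\<close> instead of \<open>h\<close>, this
  makes the variance estimator consistent, and the random normalisation is removed as in Slutsky's theorem.
\<close>

subsection \<open>Predictable integrands and random measures\<close>

text \<open>The crux is the quadratic error. If an interval contains at most one jump,
  \<open>exp (\<i> * x) - 1\<close> for the dN-integral \<open>x\<close> of \<open>h\<close>
  coincides with the dN-integral of \<open>exp (\<i> * h) - 1\<close>, so only jumps beyond the
  first one matter. Their number is the dN-mass of a predictable set, the time after the first jump.
  Compensation turns its mean into the mean of a \<Lambda>-mass, which is at most
  \<open>c * (t - s)\<close> and vanishes unless there is a jump; a jump costs a second factor
  \<open>c * (t - s)\<close>. Over a partition of mesh S / n the errors add up to order 1 / n, so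
  the mean of Z cannot move, and no stochastic calculus enters. The other obstacle is that \<Phi> is
  random and depends on W. With \<open>k\<close> the limit of exp (- \<Phi>), the identity becomes k
  E (exp (i u W / sqrt S)) - 1 = E (exp (i u W / sqrt S) (k - exp (- \<Phi>))). The oscillating
  factor has modulus 1 and drops out of the estimate, so it suffices that \<Phi> converges in mean.
  This follows from convergence in probability because bounded \<open>h\<close> and bounded
  intensity bound \<Phi> uniformly in S.\<close>

lemma norm_set_integral_le:
  fixes f :: "'b \<Rightarrow> 'c :: {banach, second_countable_topology}"
  assumes f: "set_integrable \<mu> A f" and A: "A \<in> sets \<mu>" "emeasure \<mu> A < \<infinity>"
    and C: "\<And>x. x \<in> A \<Longrightarrow> norm (f x) \<le> C"
  shows "norm (LINT x:A|\<mu>. f x) \<le> C * measure \<mu> A"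
proof -
  have ind: "integrable \<mu> (indicator A :: 'b \<Rightarrow> real)"
    using A by (intro integrable_real_indicator)
  have "norm (LINT x:A|\<mu>. f x) \<le> (LINT x|\<mu>. norm (indicator A x *\<^sub>R f x))"
    unfolding set_lebesgue_integral_def by (rule integral_norm_bound)
  also have "\<dots> \<le> (LINT x|\<mu>. indicator A x * C)"
    using f ind C unfolding set_integrable_def
    by (intro integral_mono integrable_norm integrable_mult_left) (auto split: split_indicator)
  also have "\<dots> = C * measure \<mu> A"
    using sets.sets_into_space[OF A(1)] by (simp add: Int_absorb2)
  finally show ?thesis .
qed

text \<open>The generator of \<open>predictable_sigma\<close> gets a name because induction by
  \<open>sigma_sets_induct_disjoint\<close> runs over a generator closed under intersection.\<close>

definition predictable_rectangles :: "'a measure \<Rightarrow> (real \<Rightarrow> 'a measure) \<Rightarrow> (real \<times> 'a) set set" where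
  "predictable_rectangles M F = {{0} \<times> A | A. A \<in> sets (F 0)} \<union>
      {{s<..t} \<times> A | s t A. 0 \<le> s \<and> s < t \<and> A \<in> sets (F s)}"

section \<open>Measurability of sections and of integrals against adapted random measures\<close>

locale filtered_prob_space = prob_space M for M :: "'a measure" +
  fixes F :: "real \<Rightarrow> 'a measure"
  assumes subalg: "0 \<le> t \<Longrightarrow> subalgebra M (F t)"
    and sets_F_mono: "0 \<le> s \<Longrightarrow> s \<le> t \<Longrightarrow> sets (F s) \<subseteq> sets (F t)"
begin

abbreviation "P \<equiv> predictable_sigma M F"

lemma space_F: "0 \<le> t \<Longrightarrow> space (F t) = space M"
  using subalg by (auto simp: subalgebra_def)

lemma sets_F_M: "0 \<le> t \<Longrightarrow> A \<in> sets (F t) \<Longrightarrow> A \<in> sets M"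
  using subalg by (auto simp: subalgebra_def)

lemma measurable_F_M: "0 \<le> t \<Longrightarrow> f \<in> F t \<rightarrow>\<^sub>M K \<Longrightarrow> f \<in> M \<rightarrow>\<^sub>M K"
  using measurable_from_subalg subalg by blast

lemma measurable_F_mono: "0 \<le> s \<Longrightarrow> s \<le> t \<Longrightarrow> f \<in> F s \<rightarrow>\<^sub>M K \<Longrightarrow> f \<in> F t \<rightarrow>\<^sub>M K"
  by (rule measurable_from_subalg[of _ "F s"]) (auto simp: subalgebra_def space_F sets_F_mono)

lemma rectangles_subset: "predictable_rectangles M F \<subseteq> Pow ({0..} \<times> space M)"
  using sets_F_M[THEN sets.sets_into_space] by (fastforce simp: predictable_rectangles_def)

lemma predictable_sigma_eq: "P = sigma ({0..} \<times> space M) (predictable_rectangles M F)"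
  by (simp add: predictable_sigma_def predictable_rectangles_def)

lemma space_P: "space P = {0..} \<times> space M"
  using rectangles_subset by (simp add: predictable_sigma_eq space_measure_of_conv)

lemma sets_P: "sets P = sigma_sets ({0..} \<times> space M) (predictable_rectangles M F)"
  using rectangles_subset by (simp add: predictable_sigma_eq)

text \<open>Two strips meet in \<open>{max s s'<..min t t'} \<times> (A \<inter> B)\<close>, whose
  base lies in \<open>F (max s s')\<close> because the filtration increases, and strips miss the
  slice at time 0. Hence identities for predictable sets need to be checked on rectangles
  only.\<close>

lemma Int_stable_rectangles: "Int_stable (predictable_rectangles M F)"
proof (rule Int_stableI)
  fix a b assume ab: "a \<in> predictable_rectangles M F" "b \<in> predictable_rectangles M F"
  \<comment> \<open>Disjoint pairs are covered by the slice at time 0 with empty base.\<close>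
  have e: "{} \<in> predictable_rectangles M F"
    unfolding predictable_rectangles_def by (intro UnI1 CollectI exI[of _ "{}"]) auto
  consider (1) A B where "a = {0} \<times> A" "b = {0} \<times> B" "A \<in> sets (F 0)" "B \<in> sets (F 0)"
    | (2) A B s t where "a = {0} \<times> A" "b = {s<..t} \<times> B" "0 \<le> s"
    | (3) A B s t where "a = {s<..t} \<times> A" "b = {0} \<times> B" "0 \<le> s"
    | (4) A B s t s' t' where "a = {s<..t} \<times> A" "b = {s'<..t'} \<times> B" "0 \<le> s" "0 \<le> s'"
        "A \<in> sets (F s)" "B \<in> sets (F s')"
    using ab unfolding predictable_rectangles_def by blast
  then show "a \<inter> b \<in> predictable_rectangles M F"
  proof cases
    case 1
    then have "a \<inter> b = {0} \<times> (A \<inter> B)" by auto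
    then show ?thesis using 1 unfolding predictable_rectangles_def by blast
  next
    case 2
    then have "a \<inter> b = {}" by auto
    then show ?thesis using e by simp
  next
    case 3
    then have "a \<inter> b = {}" by auto
    then show ?thesis using e by simp
  next
    case 4
    have i: "a \<inter> b = {max s s'<..min t t'} \<times> (A \<inter> B)" using 4 by auto
    have AB: "A \<inter> B \<in> sets (F (max s s'))"
      using 4 sets_F_mono[of s "max s s'"] sets_F_mono[of s' "max s s'"] by auto
    show ?thesis
    proof (cases "max s s' < min t t'")
      case True
      then show ?thesis unfolding i predictable_rectangles_def using AB 4
        by (intro UnI2 CollectI exI[of _ "max s s'"] exI[of _ "min t t'"] exI[of _ "A \<inter> B"]) auto
    next
      case False
      then have "a \<inter> b = {}" using i by auto
      then show ?thesis using e by simp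
    qed
  qed
qed

lemma rectangle_in_P:
  assumes "0 \<le> s" "A \<in> sets (F s)" shows "{s<..t} \<times> A \<in> sets P"
proof (cases "s < t")
  case True
  then show ?thesis unfolding sets_P using assms
    by (intro sigma_sets.Basic) (auto simp: predictable_rectangles_def)
qed simp

text \<open>Points of \<open>P\<close> have nonnegative time, while the random measures live on the
  whole line; clamping with \<open>max 0\<close> makes the section a total measurable map. It
  changes nothing on \<open>{0..r}\<close>, where all integrals are taken.\<close>

lemma measurable_section:
  assumes "\<omega> \<in> space M" shows "(\<lambda>t. (max 0 t, \<omega>)) \<in> borel \<rightarrow>\<^sub>M P"
  unfolding predictable_sigma_eq
proof (rule measurable_measure_of[OF rectangles_subset])
  fix y assume "y \<in> predictable_rectangles M F"
  then consider (1) A where "y = {0} \<times> A" | (2) A s t where "y = {s<..t} \<times> A"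
    unfolding predictable_rectangles_def by blast
  then show "(\<lambda>t. (max 0 t, \<omega>)) -` y \<inter> space borel \<in> sets borel"
  proof cases
    case 1
    have "(\<lambda>t. (max 0 t, \<omega>)) -` y \<inter> space borel = (if \<omega> \<in> A then {..0::real} else {})"
      using 1 by (auto simp: max_def split: if_splits)
    then show ?thesis by simp
  next
    case 2
    have "(\<lambda>t. (max 0 t, \<omega>)) -` y \<inter> space borel = (if \<omega> \<in> A then {u. s < max 0 u \<and> max 0 u \<le> t} else {})"
      using 2 by auto
    also have "\<dots> \<in> sets borel" by simp
    finally show ?thesis .
  qed
qed (use assms in auto)

lemma section_measurable: "H \<in> P \<rightarrow>\<^sub>M K \<Longrightarrow> \<omega> \<in> space M \<Longrightarrow> (\<lambda>t. H (max 0 t, \<omega>)) \<in> borel \<rightarrow>\<^sub>M K"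
  using measurable_compose[OF measurable_section] .

lemma section_sets:
  assumes "A \<in> sets P" "\<omega> \<in> space M" shows "{u \<in> {0..r}. (u, \<omega>) \<in> A} \<in> sets borel"
proof -
  have "{u \<in> {0..r}. (u, \<omega>) \<in> A} = {0..r} \<inter> ((\<lambda>t. (max 0 t, \<omega>)) -` A \<inter> space borel)"
    by (auto simp: max_def)
  then show ?thesis using measurable_sets[OF measurable_section[OF assms(2)] assms(1)] by auto
qed

lemma section_nn_measurable:
  fixes H :: "real \<times> 'a \<Rightarrow> ennreal"
  assumes "H \<in> borel_measurable P" "\<omega> \<in> space M"
  shows "(\<lambda>u. H (u, \<omega>) * indicator {0..r} u) \<in> borel_measurable borel"
proof -
  have [measurable]: "(\<lambda>t. H (max 0 t, \<omega>)) \<in> borel_measurable borel"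
    using section_measurable[OF assms] .
  have "(\<lambda>u. H (u, \<omega>) * indicator {0..r} u) = (\<lambda>u. H (max 0 u, \<omega>) * indicator {0..r} u)"
    by (auto simp: fun_eq_iff indicator_def max_def)
  then show ?thesis by simp
qed

lemma section_scaleR_measurable:
  fixes H :: "real \<times> 'a \<Rightarrow> 'b :: {real_normed_vector, second_countable_topology}"
  assumes "H \<in> borel_measurable P" "\<omega> \<in> space M"
  shows "(\<lambda>u. indicator {0..r} u *\<^sub>R H (u, \<omega>)) \<in> borel_measurable borel"
proof -
  have [measurable]: "(\<lambda>t. H (max 0 t, \<omega>)) \<in> borel_measurable borel"
    using section_measurable[OF assms] .
  have "(\<lambda>u. indicator {0..r} u *\<^sub>R H (u, \<omega>)) = (\<lambda>u. indicator {0..r} u *\<^sub>R H (max 0 u, \<omega>))"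
    by (auto simp: fun_eq_iff indicator_def max_def)
  then show ?thesis by simp
qed

text \<open>The point 0 must have no mass because the rectangles \<open>{0} \<times> A\<close> are
  invisible to increments over half-open intervals. Measurability is asked of the masses of
  \<open>{0..t}\<close> alone; the step to predictable sets and integrands is a monotone class
  argument.\<close>

definition adapted_kernel :: "('a \<Rightarrow> real measure) \<Rightarrow> bool" where
  "adapted_kernel \<mu> \<longleftrightarrow>
     (\<forall>\<omega>\<in>space M. sets (\<mu> \<omega>) = sets borel \<and> emeasure (\<mu> \<omega>) {0} = 0 \<and> (\<forall>t\<ge>0. emeasure (\<mu> \<omega>) {0..t} < \<infinity>)) \<and>
     (\<forall>t\<ge>0. (\<lambda>\<omega>. emeasure (\<mu> \<omega>) {0..t}) \<in> borel_measurable (F t))"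

lemma adapted_kernelD:
  assumes "adapted_kernel \<mu>"
  shows "\<omega> \<in> space M \<Longrightarrow> sets (\<mu> \<omega>) = sets borel"
    "\<omega> \<in> space M \<Longrightarrow> emeasure (\<mu> \<omega>) {0} = 0"
    "\<omega> \<in> space M \<Longrightarrow> 0 \<le> t \<Longrightarrow> emeasure (\<mu> \<omega>) {0..t} < \<infinity>"
    "0 \<le> t \<Longrightarrow> (\<lambda>\<omega>. emeasure (\<mu> \<omega>) {0..t}) \<in> borel_measurable (F t)"
  using assms by (auto simp: adapted_kernel_def)

lemma kernel_Ioc:
  assumes "adapted_kernel \<mu>" "\<omega> \<in> space M" "0 \<le> s" "s \<le> t"
  shows "emeasure (\<mu> \<omega>) {s<..t} = emeasure (\<mu> \<omega>) {0..t} - emeasure (\<mu> \<omega>) {0..s}"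
proof -
  have "{s<..t} = {0..t} - {0..s}" using assms by auto
  then show ?thesis
    using adapted_kernelD(1)[OF assms(1,2)] adapted_kernelD(3)[OF assms(1,2,3)] assms(4)
    by (subst emeasure_Diff[symmetric]) auto
qed

lemma section_nn_measurable_kernel:
  fixes H :: "real \<times> 'a \<Rightarrow> ennreal"
  assumes "adapted_kernel \<mu>" "H \<in> borel_measurable P" "\<omega> \<in> space M"
  shows "(\<lambda>u. H (u, \<omega>) * indicator {0..r} u) \<in> borel_measurable (\<mu> \<omega>)"
  using section_nn_measurable[OF assms(2,3)] measurable_cong_sets[OF adapted_kernelD(1)[OF assms(1,3)] refl]
  by blast

text \<open>Cutting at \<open>r\<close> gives measurability for \<open>F r\<close>: a strip
  \<open>{s<..t} \<times> B\<close> contributes only if \<open>s \<le> r\<close>, and then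
  \<open>B\<close> and the masses of \<open>{0..s}\<close> and \<open>{0..min t r}\<close> are all
  known at time \<open>r\<close>. Finite mass on \<open>{0..r}\<close> permits the subtraction for
  complements.\<close>

lemma kernel_set_measurable:
  assumes \<mu>: "adapted_kernel \<mu>" and r: "0 \<le> r" and A: "A \<in> sets P"
  shows "(\<lambda>\<omega>. emeasure (\<mu> \<omega>) {u \<in> {0..r}. (u, \<omega>) \<in> A}) \<in> borel_measurable (F r)"
  using Int_stable_rectangles rectangles_subset A[unfolded sets_P]
proof (induction rule: sigma_sets_induct_disjoint)
  case (basic A)
  note \<mu>D = adapted_kernelD[OF \<mu>]
  from basic consider (1) B where "A = {0} \<times> B"
    | (2) B s t where "A = {s<..t} \<times> B" "0 \<le> s" "s < t" "B \<in> sets (F s)"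
    unfolding predictable_rectangles_def by blast
  then show ?case
  proof cases
    case 1
    have eq: "emeasure (\<mu> \<omega>) {u \<in> {0..r}. (u, \<omega>) \<in> A} = 0" if "\<omega> \<in> space (F r)" for \<omega>
    proof -
      have "{u \<in> {0..r}. (u, \<omega>) \<in> A} \<subseteq> {0}" using 1 by auto
      then have "emeasure (\<mu> \<omega>) {u \<in> {0..r}. (u, \<omega>) \<in> A} \<le> emeasure (\<mu> \<omega>) {0}"
        using \<mu>D(1) that r by (intro emeasure_mono) (auto simp: space_F)
      then show ?thesis using \<mu>D(2) that r by (simp add: space_F)
    qed
    show ?thesis by (rule iffD2[OF measurable_cong, OF eq]) simp_all
  next
    case 2
    show ?thesis
    proof (cases "s \<le> r")
      case False
      then have e: "{u \<in> {0..r}. (u, \<omega>) \<in> A} = {}" for \<omega> using 2 by auto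
      show ?thesis unfolding e by simp
    next
      case True
      have eq: "emeasure (\<mu> \<omega>) {u \<in> {0..r}. (u, \<omega>) \<in> A}
          = (emeasure (\<mu> \<omega>) {0..min t r} - emeasure (\<mu> \<omega>) {0..s}) * indicator B \<omega>"
        if "\<omega> \<in> space (F r)" for \<omega>
      proof -
        have "{u \<in> {0..r}. (u, \<omega>) \<in> A} = (if \<omega> \<in> B then {s<..min t r} else {})"
          using 2 by auto
        then show ?thesis using that r True 2 kernel_Ioc[OF \<mu>, of \<omega> s "min t r"]
          by (auto simp: space_F)
      qed
      have "B \<in> sets (F r)" using sets_F_mono[of s r] 2 True by auto
      moreover have "(\<lambda>\<omega>. emeasure (\<mu> \<omega>) {0..s}) \<in> borel_measurable (F r)"
        using measurable_F_mono[OF _ True \<mu>D(4)] 2 by simp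
      moreover have "(\<lambda>\<omega>. emeasure (\<mu> \<omega>) {0..min t r}) \<in> borel_measurable (F r)"
        using measurable_F_mono[OF _ _ \<mu>D(4), of "min t r" r] 2 r by simp
      ultimately have "(\<lambda>\<omega>. (emeasure (\<mu> \<omega>) {0..min t r} - emeasure (\<mu> \<omega>) {0..s}) * indicator B \<omega>)
          \<in> borel_measurable (F r)" by measurable
      then show ?thesis by (intro iffD2[OF measurable_cong, OF eq])
    qed
  qed
next
  case empty
  then show ?case by simp
next
  case (compl A)
  have eq: "emeasure (\<mu> \<omega>) {u \<in> {0..r}. (u, \<omega>) \<in> {0..} \<times> space M - A}
      = emeasure (\<mu> \<omega>) {0..r} - emeasure (\<mu> \<omega>) {u \<in> {0..r}. (u, \<omega>) \<in> A}"
    if "\<omega> \<in> space (F r)" for \<omega>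
  proof -
    have \<omega>: "\<omega> \<in> space M" using that r by (simp add: space_F)
    have "{u \<in> {0..r}. (u, \<omega>) \<in> {0..} \<times> space M - A} = {0..r} - {u \<in> {0..r}. (u, \<omega>) \<in> A}"
      using \<omega> by auto
    moreover have "emeasure (\<mu> \<omega>) {u \<in> {0..r}. (u, \<omega>) \<in> A} \<le> emeasure (\<mu> \<omega>) {0..r}"
      using adapted_kernelD(1)[OF \<mu> \<omega>] by (intro emeasure_mono) auto
    then have "emeasure (\<mu> \<omega>) {u \<in> {0..r}. (u, \<omega>) \<in> A} \<noteq> \<infinity>"
      using adapted_kernelD(3)[OF \<mu> \<omega> r] by (auto simp: top_unique)
    ultimately show ?thesis
      using section_sets[OF _ \<omega>, of A r] compl adapted_kernelD(1)[OF \<mu> \<omega>]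
      by (simp add: sets_P emeasure_Diff subset_eq)
  qed
  show ?case using compl(2) adapted_kernelD(4)[OF \<mu> r]
    by (intro iffD2[OF measurable_cong, OF eq] borel_measurable_minus_ennreal)
next
  case (union A)
  have eq: "emeasure (\<mu> \<omega>) {u \<in> {0..r}. (u, \<omega>) \<in> (\<Union>i. A i)}
      = (\<Sum>i. emeasure (\<mu> \<omega>) {u \<in> {0..r}. (u, \<omega>) \<in> A i})"
    if "\<omega> \<in> space (F r)" for \<omega>
  proof -
    have \<omega>: "\<omega> \<in> space M" using that r by (simp add: space_F)
    have "{u \<in> {0..r}. (u, \<omega>) \<in> (\<Union>i. A i)} = (\<Union>i. {u \<in> {0..r}. (u, \<omega>) \<in> A i})"
      by auto
    moreover have "range (\<lambda>i. {u \<in> {0..r}. (u, \<omega>) \<in> A i}) \<subseteq> sets (\<mu> \<omega>)"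
      using section_sets[OF _ \<omega>] union(2) adapted_kernelD(1)[OF \<mu> \<omega>] by (auto simp: sets_P)
    moreover have "disjoint_family (\<lambda>i. {u \<in> {0..r}. (u, \<omega>) \<in> A i})"
      using union(1) by (fastforce simp: disjoint_family_on_def)
    ultimately show ?thesis by (simp add: suminf_emeasure)
  qed
  show ?case using union(3) by (intro iffD2[OF measurable_cong, OF eq] borel_measurable_suminf_order)
qed

lemma kernel_nn_integral_measurable:
  fixes H :: "real \<times> 'a \<Rightarrow> ennreal"
  assumes \<mu>: "adapted_kernel \<mu>" and r: "0 \<le> r" and H: "H \<in> borel_measurable P"
  shows "(\<lambda>\<omega>. \<integral>\<^sup>+u\<in>{0..r}. H (u, \<omega>) \<partial>\<mu> \<omega>) \<in> borel_measurable (F r)"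
  using H
proof (induction rule: borel_measurable_induct)
  case (cong f g)
  have eq: "(\<integral>\<^sup>+u\<in>{0..r}. f (u, \<omega>) \<partial>\<mu> \<omega>) = (\<integral>\<^sup>+u\<in>{0..r}. g (u, \<omega>) \<partial>\<mu> \<omega>)" if "\<omega> \<in> space (F r)" for \<omega>
    using cong(3) that r by (intro nn_integral_cong) (auto simp: space_F space_P indicator_def)
  show ?case by (intro iffD2[OF measurable_cong, OF eq] cong(4))
next
  case (set A)
  have eq: "(\<integral>\<^sup>+u\<in>{0..r}. indicator A (u, \<omega>) \<partial>\<mu> \<omega>) = emeasure (\<mu> \<omega>) {u \<in> {0..r}. (u, \<omega>) \<in> A}"
    if "\<omega> \<in> space (F r)" for \<omega>
  proof -
    have \<omega>: "\<omega> \<in> space M" using that r by (simp add: space_F)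
    have "(\<integral>\<^sup>+u\<in>{0..r}. indicator A (u, \<omega>) \<partial>\<mu> \<omega>)
       = (\<integral>\<^sup>+u. indicator {u \<in> {0..r}. (u, \<omega>) \<in> A} u \<partial>\<mu> \<omega>)"
      by (intro nn_integral_cong) (auto simp: indicator_def)
    then show ?thesis
      using section_sets[OF set \<omega>] adapted_kernelD(1)[OF \<mu> \<omega>] by simp
  qed
  show ?case by (intro iffD2[OF measurable_cong, OF eq] kernel_set_measurable[OF \<mu> r set])
next
  case (mult u c)
  have eq: "(\<integral>\<^sup>+x\<in>{0..r}. c * u (x, \<omega>) \<partial>\<mu> \<omega>) = c * (\<integral>\<^sup>+x\<in>{0..r}. u (x, \<omega>) \<partial>\<mu> \<omega>)" if "\<omega> \<in> space (F r)" for \<omega>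
  proof -
    have \<omega>: "\<omega> \<in> space M" using that r by (simp add: space_F)
    show ?thesis
      unfolding mult.assoc
      by (intro nn_integral_cmult section_nn_measurable_kernel[OF \<mu> mult(2) \<omega>])
  qed
  show ?case using mult(4) by (intro iffD2[OF measurable_cong, OF eq] borel_measurable_times_ennreal measurable_const) simp_all
next
  case (add u v)
  have eq: "(\<integral>\<^sup>+x\<in>{0..r}. (v (x, \<omega>) + u (x, \<omega>)) \<partial>\<mu> \<omega>)
      = (\<integral>\<^sup>+x\<in>{0..r}. v (x, \<omega>) \<partial>\<mu> \<omega>) + (\<integral>\<^sup>+x\<in>{0..r}. u (x, \<omega>) \<partial>\<mu> \<omega>)" if "\<omega> \<in> space (F r)" for \<omega>
  proof -
    have \<omega>: "\<omega> \<in> space M" using that r by (simp add: space_F)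
    show ?thesis
      unfolding distrib_right
      by (intro nn_integral_add section_nn_measurable_kernel[OF \<mu> _ \<omega>] add)
  qed
  show ?case using add(6,7) by (intro iffD2[OF measurable_cong, OF eq] borel_measurable_add)
next
  case (seq U)
  have eq: "(\<integral>\<^sup>+x\<in>{0..r}. (SUP i. U i) (x, \<omega>) \<partial>\<mu> \<omega>) = (SUP i. \<integral>\<^sup>+x\<in>{0..r}. U i (x, \<omega>) \<partial>\<mu> \<omega>)"
    if "\<omega> \<in> space (F r)" for \<omega>
  proof -
    have \<omega>: "\<omega> \<in> space M" using that r by (simp add: space_F)
    have "(\<integral>\<^sup>+x\<in>{0..r}. (SUP i. U i) (x, \<omega>) \<partial>\<mu> \<omega>)
        = (\<integral>\<^sup>+x. (SUP i. U i (x, \<omega>) * indicator {0..r} x) \<partial>\<mu> \<omega>)"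
      by (intro nn_integral_cong) (simp add: SUP_mult_right_ennreal image_comp)
    also have "\<dots> = (SUP i. \<integral>\<^sup>+x\<in>{0..r}. U i (x, \<omega>) \<partial>\<mu> \<omega>)"
      using seq(3) by (intro nn_integral_monotone_convergence_SUP section_nn_measurable_kernel[OF \<mu> seq(1) \<omega>])
        (auto simp: incseq_def le_fun_def intro!: mult_right_mono)
    finally show ?thesis .
  qed
  show ?case using seq(5) by (intro iffD2[OF measurable_cong, OF eq] borel_measurable_SUP) simp_all
qed

lemma section_set_integrable:
  fixes H :: "real \<times> 'a \<Rightarrow> 'b :: {banach, second_countable_topology}"
  assumes \<mu>: "adapted_kernel \<mu>" and H: "H \<in> borel_measurable P"
    and C: "\<And>t \<omega>. 0 \<le> t \<Longrightarrow> \<omega> \<in> space M \<Longrightarrow> norm (H (t, \<omega>)) \<le> C"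
    and \<omega>: "\<omega> \<in> space M" and r: "0 \<le> r"
  shows "set_integrable (\<mu> \<omega>) {0..r} (\<lambda>u. H (u, \<omega>))"
  unfolding set_integrable_def
proof (rule integrableI_bounded_set[where A="{0..r}" and B=C])
  show "(\<lambda>u. indicator {0..r} u *\<^sub>R H (u, \<omega>)) \<in> borel_measurable (\<mu> \<omega>)"
    using section_scaleR_measurable[OF H \<omega>] measurable_cong_sets[OF adapted_kernelD(1)[OF \<mu> \<omega>] refl]
    by blast
qed (use adapted_kernelD[OF \<mu>] \<omega> r C in auto)

lemma norm_section_set_integral_le:
  fixes H :: "real \<times> 'a \<Rightarrow> 'b :: {banach, second_countable_topology}"
  assumes \<mu>: "adapted_kernel \<mu>" and H: "H \<in> borel_measurable P"
    and C: "\<And>t \<omega>. 0 \<le> t \<Longrightarrow> \<omega> \<in> space M \<Longrightarrow> norm (H (t, \<omega>)) \<le> C"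
    and \<omega>: "\<omega> \<in> space M" and r: "0 \<le> r"
  shows "norm (LINT u:{0..r}|\<mu> \<omega>. H (u, \<omega>)) \<le> C * measure (\<mu> \<omega>) {0..r}"
  by (rule norm_set_integral_le[OF section_set_integrable[OF assms]])
    (use adapted_kernelD[OF \<mu>] \<omega> r C in auto)

text \<open>Adding the bound \<open>C\<close> makes the integrand nonnegative, so that facts about
  nonnegative integrals of predictable functions carry over to bounded signed ones. The surplus is
  \<open>C\<close> times a finite mass.\<close>

lemma section_set_integral_eq:
  fixes H :: "real \<times> 'a \<Rightarrow> real"
  assumes \<mu>: "adapted_kernel \<mu>" and H: "H \<in> borel_measurable P"
    and C: "\<And>t \<omega>. 0 \<le> t \<Longrightarrow> \<omega> \<in> space M \<Longrightarrow> norm (H (t, \<omega>)) \<le> C"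
    and \<omega>: "\<omega> \<in> space M" and r: "0 \<le> r"
  shows "(LINT u:{0..r}|\<mu> \<omega>. H (u, \<omega>))
    = enn2real (\<integral>\<^sup>+u\<in>{0..r}. ennreal (H (u, \<omega>) + C) \<partial>\<mu> \<omega>) - C * measure (\<mu> \<omega>) {0..r}"
    and "(\<integral>\<^sup>+u\<in>{0..r}. ennreal (H (u, \<omega>) + C) \<partial>\<mu> \<omega>) < \<infinity>"
proof -
  have i: "integrable (\<mu> \<omega>) (\<lambda>u. indicator {0..r} u * H (u, \<omega>))"
    using section_set_integrable[OF assms] unfolding set_integrable_def by simp
  have ic: "integrable (\<mu> \<omega>) (\<lambda>u. indicator {0..r} u * C)"
    using adapted_kernelD[OF \<mu>] \<omega> r by auto
  have s: "integrable (\<mu> \<omega>) (\<lambda>u. indicator {0..r} u * H (u, \<omega>) + indicator {0..r} u * C)"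
    by (intro Bochner_Integration.integrable_add i ic)
  have e: "(\<integral>\<^sup>+u\<in>{0..r}. ennreal (H (u, \<omega>) + C) \<partial>\<mu> \<omega>)
      = (\<integral>\<^sup>+u. ennreal (indicator {0..r} u * H (u, \<omega>) + indicator {0..r} u * C) \<partial>\<mu> \<omega>)"
    by (intro nn_integral_cong) (auto simp: indicator_def)
  have p: "0 \<le> indicator {0..r} u * H (u, \<omega>) + indicator {0..r} u * C" for u
    using C[of u \<omega>] \<omega> by (auto simp: indicator_def)
  have "(LINT u|\<mu> \<omega>. indicator {0..r} u * H (u, \<omega>) + indicator {0..r} u * C)
      = enn2real (\<integral>\<^sup>+u\<in>{0..r}. ennreal (H (u, \<omega>) + C) \<partial>\<mu> \<omega>)"
    unfolding e using s p by (intro integral_eq_nn_integral) auto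
  moreover have "(LINT u|\<mu> \<omega>. indicator {0..r} u * H (u, \<omega>) + indicator {0..r} u * C)
      = (LINT u:{0..r}|\<mu> \<omega>. H (u, \<omega>)) + C * measure (\<mu> \<omega>) {0..r}"
    using adapted_kernelD(1)[OF \<mu> \<omega>] unfolding set_lebesgue_integral_def
    by (subst Bochner_Integration.integral_add[OF i ic]) (simp add: sets_eq_imp_space_eq)
  ultimately show "(LINT u:{0..r}|\<mu> \<omega>. H (u, \<omega>))
    = enn2real (\<integral>\<^sup>+u\<in>{0..r}. ennreal (H (u, \<omega>) + C) \<partial>\<mu> \<omega>) - C * measure (\<mu> \<omega>) {0..r}" by simp
  show "(\<integral>\<^sup>+u\<in>{0..r}. ennreal (H (u, \<omega>) + C) \<partial>\<mu> \<omega>) < \<infinity>"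
    unfolding e using s p by (simp add: nn_integral_eq_integral)
qed

lemma kernel_measure_measurable:
  "adapted_kernel \<mu> \<Longrightarrow> 0 \<le> r \<Longrightarrow> (\<lambda>\<omega>. measure (\<mu> \<omega>) {0..r}) \<in> borel_measurable (F r)"
  unfolding measure_def using adapted_kernelD(4) by auto

lemma kernel_integral_measurable_real:
  fixes H :: "real \<times> 'a \<Rightarrow> real"
  assumes \<mu>: "adapted_kernel \<mu>" and r: "0 \<le> r" and H: "H \<in> borel_measurable P"
    and C: "\<And>t \<omega>. 0 \<le> t \<Longrightarrow> \<omega> \<in> space M \<Longrightarrow> norm (H (t, \<omega>)) \<le> C"
  shows "(\<lambda>\<omega>. LINT u:{0..r}|\<mu> \<omega>. H (u, \<omega>)) \<in> borel_measurable (F r)"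
proof -
  have "(\<lambda>\<omega>. \<integral>\<^sup>+u\<in>{0..r}. ennreal (H (u, \<omega>) + C) \<partial>\<mu> \<omega>) \<in> borel_measurable (F r)"
    using kernel_nn_integral_measurable[OF \<mu> r, of "\<lambda>x. ennreal (H x + C)"] H by simp
  then have "(\<lambda>\<omega>. enn2real (\<integral>\<^sup>+u\<in>{0..r}. ennreal (H (u, \<omega>) + C) \<partial>\<mu> \<omega>) - C * measure (\<mu> \<omega>) {0..r})
      \<in> borel_measurable (F r)"
    using kernel_measure_measurable[OF \<mu> r] by simp
  then show ?thesis
    using section_set_integral_eq(1)[OF \<mu> H C _ r] space_F[OF r] by (subst measurable_cong) auto
qed

lemma Re_section_integral:
  fixes H :: "real \<times> 'a \<Rightarrow> complex"
  assumes "adapted_kernel \<mu>" "H \<in> borel_measurable P"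
    "\<And>t \<omega>. 0 \<le> t \<Longrightarrow> \<omega> \<in> space M \<Longrightarrow> norm (H (t, \<omega>)) \<le> C" "\<omega> \<in> space M" "0 \<le> r"
  shows "Re (LINT u:{0..r}|\<mu> \<omega>. H (u, \<omega>)) = (LINT u:{0..r}|\<mu> \<omega>. Re (H (u, \<omega>)))"
    "Im (LINT u:{0..r}|\<mu> \<omega>. H (u, \<omega>)) = (LINT u:{0..r}|\<mu> \<omega>. Im (H (u, \<omega>)))"
  using section_set_integrable[OF assms] unfolding set_integrable_def set_lebesgue_integral_def
  by (simp_all add: integral_Re[symmetric] integral_Im[symmetric] del: integral_Re integral_Im)

lemma kernel_integral_measurable_complex:
  fixes H :: "real \<times> 'a \<Rightarrow> complex"
  assumes \<mu>: "adapted_kernel \<mu>" and r: "0 \<le> r" and H: "H \<in> borel_measurable P"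
    and C: "\<And>t \<omega>. 0 \<le> t \<Longrightarrow> \<omega> \<in> space M \<Longrightarrow> norm (H (t, \<omega>)) \<le> C"
  shows "(\<lambda>\<omega>. LINT u:{0..r}|\<mu> \<omega>. H (u, \<omega>)) \<in> borel_measurable (F r)"
proof -
  have RC: "norm (Re (H (t, \<omega>))) \<le> C" "norm (Im (H (t, \<omega>))) \<le> C" if "0 \<le> t" "\<omega> \<in> space M" for t \<omega>
    using C[OF that] abs_Re_le_cmod[of "H (t, \<omega>)"] abs_Im_le_cmod[of "H (t, \<omega>)"] by auto
  have re: "(\<lambda>\<omega>. LINT u:{0..r}|\<mu> \<omega>. Re (H (u, \<omega>))) \<in> borel_measurable (F r)"
    using kernel_integral_measurable_real[OF \<mu> r, of "\<lambda>x. Re (H x)" C] H RC(1) by simp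
  have im: "(\<lambda>\<omega>. LINT u:{0..r}|\<mu> \<omega>. Im (H (u, \<omega>))) \<in> borel_measurable (F r)"
    using kernel_integral_measurable_real[OF \<mu> r, of "\<lambda>x. Im (H x)" C] H RC(2) by simp
  have eq: "Re (LINT u:{0..r}|\<mu> \<omega>. H (u, \<omega>)) = (LINT u:{0..r}|\<mu> \<omega>. Re (H (u, \<omega>)))"
    "Im (LINT u:{0..r}|\<mu> \<omega>. H (u, \<omega>)) = (LINT u:{0..r}|\<mu> \<omega>. Im (H (u, \<omega>)))"
    if "\<omega> \<in> space (F r)" for \<omega>
    using Re_section_integral[OF \<mu> H C _ r, of \<omega>] that space_F[OF r] by auto
  show ?thesis
    unfolding borel_measurable_complex_iff
    by (intro conjI iffD2[OF measurable_cong, OF eq(1)] iffD2[OF measurable_cong, OF eq(2)] re im)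
qed

end

section \<open>Two random measures with the same mean on predictable integrands\<close>

locale compensated_kernel = filtered_prob_space +
  fixes \<mu> \<nu> :: "'a \<Rightarrow> real measure"
  assumes adapted: "adapted_kernel \<mu>" "adapted_kernel \<nu>"
    and compensates: "\<And>s t A. 0 \<le> s \<Longrightarrow> s \<le> t \<Longrightarrow> A \<in> sets (F s) \<Longrightarrow>
      (\<integral>\<^sup>+\<omega>\<in>A. emeasure (\<mu> \<omega>) {s<..t} \<partial>M) = (\<integral>\<^sup>+\<omega>\<in>A. emeasure (\<nu> \<omega>) {s<..t} \<partial>M)"
    and finite_mean: "\<And>t. 0 \<le> t \<Longrightarrow> (\<integral>\<^sup>+\<omega>. emeasure (\<mu> \<omega>) {0..t} \<partial>M) < \<infinity>"
begin

lemma total_eq: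
  assumes "0 \<le> t"
  shows "(\<integral>\<^sup>+\<omega>. emeasure (\<mu> \<omega>) {0..t} \<partial>M) = (\<integral>\<^sup>+\<omega>. emeasure (\<nu> \<omega>) {0..t} \<partial>M)"
proof -
  have "emeasure (\<kappa> \<omega>) {0..t} = emeasure (\<kappa> \<omega>) {0<..t} * indicator (space M) \<omega>"
    if "adapted_kernel \<kappa>" "\<omega> \<in> space M" for \<kappa> \<omega>
    using kernel_Ioc[OF that order_refl assms] adapted_kernelD(2)[OF that] that by simp
  then have "(\<integral>\<^sup>+\<omega>. emeasure (\<kappa> \<omega>) {0..t} \<partial>M) = (\<integral>\<^sup>+\<omega>\<in>space M. emeasure (\<kappa> \<omega>) {0<..t} \<partial>M)"
    if "adapted_kernel \<kappa>" for \<kappa>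
    using that by (intro nn_integral_cong) blast
  then show ?thesis
    using compensates[OF order_refl assms, of "space M"] adapted sets.top[of "F 0"]
    by (simp add: space_F)
qed

text \<open>Both sides are finite measures in \<open>A\<close>. They agree on strips by
  \<open>compensates\<close>, give no mass to the slice at time 0 and have equal totals by
  \<open>total_eq\<close>; \<open>finite_mean\<close> is what allows complements to be
  subtracted.\<close>

lemma mean_section_eq:
  assumes r: "0 \<le> r" and A: "A \<in> sets P"
  shows "(\<integral>\<^sup>+\<omega>. emeasure (\<mu> \<omega>) {u \<in> {0..r}. (u, \<omega>) \<in> A} \<partial>M)
       = (\<integral>\<^sup>+\<omega>. emeasure (\<nu> \<omega>) {u \<in> {0..r}. (u, \<omega>) \<in> A} \<partial>M)"
  using Int_stable_rectangles rectangles_subset A[unfolded sets_P]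
proof (induction rule: sigma_sets_induct_disjoint)
  case (basic A)
  then consider (1) B where "A = {0} \<times> B"
    | (2) B s t where "A = {s<..t} \<times> B" "0 \<le> s" "s < t" "B \<in> sets (F s)"
    unfolding predictable_rectangles_def by blast
  then show ?case
  proof cases
    case 1
    have "emeasure (\<kappa> \<omega>) {u \<in> {0..r}. (u, \<omega>) \<in> A} = 0" if "adapted_kernel \<kappa>" "\<omega> \<in> space M" for \<kappa> \<omega>
    proof -
      have "emeasure (\<kappa> \<omega>) {u \<in> {0..r}. (u, \<omega>) \<in> A} \<le> emeasure (\<kappa> \<omega>) {0}"
        using adapted_kernelD(1)[OF that] 1 by (intro emeasure_mono) auto
      then show ?thesis using adapted_kernelD(2)[OF that] by simp
    qed
    then show ?thesis using adapted by (simp cong: nn_integral_cong)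
  next
    case 2
    show ?thesis
    proof (cases "s \<le> r")
      case False
      then have e: "{u \<in> {0..r}. (u, \<omega>) \<in> A} = {}" for \<omega> using 2 by auto
      show ?thesis unfolding e by simp
    next
      case True
      have e: "{u \<in> {0..r}. (u, \<omega>) \<in> A} = (if \<omega> \<in> B then {s<..min t r} else {})" for \<omega>
        using 2 by auto
      have "(\<integral>\<^sup>+\<omega>. emeasure (\<kappa> \<omega>) {u \<in> {0..r}. (u, \<omega>) \<in> A} \<partial>M)
          = (\<integral>\<^sup>+\<omega>\<in>B. emeasure (\<kappa> \<omega>) {s<..min t r} \<partial>M)" for \<kappa> :: "'a \<Rightarrow> real measure"
        unfolding e by (intro nn_integral_cong) auto
      then show ?thesis using compensates[of s "min t r" B] 2 True by simp
    qed
  qed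
next
  case empty
  then show ?case by simp
next
  case (compl A)
  have A: "A \<in> sets P" using compl by (simp add: sets_P)
  have le: "emeasure (\<kappa> \<omega>) {u \<in> {0..r}. (u, \<omega>) \<in> A} \<le> emeasure (\<kappa> \<omega>) {0..r}"
    if "adapted_kernel \<kappa>" "\<omega> \<in> space M" for \<kappa> \<omega>
    using adapted_kernelD(1)[OF that] by (intro emeasure_mono) auto
  have eq: "emeasure (\<kappa> \<omega>) {u \<in> {0..r}. (u, \<omega>) \<in> {0..} \<times> space M - A}
      = emeasure (\<kappa> \<omega>) {0..r} - emeasure (\<kappa> \<omega>) {u \<in> {0..r}. (u, \<omega>) \<in> A}"
    if "adapted_kernel \<kappa>" "\<omega> \<in> space M" for \<kappa> \<omega>
  proof -
    have "{u \<in> {0..r}. (u, \<omega>) \<in> {0..} \<times> space M - A} = {0..r} - {u \<in> {0..r}. (u, \<omega>) \<in> A}"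
      using that by auto
    moreover have "emeasure (\<kappa> \<omega>) {u \<in> {0..r}. (u, \<omega>) \<in> A} \<noteq> \<infinity>"
      using le[OF that] adapted_kernelD(3)[OF that r] by (auto simp: top_unique)
    ultimately show ?thesis
      using section_sets[OF A that(2), of r] adapted_kernelD(1)[OF that]
      by (simp add: emeasure_Diff subset_eq)
  qed
  have d: "(\<integral>\<^sup>+\<omega>. emeasure (\<kappa> \<omega>) {u \<in> {0..r}. (u, \<omega>) \<in> {0..} \<times> space M - A} \<partial>M)
    = (\<integral>\<^sup>+\<omega>. emeasure (\<kappa> \<omega>) {0..r} \<partial>M) - (\<integral>\<^sup>+\<omega>. emeasure (\<kappa> \<omega>) {u \<in> {0..r}. (u, \<omega>) \<in> A} \<partial>M)"
    if \<kappa>: "adapted_kernel \<kappa>" and f: "(\<integral>\<^sup>+\<omega>. emeasure (\<kappa> \<omega>) {0..r} \<partial>M) < \<infinity>" for \<kappa>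
  proof -
    have "(\<integral>\<^sup>+\<omega>. emeasure (\<kappa> \<omega>) {u \<in> {0..r}. (u, \<omega>) \<in> A} \<partial>M)
        \<le> (\<integral>\<^sup>+\<omega>. emeasure (\<kappa> \<omega>) {0..r} \<partial>M)"
      by (intro nn_integral_mono le[OF \<kappa>])
    then have "(\<integral>\<^sup>+\<omega>. emeasure (\<kappa> \<omega>) {u \<in> {0..r}. (u, \<omega>) \<in> A} \<partial>M) \<noteq> \<infinity>"
      using f by (auto simp: top_unique)
    moreover have "(\<integral>\<^sup>+\<omega>. emeasure (\<kappa> \<omega>) {u \<in> {0..r}. (u, \<omega>) \<in> {0..} \<times> space M - A} \<partial>M)
      = (\<integral>\<^sup>+\<omega>. emeasure (\<kappa> \<omega>) {0..r} - emeasure (\<kappa> \<omega>) {u \<in> {0..r}. (u, \<omega>) \<in> A} \<partial>M)"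
      by (intro nn_integral_cong eq[OF \<kappa>])
    ultimately show ?thesis
      using measurable_F_M[OF r adapted_kernelD(4)[OF \<kappa> r]]
        measurable_F_M[OF r kernel_set_measurable[OF \<kappa> r A]] le[OF \<kappa>]
      by (subst (asm) nn_integral_diff) auto
  qed
  show ?case using d[OF adapted(1)] d[OF adapted(2)] finite_mean[OF r] total_eq[OF r] compl by simp
next
  case (union A)
  have A: "A i \<in> sets P" for i using union(2) by (auto simp: sets_P)
  have eq: "(\<integral>\<^sup>+\<omega>. emeasure (\<kappa> \<omega>) {u \<in> {0..r}. (u, \<omega>) \<in> (\<Union>i. A i)} \<partial>M)
      = (\<Sum>i. \<integral>\<^sup>+\<omega>. emeasure (\<kappa> \<omega>) {u \<in> {0..r}. (u, \<omega>) \<in> A i} \<partial>M)"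
    if \<kappa>: "adapted_kernel \<kappa>" for \<kappa>
  proof -
    have "emeasure (\<kappa> \<omega>) {u \<in> {0..r}. (u, \<omega>) \<in> (\<Union>i. A i)}
      = (\<Sum>i. emeasure (\<kappa> \<omega>) {u \<in> {0..r}. (u, \<omega>) \<in> A i})"
      if \<omega>: "\<omega> \<in> space M" for \<omega>
    proof -
      have "{u \<in> {0..r}. (u, \<omega>) \<in> (\<Union>i. A i)} = (\<Union>i. {u \<in> {0..r}. (u, \<omega>) \<in> A i})"
        by auto
      moreover have "range (\<lambda>i. {u \<in> {0..r}. (u, \<omega>) \<in> A i}) \<subseteq> sets (\<kappa> \<omega>)"
        using section_sets[OF A \<omega>] adapted_kernelD(1)[OF \<kappa> \<omega>] by auto
      moreover have "disjoint_family (\<lambda>i. {u \<in> {0..r}. (u, \<omega>) \<in> A i})"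
        using union(1) by (fastforce simp: disjoint_family_on_def)
      ultimately show ?thesis by (simp add: suminf_emeasure)
    qed
    then have "(\<integral>\<^sup>+\<omega>. emeasure (\<kappa> \<omega>) {u \<in> {0..r}. (u, \<omega>) \<in> (\<Union>i. A i)} \<partial>M)
      = (\<integral>\<^sup>+\<omega>. (\<Sum>i. emeasure (\<kappa> \<omega>) {u \<in> {0..r}. (u, \<omega>) \<in> A i}) \<partial>M)"
      by (intro nn_integral_cong)
    then show ?thesis
      using measurable_F_M[OF r kernel_set_measurable[OF \<kappa> r A]] by (simp add: nn_integral_suminf)
  qed
  show ?case unfolding eq[OF adapted(1)] eq[OF adapted(2)] using union(3) by simp
qed

lemma mean_nn_integral_eq:
  fixes H :: "real \<times> 'a \<Rightarrow> ennreal"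
  assumes r: "0 \<le> r" and H: "H \<in> borel_measurable P"
  shows "(\<integral>\<^sup>+\<omega>. (\<integral>\<^sup>+u\<in>{0..r}. H (u, \<omega>) \<partial>\<mu> \<omega>) \<partial>M) = (\<integral>\<^sup>+\<omega>. (\<integral>\<^sup>+u\<in>{0..r}. H (u, \<omega>) \<partial>\<nu> \<omega>) \<partial>M)"
  using H
proof (induction rule: borel_measurable_induct)
  case (cong f g)
  have "(\<integral>\<^sup>+\<omega>. (\<integral>\<^sup>+u\<in>{0..r}. f (u, \<omega>) \<partial>\<kappa> \<omega>) \<partial>M) = (\<integral>\<^sup>+\<omega>. (\<integral>\<^sup>+u\<in>{0..r}. g (u, \<omega>) \<partial>\<kappa> \<omega>) \<partial>M)"
    for \<kappa> :: "'a \<Rightarrow> real measure"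
    using cong(3) by (intro nn_integral_cong) (auto simp: space_P indicator_def)
  then show ?case using cong(4) by simp
next
  case (set A)
  have "(\<integral>\<^sup>+\<omega>. (\<integral>\<^sup>+u\<in>{0..r}. indicator A (u, \<omega>) \<partial>\<kappa> \<omega>) \<partial>M)
      = (\<integral>\<^sup>+\<omega>. emeasure (\<kappa> \<omega>) {u \<in> {0..r}. (u, \<omega>) \<in> A} \<partial>M)" if \<kappa>: "adapted_kernel \<kappa>" for \<kappa>
  proof (intro nn_integral_cong)
    fix \<omega> assume \<omega>: "\<omega> \<in> space M"
    have "(\<integral>\<^sup>+u\<in>{0..r}. indicator A (u, \<omega>) \<partial>\<kappa> \<omega>)
       = (\<integral>\<^sup>+u. indicator {u \<in> {0..r}. (u, \<omega>) \<in> A} u \<partial>\<kappa> \<omega>)"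
      by (intro nn_integral_cong) (auto simp: indicator_def)
    then show "(\<integral>\<^sup>+u\<in>{0..r}. indicator A (u, \<omega>) \<partial>\<kappa> \<omega>) = emeasure (\<kappa> \<omega>) {u \<in> {0..r}. (u, \<omega>) \<in> A}"
      using section_sets[OF set \<omega>] adapted_kernelD(1)[OF \<kappa> \<omega>] by simp
  qed
  then show ?case using mean_section_eq[OF r set] adapted by simp
next
  case (mult u c)
  have "(\<integral>\<^sup>+\<omega>. (\<integral>\<^sup>+x\<in>{0..r}. c * u (x, \<omega>) \<partial>\<kappa> \<omega>) \<partial>M) = c * (\<integral>\<^sup>+\<omega>. (\<integral>\<^sup>+x\<in>{0..r}. u (x, \<omega>) \<partial>\<kappa> \<omega>) \<partial>M)"
    if \<kappa>: "adapted_kernel \<kappa>" for \<kappa>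
  proof -
    have "(\<integral>\<^sup>+\<omega>. (\<integral>\<^sup>+x\<in>{0..r}. c * u (x, \<omega>) \<partial>\<kappa> \<omega>) \<partial>M) = (\<integral>\<^sup>+\<omega>. c * (\<integral>\<^sup>+x\<in>{0..r}. u (x, \<omega>) \<partial>\<kappa> \<omega>) \<partial>M)"
      unfolding mult.assoc
      by (intro nn_integral_cong nn_integral_cmult section_nn_measurable_kernel[OF \<kappa> mult(2)])
    also have "\<dots> = c * (\<integral>\<^sup>+\<omega>. (\<integral>\<^sup>+x\<in>{0..r}. u (x, \<omega>) \<partial>\<kappa> \<omega>) \<partial>M)"
      by (intro nn_integral_cmult measurable_F_M[OF r kernel_nn_integral_measurable[OF \<kappa> r mult(2)]])
    finally show ?thesis .
  qed
  then show ?case using mult(4) adapted by simp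
next
  case (add u v)
  have "(\<integral>\<^sup>+\<omega>. (\<integral>\<^sup>+x\<in>{0..r}. (v (x, \<omega>) + u (x, \<omega>)) \<partial>\<kappa> \<omega>) \<partial>M)
     = (\<integral>\<^sup>+\<omega>. (\<integral>\<^sup>+x\<in>{0..r}. v (x, \<omega>) \<partial>\<kappa> \<omega>) \<partial>M) + (\<integral>\<^sup>+\<omega>. (\<integral>\<^sup>+x\<in>{0..r}. u (x, \<omega>) \<partial>\<kappa> \<omega>) \<partial>M)"
    if \<kappa>: "adapted_kernel \<kappa>" for \<kappa>
  proof -
    have "(\<integral>\<^sup>+\<omega>. (\<integral>\<^sup>+x\<in>{0..r}. (v (x, \<omega>) + u (x, \<omega>)) \<partial>\<kappa> \<omega>) \<partial>M)
      = (\<integral>\<^sup>+\<omega>. (\<integral>\<^sup>+x\<in>{0..r}. v (x, \<omega>) \<partial>\<kappa> \<omega>) + (\<integral>\<^sup>+x\<in>{0..r}. u (x, \<omega>) \<partial>\<kappa> \<omega>) \<partial>M)"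
      unfolding distrib_right
      by (intro nn_integral_cong nn_integral_add section_nn_measurable_kernel[OF \<kappa>] add)
    also have "\<dots> = (\<integral>\<^sup>+\<omega>. (\<integral>\<^sup>+x\<in>{0..r}. v (x, \<omega>) \<partial>\<kappa> \<omega>) \<partial>M) + (\<integral>\<^sup>+\<omega>. (\<integral>\<^sup>+x\<in>{0..r}. u (x, \<omega>) \<partial>\<kappa> \<omega>) \<partial>M)"
      by (intro nn_integral_add measurable_F_M[OF r kernel_nn_integral_measurable[OF \<kappa> r]] add)
    finally show ?thesis .
  qed
  then show ?case using add(6,7) adapted by simp
next
  case (seq U)
  have "(\<integral>\<^sup>+\<omega>. (\<integral>\<^sup>+x\<in>{0..r}. (SUP i. U i) (x, \<omega>) \<partial>\<kappa> \<omega>) \<partial>M)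
      = (SUP i. \<integral>\<^sup>+\<omega>. (\<integral>\<^sup>+x\<in>{0..r}. U i (x, \<omega>) \<partial>\<kappa> \<omega>) \<partial>M)" if \<kappa>: "adapted_kernel \<kappa>" for \<kappa>
  proof -
    have "(\<integral>\<^sup>+x\<in>{0..r}. (SUP i. U i) (x, \<omega>) \<partial>\<kappa> \<omega>) = (SUP i. \<integral>\<^sup>+x\<in>{0..r}. U i (x, \<omega>) \<partial>\<kappa> \<omega>)"
      if \<omega>: "\<omega> \<in> space M" for \<omega>
    proof -
      have "(\<integral>\<^sup>+x\<in>{0..r}. (SUP i. U i) (x, \<omega>) \<partial>\<kappa> \<omega>)
          = (\<integral>\<^sup>+x. (SUP i. U i (x, \<omega>) * indicator {0..r} x) \<partial>\<kappa> \<omega>)"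
        by (intro nn_integral_cong) (simp add: SUP_mult_right_ennreal image_comp)
      also have "\<dots> = (SUP i. \<integral>\<^sup>+x\<in>{0..r}. U i (x, \<omega>) \<partial>\<kappa> \<omega>)"
        using seq(3) by (intro nn_integral_monotone_convergence_SUP section_nn_measurable_kernel[OF \<kappa> seq(1) \<omega>])
          (auto simp: incseq_def le_fun_def intro!: mult_right_mono)
      finally show ?thesis .
    qed
    then have "(\<integral>\<^sup>+\<omega>. (\<integral>\<^sup>+x\<in>{0..r}. (SUP i. U i) (x, \<omega>) \<partial>\<kappa> \<omega>) \<partial>M)
      = (\<integral>\<^sup>+\<omega>. (SUP i. \<integral>\<^sup>+x\<in>{0..r}. U i (x, \<omega>) \<partial>\<kappa> \<omega>) \<partial>M)"
      by (intro nn_integral_cong)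
    also have "\<dots> = (SUP i. \<integral>\<^sup>+\<omega>. (\<integral>\<^sup>+x\<in>{0..r}. U i (x, \<omega>) \<partial>\<kappa> \<omega>) \<partial>M)"
      using seq(3)
      by (intro nn_integral_monotone_convergence_SUP measurable_F_M[OF r kernel_nn_integral_measurable[OF \<kappa> r]] seq(1))
        (auto simp: incseq_def le_fun_def intro!: mult_right_mono nn_integral_mono)
    finally show ?thesis .
  qed
  then show ?case using seq(5) adapted by simp
qed

lemma integrable_total:
  assumes r: "0 \<le> r"
  shows "integrable M (\<lambda>\<omega>. measure (\<mu> \<omega>) {0..r})" "integrable M (\<lambda>\<omega>. measure (\<nu> \<omega>) {0..r})"
    "(LINT \<omega>|M. measure (\<mu> \<omega>) {0..r}) = (LINT \<omega>|M. measure (\<nu> \<omega>) {0..r})"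
proof -
  have e: "(\<integral>\<^sup>+\<omega>. ennreal (measure (\<kappa> \<omega>) {0..r}) \<partial>M) = (\<integral>\<^sup>+\<omega>. emeasure (\<kappa> \<omega>) {0..r} \<partial>M)"
    if \<kappa>: "adapted_kernel \<kappa>" for \<kappa>
    using adapted_kernelD(3)[OF \<kappa> _ r] by (intro nn_integral_cong) (auto simp: measure_def)
  have m: "(\<lambda>\<omega>. measure (\<kappa> \<omega>) {0..r}) \<in> borel_measurable M" if \<kappa>: "adapted_kernel \<kappa>" for \<kappa>
    using measurable_F_M[OF r kernel_measure_measurable[OF \<kappa> r]] .
  show "integrable M (\<lambda>\<omega>. measure (\<mu> \<omega>) {0..r})" "integrable M (\<lambda>\<omega>. measure (\<nu> \<omega>) {0..r})"
    using e m adapted finite_mean[OF r] total_eq[OF r] by (auto intro!: integrableI_nonneg)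
  show "(LINT \<omega>|M. measure (\<mu> \<omega>) {0..r}) = (LINT \<omega>|M. measure (\<nu> \<omega>) {0..r})"
    using e m adapted total_eq[OF r] by (simp add: integral_eq_nn_integral)
qed

text \<open>The equality of means is \<open>mean_nn_integral_eq\<close> for the shifted integrand
  \<open>H + C\<close>; the surplus terms have equal finite means by \<open>integrable_total\<close>
  and cancel.\<close>

lemma integrable_kernel_integral:
  fixes H :: "real \<times> 'a \<Rightarrow> real"
  assumes r: "0 \<le> r" and H: "H \<in> borel_measurable P"
    and C: "\<And>t \<omega>. 0 \<le> t \<Longrightarrow> \<omega> \<in> space M \<Longrightarrow> norm (H (t, \<omega>)) \<le> C"
  shows "integrable M (\<lambda>\<omega>. LINT u:{0..r}|\<mu> \<omega>. H (u, \<omega>))" (is ?A)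
    "integrable M (\<lambda>\<omega>. LINT u:{0..r}|\<nu> \<omega>. H (u, \<omega>))" (is ?B)
    "(LINT \<omega>|M. (LINT u:{0..r}|\<mu> \<omega>. H (u, \<omega>))) = (LINT \<omega>|M. (LINT u:{0..r}|\<nu> \<omega>. H (u, \<omega>)))" (is ?C)
proof -
  have i: "integrable M (\<lambda>\<omega>. LINT u:{0..r}|\<kappa> \<omega>. H (u, \<omega>))"
    if \<kappa>: "adapted_kernel \<kappa>" and f: "integrable M (\<lambda>\<omega>. measure (\<kappa> \<omega>) {0..r})" for \<kappa>
  proof (rule Bochner_Integration.integrable_bound)
    show "integrable M (\<lambda>\<omega>. C * measure (\<kappa> \<omega>) {0..r})" using f by simp
    show "(\<lambda>\<omega>. LINT u:{0..r}|\<kappa> \<omega>. H (u, \<omega>)) \<in> borel_measurable M"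
      using measurable_F_M[OF r kernel_integral_measurable_real[OF \<kappa> r H C]] .
    show "AE \<omega> in M. norm (LINT u:{0..r}|\<kappa> \<omega>. H (u, \<omega>)) \<le> norm (C * measure (\<kappa> \<omega>) {0..r})"
      using norm_section_set_integral_le[OF \<kappa> H C _ r] abs_ge_self order_trans
      unfolding real_norm_def by (intro AE_I2) blast
  qed
  show iA: ?A and iB: ?B using i adapted integrable_total[OF r] by auto
  let ?G = "\<lambda>\<kappa> \<omega>. \<integral>\<^sup>+u\<in>{0..r}. ennreal (H (u, \<omega>) + C) \<partial>\<kappa> \<omega>"
  have Hm: "(\<lambda>x. ennreal (H x + C)) \<in> borel_measurable P" using H by simp
  have e: "(LINT \<omega>|M. (LINT u:{0..r}|\<kappa> \<omega>. H (u, \<omega>))) + C * (LINT \<omega>|M. measure (\<kappa> \<omega>) {0..r})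
      = enn2real (\<integral>\<^sup>+\<omega>. ?G \<kappa> \<omega> \<partial>M)"
    if \<kappa>: "adapted_kernel \<kappa>" and f: "integrable M (\<lambda>\<omega>. measure (\<kappa> \<omega>) {0..r})" for \<kappa>
  proof -
    have "(LINT \<omega>|M. (LINT u:{0..r}|\<kappa> \<omega>. H (u, \<omega>))) + C * (LINT \<omega>|M. measure (\<kappa> \<omega>) {0..r})
      = (LINT \<omega>|M. (LINT u:{0..r}|\<kappa> \<omega>. H (u, \<omega>)) + C * measure (\<kappa> \<omega>) {0..r})"
      using i[OF \<kappa> f] f by simp
    also have "\<dots> = (LINT \<omega>|M. enn2real (?G \<kappa> \<omega>))"
      using section_set_integral_eq(1)[OF \<kappa> H C _ r] by (intro Bochner_Integration.integral_cong) auto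
    also have "\<dots> = enn2real (\<integral>\<^sup>+\<omega>. ennreal (enn2real (?G \<kappa> \<omega>)) \<partial>M)"
      using measurable_F_M[OF r kernel_nn_integral_measurable[OF \<kappa> r Hm]]
      by (intro integral_eq_nn_integral) auto
    also have "(\<integral>\<^sup>+\<omega>. ennreal (enn2real (?G \<kappa> \<omega>)) \<partial>M) = (\<integral>\<^sup>+\<omega>. ?G \<kappa> \<omega> \<partial>M)"
      using section_set_integral_eq(2)[OF \<kappa> H C _ r] by (intro nn_integral_cong) auto
    finally show ?thesis .
  qed
  show ?C
    using e[OF adapted(1) integrable_total(1)[OF r]] e[OF adapted(2) integrable_total(2)[OF r]]
      mean_nn_integral_eq[OF r Hm] integrable_total(3)[OF r] by simp
qed

lemma integrable_kernel_integral_complex: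
  fixes H :: "real \<times> 'a \<Rightarrow> complex"
  assumes r: "0 \<le> r" and H: "H \<in> borel_measurable P"
    and C: "\<And>t \<omega>. 0 \<le> t \<Longrightarrow> \<omega> \<in> space M \<Longrightarrow> norm (H (t, \<omega>)) \<le> C"
  shows "integrable M (\<lambda>\<omega>. LINT u:{0..r}|\<mu> \<omega>. H (u, \<omega>))" (is ?A)
    "integrable M (\<lambda>\<omega>. LINT u:{0..r}|\<nu> \<omega>. H (u, \<omega>))" (is ?B)
    "(LINT \<omega>|M. (LINT u:{0..r}|\<mu> \<omega>. H (u, \<omega>))) = (LINT \<omega>|M. (LINT u:{0..r}|\<nu> \<omega>. H (u, \<omega>)))" (is ?C)
proof -
  have R: "(\<lambda>x. Re (H x)) \<in> borel_measurable P" "(\<lambda>x. Im (H x)) \<in> borel_measurable P" using H by auto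
  have RC: "norm (Re (H (t, \<omega>))) \<le> C" "norm (Im (H (t, \<omega>))) \<le> C" if "0 \<le> t" "\<omega> \<in> space M" for t \<omega>
    using C[OF that] abs_Re_le_cmod[of "H (t, \<omega>)"] abs_Im_le_cmod[of "H (t, \<omega>)"] by auto
  note re = integrable_kernel_integral[OF r R(1) RC(1)]
  note im = integrable_kernel_integral[OF r R(2) RC(2)]
  note ReIm = Re_section_integral[OF _ H C _ r]
  have i: "integrable M (\<lambda>\<omega>. LINT u:{0..r}|\<kappa> \<omega>. H (u, \<omega>))"
    if \<kappa>: "adapted_kernel \<kappa>" and f: "integrable M (\<lambda>\<omega>. LINT u:{0..r}|\<kappa> \<omega>. Re (H (u, \<omega>)))"
      "integrable M (\<lambda>\<omega>. LINT u:{0..r}|\<kappa> \<omega>. Im (H (u, \<omega>)))" for \<kappa>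
  proof -
    have "integrable M (\<lambda>\<omega>. complex_of_real (LINT u:{0..r}|\<kappa> \<omega>. Re (H (u, \<omega>)))
        + \<i> * complex_of_real (LINT u:{0..r}|\<kappa> \<omega>. Im (H (u, \<omega>))))"
      using f by auto
    moreover have "complex_of_real (LINT u:{0..r}|\<kappa> \<omega>. Re (H (u, \<omega>)))
        + \<i> * complex_of_real (LINT u:{0..r}|\<kappa> \<omega>. Im (H (u, \<omega>))) = (LINT u:{0..r}|\<kappa> \<omega>. H (u, \<omega>))"
      if "\<omega> \<in> space M" for \<omega>
      using ReIm[OF \<kappa> _ _ that] complex_eq[of "LINT u:{0..r}|\<kappa> \<omega>. H (u, \<omega>)"] by simp
    ultimately show ?thesis
      by (subst (asm) Bochner_Integration.integrable_cong[OF refl]) auto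
  qed
  show A: ?A and B: ?B using i[OF adapted(1) re(1) im(1)] i[OF adapted(2) re(2) im(2)] by auto
  have e: "Re (LINT \<omega>|M. (LINT u:{0..r}|\<kappa> \<omega>. H (u, \<omega>))) = (LINT \<omega>|M. (LINT u:{0..r}|\<kappa> \<omega>. Re (H (u, \<omega>))))"
    "Im (LINT \<omega>|M. (LINT u:{0..r}|\<kappa> \<omega>. H (u, \<omega>))) = (LINT \<omega>|M. (LINT u:{0..r}|\<kappa> \<omega>. Im (H (u, \<omega>))))"
    if \<kappa>: "adapted_kernel \<kappa>" and f: "integrable M (\<lambda>\<omega>. LINT u:{0..r}|\<kappa> \<omega>. H (u, \<omega>))" for \<kappa>
    using ReIm[OF \<kappa>] f
    by (simp_all add: integral_Re[symmetric] integral_Im[symmetric] del: integral_Re integral_Im cong: Bochner_Integration.integral_cong)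
  show ?C
    using e[OF adapted(1) A] e[OF adapted(2) B] re(3) im(3) by (simp add: complex_eq_iff)
qed

end

section \<open>Paths of a counting process and their Stieltjes measure\<close>

context
  fixes M :: "'a measure" and N :: "real \<Rightarrow> 'a \<Rightarrow> nat" and \<omega> :: 'a
  assumes N: "counting_process M N" and \<omega>: "\<omega> \<in> space M"
begin

lemma counting_process_mono: "0 \<le> s \<Longrightarrow> s \<le> t \<Longrightarrow> N s \<omega> \<le> N t \<omega>"
  using N \<omega> unfolding counting_process_def by blast

lemma counting_process_0: "N 0 \<omega> = 0"
  using N \<omega> unfolding counting_process_def by blast

lemma counting_process_eventually_at_right:
  assumes "0 \<le> t" shows "\<forall>\<^sub>F u in at_right t. N u \<omega> = N t \<omega>"
proof -
  have "((\<lambda>u. real (N u \<omega>)) \<longlongrightarrow> real (N t \<omega>)) (at_right t)"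
    using N \<omega> assms unfolding counting_process_def continuous_within by blast
  then have "\<forall>\<^sub>F u in at_right t. dist (real (N u \<omega>)) (real (N t \<omega>)) < 1"
    by (rule tendstoD) simp
  then show ?thesis by eventually_elim (simp add: dist_real_def)
qed

lemma frozen_path_mono: "x \<le> y \<Longrightarrow> real (N (max 0 x) \<omega>) \<le> real (N (max 0 y) \<omega>)"
  using counting_process_mono[of "max 0 x" "max 0 y"] by simp

lemma frozen_path_right_continuous: "continuous (at_right a) (\<lambda>t. real (N (max 0 t) \<omega>))"
proof -
  have "\<forall>\<^sub>F u in at_right a. N (max 0 u) \<omega> = N (max 0 a) \<omega>"
  proof (cases "0 \<le> a")
    case True
    have "\<forall>\<^sub>F u in at_right a. a < u" by (simp add: eventually_at_right_less)
    then show ?thesis using counting_process_eventually_at_right[OF True]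
      by eventually_elim (use True in \<open>simp add: max_def\<close>)
  next
    case False
    then have "\<forall>\<^sub>F u in at_right a. u \<in> {a<..<0}"
      by (intro eventually_at_rightI[of a 0]) auto
    then show ?thesis by eventually_elim (use False in auto)
  qed
  then show ?thesis unfolding continuous_within by (intro tendsto_eventually) simp
qed

lemma emeasure_dN_Ioc:
  assumes "0 \<le> a" "a \<le> b" shows "emeasure (dN N \<omega>) {a<..b} = ennreal (real (N b \<omega>) - real (N a \<omega>))"
  unfolding dN_def using assms
  by (subst emeasure_interval_measure_Ioc[OF _ frozen_path_mono frozen_path_right_continuous]) auto

lemma emeasure_dN_atMost_0: "emeasure (dN N \<omega>) {-1<..0} = 0"
  unfolding dN_def
  by (subst emeasure_interval_measure_Ioc[OF _ frozen_path_mono frozen_path_right_continuous]) auto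

lemma sets_dN [simp]: "sets (dN N \<omega>) = sets borel"
  by (simp add: dN_def)

lemma space_dN [simp]: "space (dN N \<omega>) = UNIV"
  by (simp add: dN_def)

lemma emeasure_dN_0: "emeasure (dN N \<omega>) {0} = 0"
proof -
  have "emeasure (dN N \<omega>) {0} \<le> emeasure (dN N \<omega>) {-1<..0}" by (intro emeasure_mono) auto
  then show ?thesis by (simp add: emeasure_dN_atMost_0)
qed

lemma emeasure_dN_Icc:
  assumes "0 \<le> t" shows "emeasure (dN N \<omega>) {0..t} = ennreal (real (N t \<omega>))"
proof -
  have "{0..t} = {0} \<union> {0<..t}" using assms by auto
  then have "emeasure (dN N \<omega>) {0..t} = emeasure (dN N \<omega>) {0} + emeasure (dN N \<omega>) {0<..t}"
    by (simp add: plus_emeasure)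
  then show ?thesis using emeasure_dN_Ioc[OF order_refl assms] emeasure_dN_0 counting_process_0 by simp
qed

text \<open>The time \<tau> is the infimum of the times at which the path exceeds
  \<open>N s \<omega>\<close>. Right continuity of an integer-valued path makes the excess already
  present at \<tau>, and the unit bound on jumps, read from the left of \<tau>, makes it exactly
  1.\<close>

lemma counting_process_first_jump:
  assumes "0 \<le> s" "s \<le> t" and lt: "N s \<omega> < N t \<omega>"
  obtains \<tau> where "s < \<tau>" "\<tau> \<le> t" "\<And>u. s \<le> u \<Longrightarrow> u < \<tau> \<Longrightarrow> N u \<omega> = N s \<omega>" "N \<tau> \<omega> = N s \<omega> + 1"
proof -
  define T where "T = {u. s \<le> u \<and> N s \<omega> < N u \<omega>}"
  define \<tau> where "\<tau> = Inf T"
  have tT: "t \<in> T" using assms by (simp add: T_def)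
  have bdd: "bdd_below T" by (intro bdd_belowI[of _ s]) (simp add: T_def)
  have \<tau>t: "\<tau> \<le> t" unfolding \<tau>_def by (rule cInf_lower[OF tT bdd])
  have s\<tau>: "s \<le> \<tau>" unfolding \<tau>_def by (rule cInf_greatest) (use tT in \<open>auto simp: T_def\<close>)
  have before: "N u \<omega> = N s \<omega>" if "s \<le> u" "u < \<tau>" for u
  proof -
    have "u \<notin> T" using cInf_lower[OF _ bdd, of u] that by (auto simp: \<tau>_def)
    then show ?thesis using that counting_process_mono[of s u] assms by (simp add: T_def)
  qed
  obtain d where d: "\<tau> < d" "\<And>y. \<tau> < y \<Longrightarrow> y < d \<Longrightarrow> N y \<omega> = N \<tau> \<omega>"
    using counting_process_eventually_at_right[of \<tau>] s\<tau> assms(1)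
    unfolding eventually_at_right[OF less_add_one] by (metis order_trans)
  \<comment> \<open>A point of \<open>T\<close> lies so close to \<tau> that the path has the same
    value there as at \<tau>.\<close>
  obtain u where u: "u \<in> T" "u < d"
    using cInf_lessD[of T d] d(1) tT unfolding \<tau>_def by blast
  have "\<tau> \<le> u" unfolding \<tau>_def by (rule cInf_lower[OF u(1) bdd])
  then have "N u \<omega> = N \<tau> \<omega>" using d(2)[of u] u by (cases "u = \<tau>") auto
  then have gt: "N s \<omega> < N \<tau> \<omega>" using u by (simp add: T_def)
  then have s\<tau>': "s < \<tau>" using s\<tau> by (cases "s = \<tau>") auto
  have "\<forall>\<^sub>F u in at_left \<tau>. N \<tau> \<omega> \<le> N u \<omega> + 1"
    using N \<omega> s\<tau>' assms(1) unfolding counting_process_def by (metis le_less_trans)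
  moreover have "\<forall>\<^sub>F u in at_left \<tau>. u \<in> {s<..<\<tau>}"
    using s\<tau>' by (rule eventually_at_leftI[rotated]) auto
  ultimately have "\<forall>\<^sub>F u in at_left \<tau>. N \<tau> \<omega> \<le> N s \<omega> + 1"
  proof eventually_elim
    case (elim u)
    then show ?case using before[of u] by simp
  qed
  then have "N \<tau> \<omega> = N s \<omega> + 1" using gt by (simp add: trivial_limit_at_left_real)
  then show thesis using that s\<tau>' \<tau>t before by blast
qed

text \<open>On \<open>{s<..t}\<close> the measure \<open>dN\<close> is a unit mass at the jump time.
  Measurability is assumed of the cut-off function only, because sections of predictable functions
  are uncontrolled at negative times.\<close>

lemma dN_single_jump:
  assumes "0 \<le> s" "s \<le> t" and one: "N t \<omega> = N s \<omega> + 1"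
  obtains \<tau> where "s < \<tau>" "\<tau> \<le> t"
    "\<And>f :: real \<Rightarrow> 'b :: {banach, second_countable_topology}.
       (\<lambda>u. indicator {s<..t} u *\<^sub>R f u) \<in> borel_measurable borel \<Longrightarrow> (LINT u:{s<..t}|dN N \<omega>. f u) = f \<tau>"
proof -
  have "N s \<omega> < N t \<omega>" using one by simp
  then obtain \<tau> where \<tau>: "s < \<tau>" "\<tau> \<le> t" "\<And>u. s \<le> u \<Longrightarrow> u < \<tau> \<Longrightarrow> N u \<omega> = N s \<omega>" "N \<tau> \<omega> = N s \<omega> + 1"
    using counting_process_first_jump[OF assms(1,2)] by blast
  have n1: "{\<tau><..t} \<in> null_sets (dN N \<omega>)"
    using emeasure_dN_Ioc[of \<tau> t] \<tau>(1,2,4) assms by (auto simp: null_sets_def)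
  \<comment> \<open>The open interval before \<tau> is exhausted by countably many half-open
    intervals with rational right ends, each without a jump.\<close>
  have n2: "(\<Union>q\<in>{q\<in>\<rat>. s < q \<and> q < \<tau>}. {s<..q}) \<in> null_sets (dN N \<omega>)"
  proof (rule null_sets_UN')
    show "countable {q\<in>\<rat>. s < q \<and> q < \<tau>}" by (rule countable_subset[OF _ countable_rat]) auto
    show "{s<..q} \<in> null_sets (dN N \<omega>)" if "q \<in> {q\<in>\<rat>. s < q \<and> q < \<tau>}" for q
      using emeasure_dN_Ioc[of s q] \<tau>(3)[of q] that assms by (auto simp: null_sets_def)
  qed
  have "{s<..<\<tau>} \<subseteq> (\<Union>q\<in>{q\<in>\<rat>. s < q \<and> q < \<tau>}. {s<..q})"
  proof
    fix u assume "u \<in> {s<..<\<tau>}"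
    moreover from this obtain q where "q \<in> \<rat>" "u < q" "q < \<tau>" using Rats_dense_in_real[of u \<tau>] by auto
    ultimately show "u \<in> (\<Union>q\<in>{q\<in>\<rat>. s < q \<and> q < \<tau>}. {s<..q})"
      by (intro UN_I[of q]) auto
  qed
  moreover have "{s<..t} - {\<tau>} \<subseteq> {\<tau><..t} \<union> {s<..<\<tau>}" by auto
  ultimately have "{s<..t} - {\<tau>} \<subseteq> {\<tau><..t} \<union> (\<Union>q\<in>{q\<in>\<rat>. s < q \<and> q < \<tau>}. {s<..q})"
    by blast
  then have n3: "{s<..t} - {\<tau>} \<in> null_sets (dN N \<omega>)"
    by (intro null_sets_subset[OF null_sets.Un[OF n1 n2]]) auto
  then have ae: "AE u in dN N \<omega>. u \<notin> {s<..t} - {\<tau>}" by (rule AE_not_in)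
  have "emeasure (dN N \<omega>) {s<..t} = emeasure (dN N \<omega>) ({\<tau>} \<union> ({s<..t} - {\<tau>}))"
    using \<tau>(1,2) by (intro arg_cong[where f="emeasure (dN N \<omega>)"]) auto
  also have "\<dots> = emeasure (dN N \<omega>) {\<tau>}"
    using n3 by (intro emeasure_Un_null_set) auto
  finally have e1: "emeasure (dN N \<omega>) {\<tau>} = 1"
    using emeasure_dN_Ioc[of s t] one assms by simp
  have "(LINT u:{s<..t}|dN N \<omega>. f u) = f \<tau>"
    if m: "(\<lambda>u. indicator {s<..t} u *\<^sub>R f u) \<in> borel_measurable borel"
    for f :: "real \<Rightarrow> 'b"
  proof -
    have "(LINT u:{s<..t}|dN N \<omega>. f u) = (LINT u|dN N \<omega>. indicator {\<tau>} u *\<^sub>R f \<tau>)"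
      unfolding set_lebesgue_integral_def
    proof (rule integral_cong_AE)
      show "(\<lambda>u. indicator {s<..t} u *\<^sub>R f u) \<in> borel_measurable (dN N \<omega>)"
        using m measurable_cong_sets[OF sets_dN refl] by blast
      show "AE u in dN N \<omega>. indicator {s<..t} u *\<^sub>R f u = indicator {\<tau>} u *\<^sub>R f \<tau>"
        using ae \<tau>(1,2) by (auto simp: indicator_def)
      show "(\<lambda>u. indicator {\<tau>} u *\<^sub>R f \<tau>) \<in> borel_measurable (dN N \<omega>)"
        by (intro borel_measurable_scaleR borel_measurable_indicator borel_measurable_const) simp
    qed
    also have "\<dots> = f \<tau>" using e1 by (simp add: measure_def)
    finally show ?thesis .
  qed
  then show thesis using that \<tau> by blast
qed

end

section \<open>Counting processes with a bounded intensity\<close>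

locale counting_intensity = filtered_prob_space M F for M :: "'a measure" and F +
  fixes N :: "real \<Rightarrow> 'a \<Rightarrow> nat" and lam :: "real \<Rightarrow> 'a \<Rightarrow> real" and c :: real
  assumes counting: "counting_process M N"
    and N_adapted: "0 \<le> t \<Longrightarrow> N t \<in> F t \<rightarrow>\<^sub>M count_space UNIV"
    and lam_measurable: "(\<lambda>(t, \<omega>). lam t \<omega>) \<in> borel_measurable P"
    and lam_nonneg: "0 \<le> t \<Longrightarrow> \<omega> \<in> space M \<Longrightarrow> 0 \<le> lam t \<omega>"
    and lam_le: "0 \<le> t \<Longrightarrow> \<omega> \<in> space M \<Longrightarrow> lam t \<omega> \<le> c"
    and c_nonneg: "0 \<le> c"
    and martingale: "martingale M F (\<lambda>t \<omega>. real (N t \<omega>) -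
      measure (density lborel (\<lambda>u. indicator {0..} u * ennreal (lam u \<omega>))) {0..t})"
begin

definition Lam :: "'a \<Rightarrow> real measure" where
  "Lam \<omega> = density lborel (\<lambda>u. indicator {0..} u * ennreal (lam u \<omega>))"

lemma sets_Lam [simp]: "sets (Lam \<omega>) = sets borel"
  by (simp add: Lam_def)

lemma space_Lam [simp]: "space (Lam \<omega>) = UNIV"
  by (simp add: Lam_def)

lemma density_measurable:
  assumes "\<omega> \<in> space M" shows "(\<lambda>u. indicator {0..} u * ennreal (lam u \<omega>)) \<in> borel_measurable borel"
proof -
  have "(\<lambda>u. lam (max 0 u) \<omega>) \<in> borel_measurable borel"
    using section_measurable[OF lam_measurable assms] by simp
  then have "(\<lambda>u. indicator {0..} u * ennreal (lam (max 0 u) \<omega>)) \<in> borel_measurable borel" by measurable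
  moreover have "(\<lambda>u. indicator {0..} u * ennreal (lam (max 0 u) \<omega>)) = (\<lambda>u. indicator {0..} u * ennreal (lam u \<omega>))"
    by (auto simp: fun_eq_iff indicator_def max_def)
  ultimately show ?thesis by simp
qed

lemma emeasure_Lam_le:
  assumes \<omega>: "\<omega> \<in> space M" and A: "A \<in> sets borel" "A \<subseteq> {a..b}" and "a \<le> b"
  shows "emeasure (Lam \<omega>) A \<le> ennreal (c * (b - a))"
proof -
  have "emeasure (Lam \<omega>) A = (\<integral>\<^sup>+u\<in>A. (indicator {0..} u * ennreal (lam u \<omega>)) \<partial>lborel)"
    unfolding Lam_def using density_measurable[OF \<omega>] A by (intro emeasure_density) auto
  also have "\<dots> \<le> (\<integral>\<^sup>+u. ennreal c * indicator {a..b} u \<partial>lborel)"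
    using lam_le[OF _ \<omega>] A by (intro nn_integral_mono) (auto simp: indicator_def ennreal_leI)
  also have "\<dots> = ennreal (c * (b - a))"
    using \<open>a \<le> b\<close> c_nonneg by (simp add: nn_integral_cmult_indicator ennreal_mult)
  finally show ?thesis .
qed

lemma emeasure_Lam_0: "\<omega> \<in> space M \<Longrightarrow> emeasure (Lam \<omega>) {0} = 0"
  using emeasure_Lam_le[of \<omega> "{0}" 0 0] by simp

lemma measure_Lam_le:
  assumes "\<omega> \<in> space M" "A \<in> sets borel" "A \<subseteq> {a..b}" "a \<le> b"
  shows "measure (Lam \<omega>) A \<le> c * (b - a)"
  using emeasure_Lam_le[OF assms] c_nonneg \<open>a \<le> b\<close> unfolding measure_def
  by (intro enn2real_leI) auto

lemma emeasure_Lam_finite: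
  assumes "\<omega> \<in> space M" "A \<in> sets borel" "A \<subseteq> {a..b}" "a \<le> b" shows "emeasure (Lam \<omega>) A < \<infinity>"
  using emeasure_Lam_le[OF assms] by (auto simp: top_unique less_top[symmetric])

lemma N_measurable: "0 \<le> t \<Longrightarrow> (\<lambda>\<omega>. real (N t \<omega>)) \<in> borel_measurable (F t)"
  using measurable_compose[OF N_adapted, of t real borel] by simp

lemma martingale_Lam: "martingale M F (\<lambda>t \<omega>. real (N t \<omega>) - measure (Lam \<omega>) {0..t})"
  using martingale unfolding Lam_def .

text \<open>The compensator is the adapted \<open>N\<close> minus an adapted martingale, so its
  adaptedness comes without a Fubini argument on the density.\<close>

lemma measure_Lam_measurable:
  assumes "0 \<le> t" shows "(\<lambda>\<omega>. measure (Lam \<omega>) {0..t}) \<in> borel_measurable (F t)"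
proof -
  have "(\<lambda>\<omega>. real (N t \<omega>) - measure (Lam \<omega>) {0..t}) \<in> borel_measurable (F t)"
    using martingale_Lam assms unfolding martingale_def by blast
  from borel_measurable_diff[OF N_measurable[OF assms] this] show ?thesis by simp
qed

lemma adapted_Lam: "adapted_kernel Lam"
  unfolding adapted_kernel_def
proof (intro conjI ballI allI impI)
  fix t :: real assume t: "0 \<le> t"
  have "emeasure (Lam \<omega>) {0..t} = ennreal (measure (Lam \<omega>) {0..t})" if "\<omega> \<in> space (F t)" for \<omega>
    using emeasure_Lam_finite[of \<omega> "{0..t}" 0 t] that t by (simp add: space_F emeasure_eq_ennreal_measure)
  then show "(\<lambda>\<omega>. emeasure (Lam \<omega>) {0..t}) \<in> borel_measurable (F t)"
    using measure_Lam_measurable[OF t] by (subst measurable_cong) auto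
  show "emeasure (Lam \<omega>) {0..t} < \<infinity>" if "\<omega> \<in> space M" for \<omega>
    using emeasure_Lam_finite[OF that, of "{0..t}" 0 t] t by simp
qed (auto simp: emeasure_Lam_0)

lemma adapted_dN: "adapted_kernel (dN N)"
  unfolding adapted_kernel_def
proof (intro conjI ballI allI impI)
  fix t :: real assume t: "0 \<le> t"
  show "(\<lambda>\<omega>. emeasure (dN N \<omega>) {0..t}) \<in> borel_measurable (F t)"
    using N_measurable[OF t] emeasure_dN_Icc[OF counting _ t] space_F[OF t] by (subst measurable_cong) auto
qed (auto simp: emeasure_dN_0[OF counting] emeasure_dN_Icc[OF counting] sets_dN[OF counting])

lemma integrable_Lam:
  assumes t: "0 \<le> t" shows "integrable M (\<lambda>\<omega>. measure (Lam \<omega>) {0..t})"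
  using measure_Lam_le[of _ "{0..t}" 0 t] t measurable_F_M[OF t measure_Lam_measurable[OF t]]
  by (intro integrable_const_bound[where B="c * t"]) auto

lemma integrable_N:
  assumes t: "0 \<le> t" shows "integrable M (\<lambda>\<omega>. real (N t \<omega>))"
proof -
  have "integrable M (\<lambda>\<omega>. real (N t \<omega>) - measure (Lam \<omega>) {0..t})"
    using martingale_Lam t unfolding martingale_def by blast
  then show ?thesis using integrable_Lam[OF t] Bochner_Integration.integrable_add[of M "\<lambda>\<omega>. measure (Lam \<omega>) {0..t}"
      "\<lambda>\<omega>. real (N t \<omega>) - measure (Lam \<omega>) {0..t}"] by simp
qed

text \<open>This is the martingale property tested on the event \<open>A\<close>. Since
  \<open>N\<close> and the compensator both increase, the signed identity can be restated with
  nonnegative integrals, the form in which rectangles enter the monotone class argument.\<close>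

lemma increment_mean:
  assumes "0 \<le> s" "s \<le> t" and A: "A \<in> sets (F s)"
  shows "(\<integral>\<^sup>+\<omega>\<in>A. emeasure (dN N \<omega>) {s<..t} \<partial>M) = (\<integral>\<^sup>+\<omega>\<in>A. emeasure (Lam \<omega>) {s<..t} \<partial>M)"
proof -
  have t: "0 \<le> t" using assms by simp
  interpret S: finite_measure_subalgebra M "F s"
    by unfold_locales (rule subalg[OF assms(1)])
  let ?Y = "\<lambda>t \<omega>. real (N t \<omega>) - measure (Lam \<omega>) {0..t}"
  have AM: "A \<in> sets M" using sets_F_M[OF assms(1) A] .
  have iY: "integrable M (?Y t)" "integrable M (?Y s)"
    using martingale_Lam t assms(1) unfolding martingale_def by blast+
  have ae: "AE \<omega> in M. real_cond_exp M (F s) (?Y t) \<omega> = ?Y s \<omega>"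
    using martingale_Lam assms unfolding martingale_def by blast
  have "(LINT \<omega>:A|M. ?Y t \<omega>) = (LINT \<omega>:A|M. real_cond_exp M (F s) (?Y t) \<omega>)"
    by (rule S.real_cond_exp_intA[OF iY(1) A])
  also have "\<dots> = (LINT \<omega>:A|M. ?Y s \<omega>)"
    unfolding set_lebesgue_integral_def
    using ae AM iY(2) by (intro integral_cong_AE) auto
  finally have eq: "(LINT \<omega>:A|M. ?Y t \<omega>) = (LINT \<omega>:A|M. ?Y s \<omega>)" .
  let ?n = "\<lambda>\<omega>. indicator A \<omega> * (real (N t \<omega>) - real (N s \<omega>))"
  let ?l = "\<lambda>\<omega>. indicator A \<omega> * (measure (Lam \<omega>) {0..t} - measure (Lam \<omega>) {0..s})"
  have i: "integrable M ?n" "integrable M ?l"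
    using integrable_N[OF t] integrable_N[OF assms(1)] integrable_Lam[OF t] integrable_Lam[OF assms(1)]
      integrable_mult_indicator[OF AM, of "\<lambda>\<omega>. real (N t \<omega>) - real (N s \<omega>)"]
      integrable_mult_indicator[OF AM, of "\<lambda>\<omega>. measure (Lam \<omega>) {0..t} - measure (Lam \<omega>) {0..s}"]
    by auto
  have "(LINT \<omega>|M. ?n \<omega>) - (LINT \<omega>|M. ?l \<omega>) = (LINT \<omega>|M. ?n \<omega> - ?l \<omega>)"
    using i by simp
  also have "\<dots> = (LINT \<omega>|M. indicator A \<omega> *\<^sub>R ?Y t \<omega> - indicator A \<omega> *\<^sub>R ?Y s \<omega>)"
    by (intro Bochner_Integration.integral_cong) (auto simp: algebra_simps)
  also have "\<dots> = 0"
    using eq integrable_mult_indicator[OF AM iY(1)] integrable_mult_indicator[OF AM iY(2)]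
    unfolding set_lebesgue_integral_def by (subst Bochner_Integration.integral_diff) auto
  finally have E: "(LINT \<omega>|M. ?n \<omega>) = (LINT \<omega>|M. ?l \<omega>)" by simp
  have lam_fin: "emeasure (Lam \<omega>) {s<..t} = ennreal (measure (Lam \<omega>) {0..t} - measure (Lam \<omega>) {0..s})"
    and lam_mono: "measure (Lam \<omega>) {0..s} \<le> measure (Lam \<omega>) {0..t}" if \<omega>: "\<omega> \<in> space M" for \<omega>
  proof -
    have f: "emeasure (Lam \<omega>) {0..s} = ennreal (measure (Lam \<omega>) {0..s})"
      "emeasure (Lam \<omega>) {0..t} = ennreal (measure (Lam \<omega>) {0..t})"
      using emeasure_Lam_finite[OF \<omega>, of "{0..s}" 0 s] emeasure_Lam_finite[OF \<omega>, of "{0..t}" 0 t] t assms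
      by (simp_all add: emeasure_eq_ennreal_measure)
    have "emeasure (Lam \<omega>) {0..s} \<le> emeasure (Lam \<omega>) {0..t}" using assms by (intro emeasure_mono) auto
    then show "measure (Lam \<omega>) {0..s} \<le> measure (Lam \<omega>) {0..t}" unfolding f by simp
    show "emeasure (Lam \<omega>) {s<..t} = ennreal (measure (Lam \<omega>) {0..t} - measure (Lam \<omega>) {0..s})"
      unfolding kernel_Ioc[OF adapted_Lam \<omega> assms(1,2)] f by (simp add: ennreal_minus)
  qed
  have "(\<integral>\<^sup>+\<omega>\<in>A. emeasure (dN N \<omega>) {s<..t} \<partial>M) = (\<integral>\<^sup>+\<omega>. ennreal (?n \<omega>) \<partial>M)"
    using emeasure_dN_Ioc[OF counting _ assms(1,2)] by (intro nn_integral_cong) (auto simp: indicator_def)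
  also have "\<dots> = ennreal (LINT \<omega>|M. ?n \<omega>)"
    using i counting_process_mono[OF counting _ assms(1,2)]
    by (intro nn_integral_eq_integral) (auto simp: indicator_def)
  also have "\<dots> = (\<integral>\<^sup>+\<omega>. ennreal (?l \<omega>) \<partial>M)"
    unfolding E using i lam_mono
    by (intro nn_integral_eq_integral[symmetric]) (auto simp: indicator_def)
  also have "\<dots> = (\<integral>\<^sup>+\<omega>\<in>A. emeasure (Lam \<omega>) {s<..t} \<partial>M)"
    using lam_fin by (intro nn_integral_cong) (auto simp: indicator_def)
  finally show ?thesis .
qed

sublocale compensated_kernel M F "dN N" Lam
proof
  show "(\<integral>\<^sup>+\<omega>. emeasure (dN N \<omega>) {0..t} \<partial>M) < \<infinity>" if t: "0 \<le> t" for t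
  proof -
    have "(\<integral>\<^sup>+\<omega>. emeasure (dN N \<omega>) {0..t} \<partial>M) = (\<integral>\<^sup>+\<omega>. ennreal (real (N t \<omega>)) \<partial>M)"
      using emeasure_dN_Icc[OF counting _ t] by (intro nn_integral_cong) auto
    then show ?thesis using integrable_N[OF t] by (simp add: nn_integral_eq_integral)
  qed
qed (fact adapted_dN adapted_Lam increment_mean)+

lemma mean_increment_le:
  assumes "0 \<le> s" "s \<le> t"
  shows "(\<integral>\<^sup>+\<omega>. emeasure (dN N \<omega>) {s<..t} \<partial>M) \<le> ennreal (c * (t - s))"
proof -
  have sub: "{s<..t} \<subseteq> {s..t}" by auto
  have sp: "space M \<in> sets (F s)" using sets.top[of "F s"] space_F[OF assms(1)] by simp
  have "(\<integral>\<^sup>+\<omega>. emeasure (dN N \<omega>) {s<..t} \<partial>M) = (\<integral>\<^sup>+\<omega>\<in>space M. emeasure (dN N \<omega>) {s<..t} \<partial>M)"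
    by (intro nn_integral_cong) auto
  also have "\<dots> = (\<integral>\<^sup>+\<omega>\<in>space M. emeasure (Lam \<omega>) {s<..t} \<partial>M)" by (rule increment_mean[OF assms sp])
  also have "\<dots> \<le> (\<integral>\<^sup>+\<omega>. ennreal (c * (t - s)) \<partial>M)"
    using emeasure_Lam_le[of _ "{s<..t}" s t] assms sub
    by (intro nn_integral_mono) (auto simp: indicator_def)
  finally show ?thesis by (simp add: emeasure_space_1)
qed

text \<open>The part of the interval \<open>{s<..t}\<close> strictly after the first jump. Written with rational times,
  it is a countable union of predictable rectangles.\<close>

definition after_jump :: "real \<Rightarrow> real \<Rightarrow> (real \<times> 'a) set" where
  "after_jump s t = (\<Union>q\<in>{q\<in>\<rat>. s \<le> q \<and> q < t}. {q<..t} \<times> {\<omega> \<in> space M. N s \<omega> < N q \<omega>})"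

lemma after_jump_predictable:
  assumes "0 \<le> s" shows "after_jump s t \<in> sets P"
  unfolding after_jump_def
proof (rule sets.countable_UN'')
  show "countable {q\<in>\<rat>. s \<le> q \<and> q < t}" by (rule countable_subset[OF _ countable_rat]) auto
  fix q assume q: "q \<in> {q\<in>\<rat>. s \<le> q \<and> q < t}"
  have "{\<omega> \<in> space (F q). N s \<omega> < N q \<omega>} \<in> sets (F q)"
  proof -
    have "(\<lambda>\<omega>. real (N s \<omega>)) \<in> borel_measurable (F q)"
      using measurable_F_mono[OF assms _ N_measurable[OF assms]] q by auto
    moreover have "(\<lambda>\<omega>. real (N q \<omega>)) \<in> borel_measurable (F q)"
      using N_measurable[of q] q assms by auto
    ultimately have "{\<omega> \<in> space (F q). real (N s \<omega>) < real (N q \<omega>)} \<in> sets (F q)"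
      by (rule borel_measurable_less)
    then show ?thesis by simp
  qed
  then show "{q<..t} \<times> {\<omega> \<in> space M. N s \<omega> < N q \<omega>} \<in> sets P"
    using q assms by (intro rectangle_in_P) (auto simp: space_F)
qed

text \<open>The subtraction of natural numbers is truncated: the value is 0 if there is no jump.\<close>

lemma after_jump_section:
  assumes "0 \<le> s" "s \<le> t" and \<omega>: "\<omega> \<in> space M"
  shows "emeasure (dN N \<omega>) {u \<in> {0..t}. (u, \<omega>) \<in> after_jump s t} = ennreal (real (N t \<omega> - N s \<omega> - 1))"
    and "emeasure (Lam \<omega>) {u \<in> {0..t}. (u, \<omega>) \<in> after_jump s t}
      \<le> ennreal (c * (t - s)) * emeasure (dN N \<omega>) {s<..t}"
proof -
  have "emeasure (dN N \<omega>) {u \<in> {0..t}. (u, \<omega>) \<in> after_jump s t} = ennreal (real (N t \<omega> - N s \<omega> - 1)) \<and>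
    emeasure (Lam \<omega>) {u \<in> {0..t}. (u, \<omega>) \<in> after_jump s t}
      \<le> ennreal (c * (t - s)) * emeasure (dN N \<omega>) {s<..t}"
  proof (cases "N s \<omega> < N t \<omega>")
    case False
    have "(u, \<omega>) \<notin> after_jump s t" for u
    proof
      assume "(u, \<omega>) \<in> after_jump s t"
      then obtain q where "s \<le> q" "q < t" "N s \<omega> < N q \<omega>" by (auto simp: after_jump_def)
      then show False using counting_process_mono[OF counting \<omega>, of q t] assms False by auto
    qed
    then show ?thesis using False by simp
  next
    case True
    then obtain \<tau> where \<tau>: "s < \<tau>" "\<tau> \<le> t" "\<And>u. s \<le> u \<Longrightarrow> u < \<tau> \<Longrightarrow> N u \<omega> = N s \<omega>"
      "N \<tau> \<omega> = N s \<omega> + 1"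
      using counting_process_first_jump[OF counting \<omega> assms(1,2)] by metis
    have sec: "{u \<in> {0..t}. (u, \<omega>) \<in> after_jump s t} = {\<tau><..t}"
    proof (intro set_eqI iffI)
      fix u assume "u \<in> {u \<in> {0..t}. (u, \<omega>) \<in> after_jump s t}"
      then obtain q where q: "s \<le> q" "q < u" "u \<le> t" "N s \<omega> < N q \<omega>" by (auto simp: after_jump_def)
      then have "\<tau> \<le> q" using \<tau>(3)[of q] by (cases "q < \<tau>") auto
      then show "u \<in> {\<tau><..t}" using q by auto
    next
      fix u assume u: "u \<in> {\<tau><..t}"
      then obtain q where q: "q \<in> \<rat>" "\<tau> < q" "q < u" using Rats_dense_in_real[of \<tau> u] by auto
      have "N s \<omega> < N q \<omega>"
        using counting_process_mono[OF counting \<omega>, of \<tau> q] \<tau>(1,2,4) q assms by auto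
      then have "(u, \<omega>) \<in> after_jump s t" unfolding after_jump_def
        using q u \<tau>(1,2) \<omega> by (intro UN_I[of q]) auto
      then show "u \<in> {u \<in> {0..t}. (u, \<omega>) \<in> after_jump s t}" using u \<tau>(1,2) assms by auto
    qed
    \<comment> \<open>The section is nonempty only if there was a jump, so the bound
      \<open>c * (t - s)\<close> may be multiplied by the number of jumps. This extra factor makes
      the later estimate quadratic.\<close>
    have "1 \<le> emeasure (dN N \<omega>) {s<..t}"
      unfolding emeasure_dN_Ioc[OF counting \<omega> assms(1,2)] using True by simp
    then have "ennreal (c * (t - s)) * 1 \<le> ennreal (c * (t - s)) * emeasure (dN N \<omega>) {s<..t}"
      by (intro mult_left_mono) auto
    moreover have "{\<tau><..t} \<subseteq> {s..t}" using \<tau>(1) by auto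
    then have "emeasure (Lam \<omega>) {\<tau><..t} \<le> ennreal (c * (t - s))"
      using emeasure_Lam_le[OF \<omega>, of "{\<tau><..t}" s t] \<tau>(1,2) assms by auto
    ultimately have "emeasure (Lam \<omega>) {\<tau><..t} \<le> ennreal (c * (t - s)) * emeasure (dN N \<omega>) {s<..t}"
      by simp
    moreover have "emeasure (dN N \<omega>) {\<tau><..t} = ennreal (real (N t \<omega> - N s \<omega> - 1))"
      using emeasure_dN_Ioc[OF counting \<omega>, of \<tau> t] \<tau>(1,2,4) assms True by (simp add: of_nat_diff)
    ultimately show ?thesis unfolding sec by simp
  qed
  then show "emeasure (dN N \<omega>) {u \<in> {0..t}. (u, \<omega>) \<in> after_jump s t} = ennreal (real (N t \<omega> - N s \<omega> - 1))"
    and "emeasure (Lam \<omega>) {u \<in> {0..t}. (u, \<omega>) \<in> after_jump s t}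
      \<le> ennreal (c * (t - s)) * emeasure (dN N \<omega>) {s<..t}" by auto
qed

text \<open>The jumps after the first one are counted by the dN-mass of the predictable set
  \<open>after_jump s t\<close>, so their mean number is the mean \<open>Lam\<close>-mass of that
  set. This mass is at most \<open>c * (t - s)\<close> times the number of jumps, whose mean is
  again at most \<open>c * (t - s)\<close>.\<close>

lemma mean_excess_jumps_le:
  assumes "0 \<le> s" "s \<le> t"
  shows "integrable M (\<lambda>\<omega>. real (N t \<omega> - N s \<omega> - 1))"
    and "(LINT \<omega>|M. real (N t \<omega> - N s \<omega> - 1)) \<le> (c * (t - s))\<^sup>2"
proof -
  have t: "0 \<le> t" using assms by simp
  have n: "(\<lambda>\<omega>. emeasure (dN N \<omega>) {s<..t}) \<in> borel_measurable M"
  proof (subst measurable_cong)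
    show "emeasure (dN N \<omega>) {s<..t} = ennreal (real (N t \<omega>) - real (N s \<omega>))" if "\<omega> \<in> space M" for \<omega>
      by (rule emeasure_dN_Ioc[OF counting that assms])
  qed (use measurable_F_M[OF t N_measurable[OF t]] measurable_F_M[OF assms(1) N_measurable[OF assms(1)]] in simp)
  have "(\<integral>\<^sup>+\<omega>. ennreal (real (N t \<omega> - N s \<omega> - 1)) \<partial>M)
      = (\<integral>\<^sup>+\<omega>. emeasure (dN N \<omega>) {u \<in> {0..t}. (u, \<omega>) \<in> after_jump s t} \<partial>M)"
    using after_jump_section(1)[OF assms] by (intro nn_integral_cong) simp
  also have "\<dots> = (\<integral>\<^sup>+\<omega>. emeasure (Lam \<omega>) {u \<in> {0..t}. (u, \<omega>) \<in> after_jump s t} \<partial>M)"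
    by (rule mean_section_eq[OF t after_jump_predictable[OF assms(1)]])
  also have "\<dots> \<le> (\<integral>\<^sup>+\<omega>. ennreal (c * (t - s)) * emeasure (dN N \<omega>) {s<..t} \<partial>M)"
    by (intro nn_integral_mono after_jump_section(2)[OF assms])
  also have "\<dots> = ennreal (c * (t - s)) * (\<integral>\<^sup>+\<omega>. emeasure (dN N \<omega>) {s<..t} \<partial>M)"
    using n by (rule nn_integral_cmult)
  also have "\<dots> \<le> ennreal (c * (t - s)) * ennreal (c * (t - s))"
    by (intro mult_left_mono mean_increment_le[OF assms]) auto
  also have "\<dots> = ennreal ((c * (t - s))\<^sup>2)"
    using c_nonneg assms by (simp add: ennreal_mult power2_eq_square)
  finally have le: "(\<integral>\<^sup>+\<omega>. ennreal (real (N t \<omega> - N s \<omega> - 1)) \<partial>M) \<le> ennreal ((c * (t - s))\<^sup>2)" .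
  have Nm: "N r \<in> M \<rightarrow>\<^sub>M count_space UNIV" if "0 \<le> r" for r
    using measurable_F_M[OF that N_adapted[OF that]] .
  have m: "(\<lambda>\<omega>. real (N t \<omega> - N s \<omega> - 1)) \<in> borel_measurable M"
    using Nm[OF t] Nm[OF assms(1)] by measurable
  show i: "integrable M (\<lambda>\<omega>. real (N t \<omega> - N s \<omega> - 1))"
    using le m by (intro integrableI_nonneg) (auto simp: less_top[symmetric] top_unique)
  then have "ennreal (LINT \<omega>|M. real (N t \<omega> - N s \<omega> - 1)) \<le> ennreal ((c * (t - s))\<^sup>2)"
    using le by (subst nn_integral_eq_integral[symmetric]) auto
  then show "(LINT \<omega>|M. real (N t \<omega> - N s \<omega> - 1)) \<le> (c * (t - s))\<^sup>2"
    by simp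
qed

lemma mean_N_increment:
  assumes "0 \<le> s" "s \<le> t"
  shows "(LINT \<omega>|M. real (N t \<omega>) - real (N s \<omega>)) \<le> c * (t - s)"
proof -
  have t: "0 \<le> t" using assms by simp
  have "ennreal (LINT \<omega>|M. real (N t \<omega>) - real (N s \<omega>)) = (\<integral>\<^sup>+\<omega>. ennreal (real (N t \<omega>) - real (N s \<omega>)) \<partial>M)"
    using integrable_N[OF t] integrable_N[OF assms(1)] counting_process_mono[OF counting _ assms]
    by (intro nn_integral_eq_integral[symmetric]) auto
  also have "\<dots> = (\<integral>\<^sup>+\<omega>. emeasure (dN N \<omega>) {s<..t} \<partial>M)"
    using emeasure_dN_Ioc[OF counting _ assms] by (intro nn_integral_cong) auto
  also have "\<dots> \<le> ennreal (c * (t - s))" by (rule mean_increment_le[OF assms])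
  finally show ?thesis using c_nonneg assms by simp
qed

end

subsection \<open>The exponential martingale\<close>

text \<open>Cutting \<open>{0..S}\<close> into \<open>n\<close> equal pieces bounds the total
  increment by \<open>n * K * (S / n)\<^sup>2\<close>, which tends to 0.\<close>

lemma constant_if_quadratic_increments:
  fixes f :: "real \<Rightarrow> 'b :: real_normed_vector"
  assumes S: "0 \<le> S"
    and f: "\<And>s t. 0 \<le> s \<Longrightarrow> s \<le> t \<Longrightarrow> t \<le> S \<Longrightarrow> norm (f t - f s) \<le> K * (t - s)\<^sup>2"
  shows "f S = f 0"
proof -
  have le: "norm (f S - f 0) \<le> K * S\<^sup>2 / real n" if n: "0 < n" for n :: nat
  proof -
    define p where "p k = real k * S / real n" for k
    have "norm (f S - f 0) = norm (\<Sum>k<n. f (p (Suc k)) - f (p k))"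
      using n unfolding sum_lessThan_telescope[of "\<lambda>k. f (p k)"] by (simp add: p_def)
    also have "\<dots> \<le> (\<Sum>k<n. K * (S / real n)\<^sup>2)"
    proof (rule sum_norm_le)
      fix k assume k: "k \<in> {..<n}"
      have "real (Suc k) * S \<le> real n * S" using k S by (intro mult_right_mono) auto
      then have "p (Suc k) \<le> S" using n by (simp add: p_def field_simps)
      moreover have "p (Suc k) - p k = S / real n" by (simp add: p_def distrib_right add_divide_distrib)
      moreover have "0 \<le> p k" using S by (simp add: p_def)
      ultimately show "norm (f (p (Suc k)) - f (p k)) \<le> K * (S / real n)\<^sup>2"
        using f[of "p k" "p (Suc k)"] S by (simp add: diff_eq_eq)
    qed
    also have "\<dots> = K * S\<^sup>2 / real n" using n by (simp add: power2_eq_square field_simps)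
    finally show ?thesis .
  qed
  have "(\<lambda>n. K * S\<^sup>2 / real n) \<longlonglongrightarrow> 0" by (rule lim_const_over_n)
  then have "norm (f S - f 0) \<le> 0"
    by (rule LIMSEQ_le_const) (use le in \<open>auto intro!: exI[of _ 1]\<close>)
  then show ?thesis by simp
qed

lemma norm_exp_minus_affine_le:
  fixes z :: complex shows "norm (exp z - 1 - z) \<le> exp (norm z) * (norm z)\<^sup>2"
proof -
  have "norm (exp z - (\<Sum>k\<le>1. z ^ k / fact k)) \<le> exp \<bar>Re z\<bar> * (norm z) ^ Suc 1 / fact 1"
    by (rule Taylor_exp)
  also have "\<dots> \<le> exp (norm z) * (norm z)\<^sup>2"
    using abs_Re_le_cmod[of z] by (simp add: mult_right_mono numeral_2_eq_2)
  finally show ?thesis by (simp add: algebra_simps)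
qed

lemma norm_iexp_minus_1_le: "norm (exp (\<i> * complex_of_real x) - 1) \<le> 2"
  using norm_triangle_ineq4[of "exp (\<i> * complex_of_real x)" 1] by simp

text \<open>Here \<open>x\<close> will be the dN-integral of \<open>h\<close> over a short interval,
  \<open>I\<close> that of \<open>exp (\<i> * h) - 1\<close>, and \<open>a\<close> the increment of
  the cumulant. The three errors come from multiple jumps, from the curvature of
  \<open>exp (- a)\<close>, and from a jump multiplied by the drift \<open>a\<close>.\<close>

lemma exp_increment_error:
  fixes a I :: complex and x :: real
  shows "norm (exp (\<i> * x - a) - 1 - (I - a))
    \<le> norm (exp (\<i> * x) - 1 - I) + exp (norm a) * (norm a)\<^sup>2 + norm (exp (\<i> * x) - 1) * norm a"
proof -
  have eq: "exp (\<i> * x - a) - 1 - (I - a) = (exp (\<i> * x) - 1 - I) + exp (\<i> * x) * (exp (- a) - 1 - (- a))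
    - (exp (\<i> * x) - 1) * a"
    by (simp add: algebra_simps exp_add[symmetric])
  have "norm (exp (\<i> * x - a) - 1 - (I - a)) \<le> norm (exp (\<i> * x) - 1 - I)
      + norm (exp (\<i> * x) * (exp (- a) - 1 - (- a))) + norm ((exp (\<i> * x) - 1) * a)"
    unfolding eq by (rule order_trans[OF norm_triangle_ineq4]) (intro add_right_mono norm_triangle_ineq)
  also have "\<dots> \<le> norm (exp (\<i> * x) - 1 - I) + exp (norm a) * (norm a)\<^sup>2 + norm (exp (\<i> * x) - 1) * norm a"
    using norm_exp_minus_affine_le[of "- a"] by (simp add: norm_mult)
  finally show ?thesis .
qed

context filtered_prob_space
begin

lemma Ioc_set_integrable:
  fixes H :: "real \<times> 'a \<Rightarrow> 'b :: {banach, second_countable_topology}"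
  assumes \<mu>: "adapted_kernel \<mu>" and H: "H \<in> borel_measurable P"
    and C: "\<And>t \<omega>. 0 \<le> t \<Longrightarrow> \<omega> \<in> space M \<Longrightarrow> norm (H (t, \<omega>)) \<le> C"
    and \<omega>: "\<omega> \<in> space M" and s: "0 \<le> s" "s \<le> t"
  shows "set_integrable (\<mu> \<omega>) {s<..t} (\<lambda>u. H (u, \<omega>))"
  by (rule set_integrable_subset[OF section_set_integrable[OF \<mu> H C \<omega>, of t]])
    (use s adapted_kernelD(1)[OF \<mu> \<omega>] in auto)

lemma section_set_integral_split:
  fixes H :: "real \<times> 'a \<Rightarrow> 'b :: {banach, second_countable_topology}"
  assumes \<mu>: "adapted_kernel \<mu>" and H: "H \<in> borel_measurable P"
    and C: "\<And>t \<omega>. 0 \<le> t \<Longrightarrow> \<omega> \<in> space M \<Longrightarrow> norm (H (t, \<omega>)) \<le> C"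
    and \<omega>: "\<omega> \<in> space M" and s: "0 \<le> s" "s \<le> t"
  shows "(LINT u:{0..t}|\<mu> \<omega>. H (u, \<omega>)) = (LINT u:{0..s}|\<mu> \<omega>. H (u, \<omega>)) + (LINT u:{s<..t}|\<mu> \<omega>. H (u, \<omega>))"
proof -
  have "{0..t} = {0..s} \<union> {s<..t}" "{0..s} \<inter> {s<..t} = {}" using s by auto
  then show ?thesis
    using set_integral_Un[OF _ section_set_integrable[OF \<mu> H C \<omega> s(1)] Ioc_set_integrable[OF \<mu> H C \<omega> s]]
    by simp
qed

text \<open>These are the elementary predictable integrands. They allow a factor known at time
  \<open>s\<close> to be moved inside an integral over \<open>{s<..t}\<close>. The value off the
  strip is 0, so preimages depend on whether the target set contains 0.\<close>

lemma strip_measurable: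
  fixes Y :: "'a \<Rightarrow> 'b :: {real_normed_vector, second_countable_topology}"
  assumes s: "0 \<le> s" and Y: "Y \<in> borel_measurable (F s)"
  shows "(\<lambda>(u, \<omega>). indicator {s<..t} u *\<^sub>R Y \<omega>) \<in> borel_measurable P"
proof (rule measurableI)
  fix B :: "'b set" assume B: "B \<in> sets borel"
  have Ym: "Y -` B \<inter> space M \<in> sets (F s)" using measurable_sets[OF Y B] space_F[OF s] by simp
  have sp: "space M \<in> sets (F s)" using sets.top[of "F s"] space_F[OF s] by simp
  have "(\<lambda>(u, \<omega>). indicator {s<..t} u *\<^sub>R Y \<omega>) -` B \<inter> space P
    = {s<..t} \<times> (Y -` B \<inter> space M) \<union> (if 0 \<in> B then space P - {s<..t} \<times> space M else {})"
  proof (rule set_eqI)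
    fix x show "x \<in> (\<lambda>(u, \<omega>). indicator {s<..t} u *\<^sub>R Y \<omega>) -` B \<inter> space P \<longleftrightarrow>
      x \<in> {s<..t} \<times> (Y -` B \<inter> space M) \<union> (if 0 \<in> B then space P - {s<..t} \<times> space M else {})"
      using s by (cases "fst x \<in> {s<..t}") (auto simp: space_P)
  qed
  also have "\<dots> \<in> sets P"
    using rectangle_in_P[OF s Ym, of t] rectangle_in_P[OF s sp, of t] by auto
  finally show "(\<lambda>(u, \<omega>). indicator {s<..t} u *\<^sub>R Y \<omega>) -` B \<inter> space P \<in> sets P" .
qed simp

end

section \<open>The exponential martingale has constant mean\<close>

context counting_intensity
begin

definition stoch_int :: "(real \<times> 'a \<Rightarrow> real) \<Rightarrow> real \<Rightarrow> 'a \<Rightarrow> real" where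
  "stoch_int h t \<omega> = (LINT u:{0..t}|dN N \<omega>. h (u, \<omega>))"

text \<open>If \<open>h\<close> and \<open>lam\<close> were deterministic, \<open>N\<close> would be
  a Poisson process and this would be the logarithm of the mean of
  \<open>exp (\<i> * stoch_int h t \<omega>)\<close>.\<close>

definition cumulant :: "(real \<times> 'a \<Rightarrow> real) \<Rightarrow> real \<Rightarrow> 'a \<Rightarrow> complex" where
  "cumulant h t \<omega> = (LINT u:{0..t}|Lam \<omega>. exp (\<i> * h (u, \<omega>)) - 1)"

text \<open>This is the stochastic exponential of the integral of \<open>exp (\<i> * h) - 1\<close>
  against dN - d\<Lambda>, in closed form: a jump multiplies it by
  \<open>exp (\<i> * h)\<close>.\<close>

definition exp_mart :: "(real \<times> 'a \<Rightarrow> real) \<Rightarrow> real \<Rightarrow> 'a \<Rightarrow> complex" where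
  "exp_mart h t \<omega> = exp (\<i> * stoch_int h t \<omega> - cumulant h t \<omega>)"

context
  fixes h :: "real \<times> 'a \<Rightarrow> real" and C :: real
  assumes h: "h \<in> borel_measurable P"
    and h_le: "\<And>t \<omega>. 0 \<le> t \<Longrightarrow> \<omega> \<in> space M \<Longrightarrow> \<bar>h (t, \<omega>)\<bar> \<le> C"
begin

lemma norm_integrand_le: "0 \<le> t \<Longrightarrow> \<omega> \<in> space M \<Longrightarrow> norm (h (t, \<omega>)) \<le> C"
  using h_le by simp

lemma iexp_minus_1_measurable: "(\<lambda>x. exp (\<i> * complex_of_real (h x)) - 1) \<in> borel_measurable P"
  using h by measurable

lemma stoch_int_measurable: "0 \<le> t \<Longrightarrow> stoch_int h t \<in> borel_measurable (F t)"
  using kernel_integral_measurable_real[OF adapted_dN _ h norm_integrand_le] unfolding stoch_int_def[abs_def] by blast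

lemma cumulant_measurable: "0 \<le> t \<Longrightarrow> cumulant h t \<in> borel_measurable (F t)"
  using kernel_integral_measurable_complex[OF adapted_Lam _ iexp_minus_1_measurable norm_iexp_minus_1_le]
  unfolding cumulant_def[abs_def] by blast

lemma exp_mart_measurable: "0 \<le> t \<Longrightarrow> exp_mart h t \<in> borel_measurable (F t)"
  using stoch_int_measurable[of t] cumulant_measurable[of t] unfolding exp_mart_def[abs_def] by measurable

lemma norm_cumulant_le:
  assumes "0 \<le> t" "\<omega> \<in> space M" shows "norm (cumulant h t \<omega>) \<le> 2 * c * t"
proof -
  have "norm (cumulant h t \<omega>) \<le> 2 * measure (Lam \<omega>) {0..t}"
    unfolding cumulant_def
    by (rule norm_section_set_integral_le[OF adapted_Lam iexp_minus_1_measurable norm_iexp_minus_1_le assms(2,1)])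
  then show ?thesis using measure_Lam_le[OF assms(2), of "{0..t}" 0 t] assms by simp
qed

text \<open>The stochastic integral enters only as a phase, so the modulus is governed by the
  cumulant, which is bounded whatever the number of jumps.\<close>

lemma norm_exp_mart_le:
  assumes "0 \<le> t" "t \<le> S" "\<omega> \<in> space M" shows "norm (exp_mart h t \<omega>) \<le> exp (2 * c * S)"
proof -
  have "norm (exp_mart h t \<omega>) = exp (- Re (cumulant h t \<omega>))" by (simp add: exp_mart_def)
  also have "\<dots> \<le> exp (norm (cumulant h t \<omega>))" using abs_Re_le_cmod[of "cumulant h t \<omega>"] by simp
  also have "\<dots> \<le> exp (2 * c * S)"
    using norm_cumulant_le[OF assms(1,3)] mult_left_mono[OF assms(2), of "2 * c"] c_nonneg by simp
  finally show ?thesis .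
qed

text \<open>Without a jump both integrals vanish, and with one jump at \<tau> both expressions equal
  \<open>exp (\<i> * h (\<tau>, \<omega>)) - 1\<close>. Only two or more jumps cause an error, and
  they are few in the mean by \<open>mean_excess_jumps_le\<close>.\<close>

lemma dN_integral_exp_error:
  assumes \<omega>: "\<omega> \<in> space M" and s: "0 \<le> s" "s \<le> t"
  shows "norm (exp (\<i> * complex_of_real (LINT u:{s<..t}|dN N \<omega>. h (u, \<omega>))) - 1
      - (LINT u:{s<..t}|dN N \<omega>. exp (\<i> * h (u, \<omega>)) - 1)) \<le> 6 * real (N t \<omega> - N s \<omega> - 1)" (is "norm (?E - ?I) \<le> _")
    and "norm (exp (\<i> * complex_of_real (LINT u:{s<..t}|dN N \<omega>. h (u, \<omega>))) - 1) \<le> 2 * (real (N t \<omega>) - real (N s \<omega>))"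
proof -
  note dN = sets_dN[OF counting \<omega>] space_dN[OF counting \<omega>]
  have mono: "N s \<omega> \<le> N t \<omega>" using counting_process_mono[OF counting \<omega> s] .
  have em: "emeasure (dN N \<omega>) {s<..t} = ennreal (real (N t \<omega>) - real (N s \<omega>))"
    by (rule emeasure_dN_Ioc[OF counting \<omega> s])
  then have ms: "measure (dN N \<omega>) {s<..t} = real (N t \<omega>) - real (N s \<omega>)"
    using mono by (simp add: measure_def)
  have I: "norm ?I \<le> 2 * (real (N t \<omega>) - real (N s \<omega>))"
    unfolding ms[symmetric]
    using Ioc_set_integrable[OF adapted_dN iexp_minus_1_measurable norm_iexp_minus_1_le \<omega> s] dN em
    by (intro norm_set_integral_le norm_iexp_minus_1_le) auto
  have L: "\<bar>LINT u:{s<..t}|dN N \<omega>. h (u, \<omega>)\<bar> \<le> C * (real (N t \<omega>) - real (N s \<omega>))"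
    unfolding ms[symmetric] real_norm_def[symmetric]
    using Ioc_set_integrable[OF adapted_dN h norm_integrand_le \<omega> s] dN em norm_integrand_le[OF _ \<omega>] s
    by (intro norm_set_integral_le) auto
  consider (0) "N t \<omega> = N s \<omega>" | (1) "N t \<omega> = N s \<omega> + 1" | (2) "N t \<omega> \<ge> N s \<omega> + 2"
    using mono by linarith
  then have "norm (?E - ?I) \<le> 6 * real (N t \<omega> - N s \<omega> - 1) \<and> norm ?E \<le> 2 * (real (N t \<omega>) - real (N s \<omega>))"
  proof cases
    case 0
    then show ?thesis using I L by simp
  next
    case 1
    obtain \<tau> where \<tau>: "s < \<tau>" "\<tau> \<le> t"
      "\<And>f :: real \<Rightarrow> complex.
       (\<lambda>u. indicator {s<..t} u *\<^sub>R f u) \<in> borel_measurable borel \<Longrightarrow> (LINT u:{s<..t}|dN N \<omega>. f u) = f \<tau>"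
      using dN_single_jump[OF counting \<omega> s 1, where ?'b=complex] by blast
    have m: "(\<lambda>u. indicator {s<..t} u *\<^sub>R H (u, \<omega>)) \<in> borel_measurable borel"
      if H: "H \<in> borel_measurable P" for H :: "real \<times> 'a \<Rightarrow> complex"
    proof -
      have "(\<lambda>u. indicator {s<..t} u *\<^sub>R H (max 0 u, \<omega>)) \<in> borel_measurable borel"
        using section_measurable[OF H \<omega>] by measurable
      moreover have "(\<lambda>u. indicator {s<..t} u *\<^sub>R H (max 0 u, \<omega>)) = (\<lambda>u. indicator {s<..t} u *\<^sub>R H (u, \<omega>))"
        using s by (auto simp: fun_eq_iff indicator_def max_def)
      ultimately show ?thesis by simp
    qed
    have "complex_of_real (LINT u:{s<..t}|dN N \<omega>. h (u, \<omega>)) = (LINT u:{s<..t}|dN N \<omega>. complex_of_real (h (u, \<omega>)))"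
      by (simp add: set_integral_complex_of_real)
    also have "\<dots> = h (\<tau>, \<omega>)"
      using \<tau>(3)[OF m[of "\<lambda>x. complex_of_real (h x)"]] h by simp
    finally have "complex_of_real (LINT u:{s<..t}|dN N \<omega>. h (u, \<omega>)) = h (\<tau>, \<omega>)" .
    moreover have "?I = exp (\<i> * h (\<tau>, \<omega>)) - 1"
      using \<tau>(3)[OF m[OF iexp_minus_1_measurable]] by simp
    ultimately show ?thesis using 1 norm_iexp_minus_1_le by simp
  next
    case 2
    \<comment> \<open>For \<open>n\<close> jumps the crude bound is \<open>2 + 2 * n\<close>, and
      this is at most \<open>6 * (n - 1)\<close> exactly when \<open>n \<ge> 2\<close>; hence the
      constant 6.\<close>
    have "norm ?E \<le> 2" by (rule norm_iexp_minus_1_le)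
    moreover have "norm (?E - ?I) \<le> norm ?E + norm ?I" by (rule norm_triangle_ineq4)
    moreover have "real (N t \<omega> - N s \<omega> - 1) = real (N t \<omega>) - real (N s \<omega>) - 1" "real (N t \<omega>) \<ge> real (N s \<omega>) + 2"
      using 2 by linarith+
    ultimately show ?thesis using I by auto
  qed
  then show "norm (?E - ?I) \<le> 6 * real (N t \<omega> - N s \<omega> - 1)" "norm ?E \<le> 2 * (real (N t \<omega>) - real (N s \<omega>))"
    by auto
qed

text \<open>The first-order part of the increment of \<open>exp_mart\<close>, with the prefactor
  frozen at the left end \<open>s\<close>. Freezing makes the integrand predictable, hence the mean
  zero.\<close>

definition mart_increment :: "real \<Rightarrow> real \<Rightarrow> 'a \<Rightarrow> complex" where
  "mart_increment s t \<omega> = exp_mart h s \<omega> * ((LINT u:{s<..t}|dN N \<omega>. exp (\<i> * h (u, \<omega>)) - 1)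
     - (LINT u:{s<..t}|Lam \<omega>. exp (\<i> * h (u, \<omega>)) - 1))"

lemma exp_mart_increment_error:
  assumes \<omega>: "\<omega> \<in> space M" and s: "0 \<le> s" "s \<le> t" and t: "t \<le> S"
  shows "norm (exp_mart h t \<omega> - exp_mart h s \<omega> - mart_increment s t \<omega>)
    \<le> exp (2 * c * S) * (6 * real (N t \<omega> - N s \<omega> - 1) + exp (2 * c * S) * (2 * c * (t - s))\<^sup>2
        + 4 * c * (t - s) * (real (N t \<omega>) - real (N s \<omega>)))"
proof -
  let ?x = "LINT u:{s<..t}|dN N \<omega>. h (u, \<omega>)"
  let ?a = "LINT u:{s<..t}|Lam \<omega>. exp (\<i> * h (u, \<omega>)) - 1"
  let ?I = "LINT u:{s<..t}|dN N \<omega>. exp (\<i> * h (u, \<omega>)) - 1"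
  have mono: "N s \<omega> \<le> N t \<omega>" using counting_process_mono[OF counting \<omega> s] .
  have J: "stoch_int h t \<omega> = stoch_int h s \<omega> + ?x"
    unfolding stoch_int_def by (rule section_set_integral_split[OF adapted_dN h norm_integrand_le \<omega> s])
  have A: "cumulant h t \<omega> = cumulant h s \<omega> + ?a"
    unfolding cumulant_def
    by (rule section_set_integral_split[OF adapted_Lam iexp_minus_1_measurable norm_iexp_minus_1_le \<omega> s])
  have eq: "exp_mart h t \<omega> - exp_mart h s \<omega> - mart_increment s t \<omega>
      = exp_mart h s \<omega> * (exp (\<i> * ?x - ?a) - 1 - (?I - ?a))"
    unfolding mart_increment_def exp_mart_def J A
    by (simp add: algebra_simps exp_add[symmetric])
  have sub: "{s<..t} \<subseteq> {s..t}" by auto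
  have "norm ?a \<le> 2 * measure (Lam \<omega>) {s<..t}"
    using Ioc_set_integrable[OF adapted_Lam iexp_minus_1_measurable norm_iexp_minus_1_le \<omega> s]
      emeasure_Lam_finite[OF \<omega> _ sub] s
    by (intro norm_set_integral_le norm_iexp_minus_1_le) auto
  then have a: "norm ?a \<le> 2 * c * (t - s)" using measure_Lam_le[OF \<omega> _ sub] s by simp
  \<comment> \<open>The cruder bound is meant for \<open>exp (norm ?a)\<close>: it gives a constant
    that does not depend on the interval.\<close>
  also have "\<dots> \<le> 2 * c * S" using c_nonneg s t by (intro mult_left_mono) auto
  finally have a': "norm ?a \<le> 2 * c * S" .
  have "norm (exp (\<i> * ?x - ?a) - 1 - (?I - ?a))
    \<le> norm (exp (\<i> * ?x) - 1 - ?I) + exp (norm ?a) * (norm ?a)\<^sup>2 + norm (exp (\<i> * ?x) - 1) * norm ?a"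
    by (rule exp_increment_error)
  also have "\<dots> \<le> 6 * real (N t \<omega> - N s \<omega> - 1) + exp (2 * c * S) * (2 * c * (t - s))\<^sup>2
        + (2 * (real (N t \<omega>) - real (N s \<omega>))) * (2 * c * (t - s))"
    using dN_integral_exp_error[OF \<omega> s] a a' mono
    by (intro add_mono mult_mono power_mono) auto
  also have "\<dots> = 6 * real (N t \<omega> - N s \<omega> - 1) + exp (2 * c * S) * (2 * c * (t - s))\<^sup>2
        + 4 * c * (t - s) * (real (N t \<omega>) - real (N s \<omega>))" by (simp add: algebra_simps)
  finally have le: "norm (exp (\<i> * ?x - ?a) - 1 - (?I - ?a)) \<le> \<dots>" .
  show ?thesis
    unfolding eq norm_mult
    using le norm_exp_mart_le[OF s(1) order_trans[OF s(2) t] \<omega>] by (intro mult_mono) auto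
qed

lemma mart_increment_mean:
  assumes s: "0 \<le> s" "s \<le> t"
  shows "integrable M (mart_increment s t)" "(LINT \<omega>|M. mart_increment s t \<omega>) = 0"
proof -
  have t: "0 \<le> t" using s by simp
  define H :: "real \<times> 'a \<Rightarrow> complex" where
    "H x = (case x of (u, \<omega>) \<Rightarrow> indicator {s<..t} u *\<^sub>R exp_mart h s \<omega>) * (exp (\<i> * h x) - 1)" for x
  have Hm: "H \<in> borel_measurable P"
    unfolding H_def[abs_def]
    by (intro borel_measurable_times strip_measurable[OF s(1) exp_mart_measurable[OF s(1)]] iexp_minus_1_measurable)
  have Hb: "norm (H (u, \<omega>)) \<le> exp (2 * c * s) * 2" if "\<omega> \<in> space M" for u \<omega>
  proof -
    have "norm (indicator {s<..t} u *\<^sub>R exp_mart h s \<omega>) \<le> exp (2 * c * s)"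
      using norm_exp_mart_le[OF s(1) order_refl that] by (auto simp: indicator_def)
    then show ?thesis unfolding H_def norm_mult split_conv
      using norm_iexp_minus_1_le by (intro mult_mono) auto
  qed
  note H = integrable_kernel_integral_complex[OF t Hm Hb]
  have split: "(LINT u:{0..t}|\<mu> \<omega>. H (u, \<omega>)) = exp_mart h s \<omega> * (LINT u:{s<..t}|\<mu> \<omega>. exp (\<i> * h (u, \<omega>)) - 1)"
    for \<mu> :: "'a \<Rightarrow> real measure" and \<omega>
  proof -
    have "(LINT u:{0..t}|\<mu> \<omega>. H (u, \<omega>)) = (LINT u:{s<..t}|\<mu> \<omega>. exp_mart h s \<omega> * (exp (\<i> * h (u, \<omega>)) - 1))"
      unfolding set_lebesgue_integral_def H_def using s
      by (intro Bochner_Integration.integral_cong) (auto simp: indicator_def)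
    then show ?thesis by simp
  qed
  have eq: "mart_increment s t \<omega> = (LINT u:{0..t}|dN N \<omega>. H (u, \<omega>)) - (LINT u:{0..t}|Lam \<omega>. H (u, \<omega>))" for \<omega>
    unfolding split mart_increment_def by (simp add: right_diff_distrib)
  show "integrable M (mart_increment s t)" unfolding eq[abs_def] using H(1,2) by (intro Bochner_Integration.integrable_diff)
  show "(LINT \<omega>|M. mart_increment s t \<omega>) = 0"
    unfolding eq using H by (subst Bochner_Integration.integral_diff) auto
qed

lemma integrable_exp_mart:
  assumes "0 \<le> t" shows "integrable M (exp_mart h t)"
  using norm_exp_mart_le[OF assms order_refl] measurable_F_M[OF assms exp_mart_measurable[OF assms]]
  by (intro integrable_const_bound[where B="exp (2 * c * t)"]) auto

text \<open>Each term of the pathwise error has a mean quadratic in \<open>t - s\<close>. The 10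
  collects 6 from the excess jumps and 4 from the product of jumps and drift;
  \<open>4 * c\<^sup>2\<close> is the squared drift bound \<open>2 * c\<close>.\<close>

lemma mean_exp_mart_increment:
  assumes s: "0 \<le> s" "s \<le> t" and t: "t \<le> S"
  shows "norm ((LINT \<omega>|M. exp_mart h t \<omega>) - (LINT \<omega>|M. exp_mart h s \<omega>))
    \<le> exp (2 * c * S) * (10 * c\<^sup>2 + 4 * c\<^sup>2 * exp (2 * c * S)) * (t - s)\<^sup>2"
proof -
  have t0: "0 \<le> t" using s by simp
  let ?R = "\<lambda>\<omega>. exp_mart h t \<omega> - exp_mart h s \<omega> - mart_increment s t \<omega>"
  let ?B = "\<lambda>\<omega>. exp (2 * c * S) * (6 * real (N t \<omega> - N s \<omega> - 1) + exp (2 * c * S) * (2 * c * (t - s))\<^sup>2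
        + 4 * c * (t - s) * (real (N t \<omega>) - real (N s \<omega>)))"
  note i = integrable_exp_mart[OF t0] integrable_exp_mart[OF s(1)] mart_increment_mean(1)[OF s]
  note iB = mean_excess_jumps_le(1)[OF s] integrable_N[OF t0] integrable_N[OF s(1)]
  have "(LINT \<omega>|M. exp_mart h t \<omega>) - (LINT \<omega>|M. exp_mart h s \<omega>) = (LINT \<omega>|M. ?R \<omega>)"
    using i mart_increment_mean(2)[OF s] by simp
  then have "norm ((LINT \<omega>|M. exp_mart h t \<omega>) - (LINT \<omega>|M. exp_mart h s \<omega>)) \<le> (LINT \<omega>|M. norm (?R \<omega>))"
    by (simp only: integral_norm_bound)
  also have "\<dots> \<le> (LINT \<omega>|M. ?B \<omega>)"
  proof (rule integral_mono)
    show "integrable M (\<lambda>\<omega>. norm (?R \<omega>))"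
      by (intro integrable_norm Bochner_Integration.integrable_diff i)
    show "integrable M ?B" using iB by simp
  qed (rule exp_mart_increment_error[OF _ s t])
  also have "\<dots> = exp (2 * c * S) * (6 * (LINT \<omega>|M. real (N t \<omega> - N s \<omega> - 1)) + exp (2 * c * S) * (2 * c * (t - s))\<^sup>2
        + 4 * c * (t - s) * (LINT \<omega>|M. real (N t \<omega>) - real (N s \<omega>)))"
    using iB by (simp add: prob_space)
  also have "\<dots> \<le> exp (2 * c * S) * (6 * (c * (t - s))\<^sup>2 + exp (2 * c * S) * (2 * c * (t - s))\<^sup>2
        + 4 * c * (t - s) * (c * (t - s)))"
    using mean_excess_jumps_le(2)[OF s] mean_N_increment[OF s] c_nonneg s
    by (intro mult_left_mono add_mono) auto
  also have "\<dots> = exp (2 * c * S) * (10 * c\<^sup>2 + 4 * c\<^sup>2 * exp (2 * c * S)) * (t - s)\<^sup>2"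
    by (simp add: power2_eq_square algebra_simps)
  finally show ?thesis .
qed

lemma mean_exp_mart:
  assumes S: "0 \<le> S" shows "(LINT \<omega>|M. exp_mart h S \<omega>) = 1"
proof -
  have "(LINT \<omega>|M. exp_mart h S \<omega>) = (LINT \<omega>|M. exp_mart h 0 \<omega>)"
    by (rule constant_if_quadratic_increments[OF S mean_exp_mart_increment])
  also have "\<dots> = (LINT \<omega>|M. 1)"
  proof (intro Bochner_Integration.integral_cong refl)
    fix \<omega> assume \<omega>: "\<omega> \<in> space M"
    \<comment> \<open>At time 0 the integral over \<open>{0..0}\<close> sees only the point 0, which
      has no mass.\<close>
    have "norm (stoch_int h 0 \<omega>) \<le> C * measure (dN N \<omega>) {0..0}"
      unfolding stoch_int_def by (rule norm_section_set_integral_le[OF adapted_dN h norm_integrand_le \<omega> order_refl])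
    then have "stoch_int h 0 \<omega> = 0" using emeasure_dN_0[OF counting \<omega>] by (simp add: measure_def)
    moreover have "cumulant h 0 \<omega> = 0" using norm_cumulant_le[OF order_refl \<omega>] by simp
    ultimately show "exp_mart h 0 \<omega> = 1" by (simp add: exp_mart_def)
  qed
  also have "\<dots> = 1" by (simp add: prob_space)
  finally show ?thesis .
qed

end

end

subsection \<open>The central limit theorem\<close>

lemma norm_iexp_diff_le:
  fixes x y :: real shows "norm (exp (\<i> * x) - exp (\<i> * y)) \<le> \<bar>x - y\<bar>"
proof -
  have "exp (\<i> * x) - exp (\<i> * y) = exp (\<i> * y) * (exp (\<i> * (x - y)) - 1)"
    by (simp add: algebra_simps exp_add[symmetric])
  then have "norm (exp (\<i> * x) - exp (\<i> * y)) = norm (exp (\<i> * complex_of_real (x - y)) - 1)"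
    by (simp add: norm_mult)
  also have "\<dots> \<le> \<bar>x - y\<bar>" using iexp_approx1[of "x - y" 0] by simp
  finally show ?thesis .
qed

lemma norm_exp_minus_1_le:
  fixes z :: complex shows "norm (exp z - 1) \<le> norm z * exp (norm z)"
proof -
  have "norm (exp z - (\<Sum>k\<le>0. z ^ k / fact k)) \<le> exp \<bar>Re z\<bar> * (norm z) ^ Suc 0 / fact 0"
    by (rule Taylor_exp)
  also have "\<dots> \<le> norm z * exp (norm z)"
    using abs_Re_le_cmod[of z] by (simp add: mult.commute mult_left_mono)
  finally show ?thesis by simp
qed

text \<open>One \<open>norm b\<close> comes from factoring out \<open>exp b\<close>, the other from
  bounding \<open>norm (a - b)\<close> in the exponent.\<close>

lemma norm_exp_diff_le:
  fixes a b :: complex shows "norm (exp a - exp b) \<le> exp (norm a + 2 * norm b) * norm (a - b)"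
proof -
  have "exp a - exp b = exp b * (exp (a - b) - 1)" by (simp add: algebra_simps exp_add[symmetric])
  then have "norm (exp a - exp b) = exp (Re b) * norm (exp (a - b) - 1)" by (simp add: norm_mult)
  also have "\<dots> \<le> exp (norm b) * (norm (a - b) * exp (norm a + norm b))"
  proof (rule mult_mono)
    show "exp (Re b) \<le> exp (norm b)" using complex_Re_le_cmod[of b] by simp
    have "norm (a - b) * exp (norm (a - b)) \<le> norm (a - b) * exp (norm a + norm b)"
      using norm_triangle_ineq4[of a b] by (intro mult_left_mono) auto
    then show "norm (exp (a - b) - 1) \<le> norm (a - b) * exp (norm a + norm b)"
      using norm_exp_minus_1_le[of "a - b"] by (rule order_trans[rotated])
  qed auto
  also have "\<dots> = exp (norm a + 2 * norm b) * norm (a - b)"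
    using exp_add[of "norm b" "norm a + norm b"] by (simp add: ac_simps)
  finally show ?thesis .
qed

text \<open>The half-angle formula turns the expression into a squared sine, and sin x / x tends to
  1 at 0. The case \<open>w = 0\<close> is separate because that limit requires a nonzero
  argument.\<close>

lemma tendsto_scaled_cos: "(\<lambda>n. 2 * (real n + 1)\<^sup>2 * (1 - cos (w / (real n + 1)))) \<longlonglongrightarrow> w\<^sup>2"
proof -
  have "(\<lambda>n. (2 * (real n + 1) * sin (w / 2 / (real n + 1)))\<^sup>2) \<longlonglongrightarrow> w\<^sup>2"
  proof (cases "w = 0")
    case False
    have "filterlim (\<lambda>n. w / 2 / (real n + 1)) (at 0) sequentially"
      unfolding filterlim_at
    proof (intro conjI)
      show "(\<lambda>n. w / 2 / (real n + 1)) \<longlonglongrightarrow> 0"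
        using LIMSEQ_Suc[OF lim_const_over_n[of "w / 2"]] by (simp add: add.commute)
      show "\<forall>\<^sub>F n in sequentially. w / 2 / (real n + 1) \<in> UNIV \<and> w / 2 / (real n + 1) \<noteq> 0"
        using False by (intro always_eventually) (auto simp: add_eq_0_iff)
    qed
    moreover have "((\<lambda>x::real. sin x / x) \<longlongrightarrow> 1) (at 0)" using DERIV_sin[of "0::real"] by (simp add: DERIV_def)
    ultimately have "(\<lambda>n. sin (w / 2 / (real n + 1)) / (w / 2 / (real n + 1))) \<longlonglongrightarrow> 1"
      by (rule filterlim_compose[rotated])
    then have "(\<lambda>n. (w * (sin (w / 2 / (real n + 1)) / (w / 2 / (real n + 1))))\<^sup>2) \<longlonglongrightarrow> (w * 1)\<^sup>2"
      by (intro tendsto_intros)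
    moreover have "w * (sin (w / 2 / (real n + 1)) / (w / 2 / (real n + 1)))
      = 2 * (real n + 1) * sin (w / 2 / (real n + 1))" for n
      using False by (simp add: field_simps)
    ultimately show ?thesis by simp
  qed simp
  moreover have "(2 * (real n + 1) * sin (w / 2 / (real n + 1)))\<^sup>2 = 2 * (real n + 1)\<^sup>2 * (1 - cos (w / (real n + 1)))" for n
  proof -
    have "cos (w / (real n + 1)) = 1 - 2 * (sin (w / 2 / (real n + 1)))\<^sup>2"
      unfolding cos_double_sin[symmetric] by (rule arg_cong[where f=cos]) (simp only: times_divide_eq_right)
    then show ?thesis by (simp only: power_mult_distrib) simp
  qed
  ultimately show ?thesis by simp
qed

text \<open>Bounded convergence: the deviation is at most \<open>e / 2\<close> off a bad event and
  at most \<open>B\<close> on it. The hypotheses concern \<open>0 < t\<close> only, since the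
  processes in question are averages over time.\<close>

lemma (in prob_space) converges_in_prob_imp_L1:
  fixes Y :: "real \<Rightarrow> 'a \<Rightarrow> real"
  assumes conv: "converges_in_prob M Y (\<lambda>_. z) at_top"
    and Y: "\<And>t. 0 < t \<Longrightarrow> Y t \<in> borel_measurable M"
    and B: "\<And>t \<omega>. 0 < t \<Longrightarrow> \<omega> \<in> space M \<Longrightarrow> \<bar>Y t \<omega> - z\<bar> \<le> B"
  shows "((\<lambda>t. LINT \<omega>|M. \<bar>Y t \<omega> - z\<bar>) \<longlongrightarrow> 0) at_top"
proof (rule tendstoI)
  fix e :: real assume e: "0 < e"
  obtain \<omega>0 where "\<omega>0 \<in> space M" using not_empty by blast
  then have B0: "0 \<le> B" using B[of 1 \<omega>0] by force
  have "((\<lambda>t. B * measure M {\<omega> \<in> space M. \<bar>Y t \<omega> - z\<bar> > e / 2}) \<longlongrightarrow> B * 0) at_top"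
    using conv[unfolded converges_in_prob_def, rule_format, of "e / 2"] e by (intro tendsto_mult tendsto_const) simp
  then have "\<forall>\<^sub>F t in at_top. B * measure M {\<omega> \<in> space M. \<bar>Y t \<omega> - z\<bar> > e / 2} < e / 2"
    using e by (intro order_tendstoD(2)) auto
  then show "\<forall>\<^sub>F t in at_top. dist (LINT \<omega>|M. \<bar>Y t \<omega> - z\<bar>) 0 < e"
    using eventually_gt_at_top[of 0]
  proof eventually_elim
    case (elim t)
    note [measurable] = Y[OF elim(2)]
    define A where "A = {\<omega> \<in> space M. \<bar>Y t \<omega> - z\<bar> > e / 2}"
    have A: "A \<in> sets M" unfolding A_def by measurable
    have "(LINT \<omega>|M. \<bar>Y t \<omega> - z\<bar>) \<le> (LINT \<omega>|M. e / 2 + B * indicator A \<omega>)"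
    proof (rule integral_mono)
      show "integrable M (\<lambda>\<omega>. \<bar>Y t \<omega> - z\<bar>)"
        using B[OF elim(2)] by (intro integrable_const_bound[where B=B]) auto
      show "integrable M (\<lambda>\<omega>. e / 2 + B * indicator A \<omega>)"
        using A by (intro Bochner_Integration.integrable_add integrable_const integrable_mult_right integrable_real_indicator)
          (simp_all add: less_top[symmetric])
      show "\<bar>Y t \<omega> - z\<bar> \<le> e / 2 + B * indicator A \<omega>" if "\<omega> \<in> space M" for \<omega>
        using B[OF elim(2) that] that e by (auto simp: indicator_def A_def)
    qed
    also have "\<dots> = e / 2 + B * measure M A" using A by (simp add: prob_space less_top[symmetric])
    also have "\<dots> < e" using elim(1) by (simp add: A_def)
    finally show ?case by (simp add: dist_real_def integral_nonneg_AE)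
  qed
qed

section \<open>Expansion of the cumulant and the compensated integral\<close>

context counting_intensity
begin

definition comp_int :: "(real \<times> 'a \<Rightarrow> real) \<Rightarrow> real \<Rightarrow> 'a \<Rightarrow> real" where
  "comp_int h t \<omega> = (LINT u:{0..t}|Lam \<omega>. h (u, \<omega>))"

definition mart_int :: "(real \<times> 'a \<Rightarrow> real) \<Rightarrow> real \<Rightarrow> 'a \<Rightarrow> real" where
  "mart_int h t \<omega> = stoch_int h t \<omega> - comp_int h t \<omega>"

text \<open>This is the \<Phi> of the overview: removing the linear term replaces the integral
  against dN by the compensated one. As the integral of \<open>exp (\<i> * h) - 1 - \<i> * h\<close>
  it is of second order in \<open>h\<close>.\<close>

definition cumulant_remainder :: "(real \<times> 'a \<Rightarrow> real) \<Rightarrow> real \<Rightarrow> 'a \<Rightarrow> complex" where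
  "cumulant_remainder h t \<omega> = cumulant h t \<omega> - \<i> * comp_int h t \<omega>"

lemma exp_mart_eq: "exp_mart h t \<omega> = exp (\<i> * mart_int h t \<omega>) * exp (- cumulant_remainder h t \<omega>)"
  by (simp add: exp_mart_def mart_int_def cumulant_remainder_def exp_add[symmetric] algebra_simps)

lemma mart_int_scale: "mart_int (\<lambda>x. \<theta> * h x) t \<omega> = \<theta> * mart_int h t \<omega>"
  by (simp add: mart_int_def stoch_int_def comp_int_def right_diff_distrib)

context
  fixes h :: "real \<times> 'a \<Rightarrow> real" and C :: real
  assumes h: "h \<in> borel_measurable P"
    and h_le: "\<And>t \<omega>. 0 \<le> t \<Longrightarrow> \<omega> \<in> space M \<Longrightarrow> \<bar>h (t, \<omega>)\<bar> \<le> C"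
begin

lemma bound_nonneg: "0 \<le> C"
proof -
  obtain \<omega> where "\<omega> \<in> space M" using not_empty by blast
  from h_le[OF order_refl this] show ?thesis by simp
qed

lemma square_predictable_bounded: "(\<lambda>x. (h x)\<^sup>2) \<in> borel_measurable P"
  "\<And>t \<omega>. 0 \<le> t \<Longrightarrow> \<omega> \<in> space M \<Longrightarrow> \<bar>(h (t, \<omega>))\<^sup>2\<bar> \<le> C\<^sup>2"
  using h h_le by (auto intro!: power2_le_imp_le simp: abs_le_square_iff[symmetric] bound_nonneg)

lemma comp_int_measurable: "0 \<le> t \<Longrightarrow> comp_int h t \<in> borel_measurable (F t)"
  using kernel_integral_measurable_real[OF adapted_Lam _ h] h_le unfolding comp_int_def[abs_def] real_norm_def by blast

lemma mart_int_measurable: "0 \<le> t \<Longrightarrow> mart_int h t \<in> borel_measurable M"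
  using measurable_F_M[OF _ comp_int_measurable] measurable_F_M[OF _ stoch_int_measurable[OF h h_le]]
  unfolding mart_int_def[abs_def] by simp

lemma cumulant_remainder_measurable: "0 \<le> t \<Longrightarrow> cumulant_remainder h t \<in> borel_measurable M"
  using measurable_F_M[OF _ comp_int_measurable] measurable_F_M[OF _ cumulant_measurable[OF h h_le]]
  unfolding cumulant_remainder_def[abs_def] by simp

lemma abs_comp_int_le:
  assumes "0 \<le> t" "\<omega> \<in> space M" shows "\<bar>comp_int h t \<omega>\<bar> \<le> C * c * t"
proof -
  have "norm (comp_int h t \<omega>) \<le> C * measure (Lam \<omega>) {0..t}"
    unfolding comp_int_def
    using h_le by (intro norm_section_set_integral_le[OF adapted_Lam h _ assms(2,1)]) auto
  also have "\<dots> \<le> C * (c * t)"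
    using measure_Lam_le[OF assms(2), of "{0..t}" 0 t] assms bound_nonneg by (intro mult_left_mono) auto
  finally show ?thesis by (simp add: mult.assoc)
qed

lemma cumulant_remainder_integral:
  assumes "0 \<le> t" "\<omega> \<in> space M"
  shows "set_integrable (Lam \<omega>) {0..t} (\<lambda>u. exp (\<i> * h (u, \<omega>)) - 1 - \<i> * h (u, \<omega>))"
    "cumulant_remainder h t \<omega> = (LINT u:{0..t}|Lam \<omega>. exp (\<i> * h (u, \<omega>)) - 1 - \<i> * h (u, \<omega>))"
proof -
  have 1: "set_integrable (Lam \<omega>) {0..t} (\<lambda>u. exp (\<i> * h (u, \<omega>)) - 1)"
    by (rule section_set_integrable[OF adapted_Lam iexp_minus_1_measurable[OF h h_le] norm_iexp_minus_1_le assms(2,1)])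
  have 2: "set_integrable (Lam \<omega>) {0..t} (\<lambda>u. \<i> * complex_of_real (h (u, \<omega>)))"
    using section_set_integrable[OF adapted_Lam, of "\<lambda>x. \<i> * complex_of_real (h x)" C] h h_le assms
    by (simp add: norm_mult)
  show "set_integrable (Lam \<omega>) {0..t} (\<lambda>u. exp (\<i> * h (u, \<omega>)) - 1 - \<i> * h (u, \<omega>))"
    by (rule set_integral_diff(1)[OF 1 2])
  show "cumulant_remainder h t \<omega> = (LINT u:{0..t}|Lam \<omega>. exp (\<i> * h (u, \<omega>)) - 1 - \<i> * h (u, \<omega>))"
    unfolding set_integral_diff(2)[OF 1 2] cumulant_remainder_def cumulant_def comp_int_def
    by (simp add: set_integral_complex_of_real)
qed

text \<open>The integrand is bounded by half the square of \<open>h\<close>. Since the bound is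
  quadratic in \<open>C\<close> and linear in \<open>t\<close>, scaling \<open>h\<close> by
  \<open>1 / sqrt t\<close> makes it independent of \<open>t\<close>.\<close>

lemma norm_cumulant_remainder_le:
  assumes "0 \<le> t" "\<omega> \<in> space M"
  shows "norm (cumulant_remainder h t \<omega>) \<le> C\<^sup>2 / 2 * c * t"
proof -
  have "norm (cumulant_remainder h t \<omega>) \<le> C\<^sup>2 / 2 * measure (Lam \<omega>) {0..t}"
    unfolding cumulant_remainder_integral(2)[OF assms]
  proof (rule norm_set_integral_le[OF cumulant_remainder_integral(1)[OF assms]])
    show "norm (exp (\<i> * h (u, \<omega>)) - 1 - \<i> * h (u, \<omega>)) \<le> C\<^sup>2 / 2" if "u \<in> {0..t}" for u
    proof -
      have "norm (exp (\<i> * h (u, \<omega>)) - 1 - \<i> * h (u, \<omega>)) \<le> \<bar>h (u, \<omega>)\<bar>\<^sup>2 / 2"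
        using iexp_approx1[of "h (u, \<omega>)" 1] by (simp add: algebra_simps numeral_2_eq_2)
      also have "\<dots> \<le> C\<^sup>2 / 2" using h_le[of u \<omega>] that assms by (intro divide_right_mono power_mono) auto
      finally show ?thesis .
    qed
  qed (use emeasure_Lam_finite[OF assms(2), of "{0..t}" 0 t] assms in auto)
  also have "\<dots> \<le> C\<^sup>2 / 2 * (c * t)"
    using measure_Lam_le[OF assms(2), of "{0..t}" 0 t] assms by (intro mult_left_mono) auto
  finally show ?thesis by (simp add: mult.assoc)
qed

text \<open>Taylor expansion one order further identifies the leading term as minus half the
  integral of the square. The error is cubic in \<open>C\<close>, hence of order
  \<open>1 / sqrt t\<close> after scaling by \<open>1 / sqrt t\<close>.\<close>

lemma cumulant_remainder_approx:
  assumes "0 \<le> t" "\<omega> \<in> space M"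
  shows "norm (cumulant_remainder h t \<omega> + comp_int (\<lambda>x. (h x)\<^sup>2) t \<omega> / 2) \<le> C ^ 3 / 6 * c * t"
proof -
  have m: "(\<lambda>x. complex_of_real ((h x)\<^sup>2 / 2)) \<in> borel_measurable P"
    using h by measurable
  have 2: "set_integrable (Lam \<omega>) {0..t} (\<lambda>u. complex_of_real ((h (u, \<omega>))\<^sup>2 / 2))"
    by (rule section_set_integrable[OF adapted_Lam m _ assms(2,1), of "C\<^sup>2 / 2"])
      (use square_predictable_bounded(2) in \<open>simp add: norm_divide norm_power\<close>)
  note i = set_integral_add[OF cumulant_remainder_integral(1)[OF assms] 2]
  have "complex_of_real (comp_int (\<lambda>x. (h x)\<^sup>2) t \<omega> / 2) = (LINT u:{0..t}|Lam \<omega>. complex_of_real ((h (u, \<omega>))\<^sup>2 / 2))"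
    unfolding comp_int_def set_integral_complex_of_real by simp
  then have eq: "cumulant_remainder h t \<omega> + comp_int (\<lambda>x. (h x)\<^sup>2) t \<omega> / 2
    = (LINT u:{0..t}|Lam \<omega>. exp (\<i> * h (u, \<omega>)) - 1 - \<i> * h (u, \<omega>) + complex_of_real ((h (u, \<omega>))\<^sup>2 / 2))"
    unfolding i(2) cumulant_remainder_integral(2)[OF assms] by simp
  have "norm (cumulant_remainder h t \<omega> + comp_int (\<lambda>x. (h x)\<^sup>2) t \<omega> / 2) \<le> C ^ 3 / 6 * measure (Lam \<omega>) {0..t}"
    unfolding eq
  proof (rule norm_set_integral_le[OF i(1)])
    show "norm (exp (\<i> * h (u, \<omega>)) - 1 - \<i> * h (u, \<omega>) + complex_of_real ((h (u, \<omega>))\<^sup>2 / 2)) \<le> C ^ 3 / 6"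
      if "u \<in> {0..t}" for u
    proof -
      have "norm (exp (\<i> * h (u, \<omega>)) - 1 - \<i> * h (u, \<omega>) + complex_of_real ((h (u, \<omega>))\<^sup>2 / 2)) \<le> \<bar>h (u, \<omega>)\<bar> ^ 3 / 6"
        using iexp_approx1[of "h (u, \<omega>)" 2]
        by (simp add: algebra_simps numeral_2_eq_2 numeral_3_eq_3 power_mult_distrib)
      also have "\<dots> \<le> C ^ 3 / 6" using h_le[of u \<omega>] that assms by (intro divide_right_mono power_mono) auto
      finally show ?thesis .
    qed
  qed (use emeasure_Lam_finite[OF assms(2), of "{0..t}" 0 t] assms in auto)
  also have "\<dots> \<le> C ^ 3 / 6 * (c * t)"
    using measure_Lam_le[OF assms(2), of "{0..t}" 0 t] assms bound_nonneg by (intro mult_left_mono) auto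
  finally show ?thesis by (simp add: mult.assoc)
qed

text \<open>The 1 is the mean of \<open>exp_mart\<close>, so the difference is the mean of
  \<open>exp (\<i> * mart_int h t \<omega>)\<close> times
  \<open>k - exp (- cumulant_remainder h t \<omega>)\<close>, and the first factor has modulus 1.
  The dependence between the two factors is thus harmless.\<close>

lemma char_mart_int_error:
  assumes t: "0 \<le> t"
  shows "norm (k * (LINT \<omega>|M. exp (\<i> * mart_int h t \<omega>)) - 1)
    \<le> (LINT \<omega>|M. norm (k - exp (- cumulant_remainder h t \<omega>)))"
    and "integrable M (\<lambda>\<omega>. norm (k - exp (- cumulant_remainder h t \<omega>)))"
proof -
  note [measurable] = mart_int_measurable[OF t] cumulant_remainder_measurable[OF t]
  have b: "norm (exp (- cumulant_remainder h t \<omega>)) \<le> exp (C\<^sup>2 / 2 * c * t)" if "\<omega> \<in> space M" for \<omega>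
    using norm_cumulant_remainder_le[OF t that] abs_Re_le_cmod[of "cumulant_remainder h t \<omega>"] by simp
  have i1: "integrable M (\<lambda>\<omega>. exp (\<i> * mart_int h t \<omega>))"
    by (intro integrable_const_bound[where B=1]) auto
  have i2: "integrable M (\<lambda>\<omega>. exp (- cumulant_remainder h t \<omega>))"
    using b by (intro integrable_const_bound[where B="exp (C\<^sup>2 / 2 * c * t)"]) auto
  show i3: "integrable M (\<lambda>\<omega>. norm (k - exp (- cumulant_remainder h t \<omega>)))"
    using i2 by (intro integrable_norm Bochner_Integration.integrable_diff) auto
  have i4: "integrable M (exp_mart h t)" by (rule integrable_exp_mart[OF h h_le t])
  have "k * (LINT \<omega>|M. exp (\<i> * mart_int h t \<omega>)) - 1
      = (LINT \<omega>|M. k * exp (\<i> * mart_int h t \<omega>)) - (LINT \<omega>|M. exp_mart h t \<omega>)"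
    using mean_exp_mart[OF h h_le t] by simp
  also have "\<dots> = (LINT \<omega>|M. k * exp (\<i> * mart_int h t \<omega>) - exp_mart h t \<omega>)"
    using i1 i4 by (intro Bochner_Integration.integral_diff[symmetric]) auto
  finally have "norm (k * (LINT \<omega>|M. exp (\<i> * mart_int h t \<omega>)) - 1)
      \<le> (LINT \<omega>|M. norm (k * exp (\<i> * mart_int h t \<omega>) - exp_mart h t \<omega>))"
    by (simp only: integral_norm_bound)
  moreover have "norm (k * exp (\<i> * mart_int h t \<omega>) - exp_mart h t \<omega>)
      = norm (k - exp (- cumulant_remainder h t \<omega>))" for \<omega>
  proof -
    have "k * exp (\<i> * mart_int h t \<omega>) - exp_mart h t \<omega>
        = exp (\<i> * mart_int h t \<omega>) * (k - exp (- cumulant_remainder h t \<omega>))"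
      by (simp add: exp_mart_eq algebra_simps)
    then show ?thesis by (simp add: norm_mult)
  qed
  ultimately show "norm (k * (LINT \<omega>|M. exp (\<i> * mart_int h t \<omega>)) - 1)
    \<le> (LINT \<omega>|M. norm (k - exp (- cumulant_remainder h t \<omega>)))" by simp
qed

text \<open>The case \<open>k = 1\<close> of \<open>char_mart_int_error\<close>, in its real part.
  The bound is quadratic in \<open>C\<close>, which matches the division by the squared scale in the
  second moment.\<close>

lemma mean_one_minus_cos_le:
  assumes t: "0 \<le> t"
  shows "(LINT \<omega>|M. 1 - cos (mart_int h t \<omega>)) \<le> C\<^sup>2 / 2 * c * t * exp (C\<^sup>2 / 2 * c * t)"
proof -
  note [measurable] = mart_int_measurable[OF t]
  let ?b = "C\<^sup>2 / 2 * c * t"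
  have i1: "integrable M (\<lambda>\<omega>. exp (\<i> * mart_int h t \<omega>))"
    by (intro integrable_const_bound[where B=1]) auto
  have ic: "integrable M (\<lambda>\<omega>. cos (mart_int h t \<omega>))"
    by (intro integrable_const_bound[where B=1]) auto
  have "(LINT \<omega>|M. 1 - cos (mart_int h t \<omega>)) = 1 - (LINT \<omega>|M. Re (exp (\<i> * mart_int h t \<omega>)))"
    using ic by (simp add: prob_space Re_exp)
  also have "\<dots> = - Re (1 * (LINT \<omega>|M. exp (\<i> * mart_int h t \<omega>)) - 1)"
    using integral_Re[OF i1] by simp
  also have "\<dots> \<le> norm (1 * (LINT \<omega>|M. exp (\<i> * mart_int h t \<omega>)) - 1)"
    using abs_Re_le_cmod[of "1 * (LINT \<omega>|M. exp (\<i> * mart_int h t \<omega>)) - 1"] by linarith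
  also have "\<dots> \<le> (LINT \<omega>|M. norm (1 - exp (- cumulant_remainder h t \<omega>)))"
    by (rule char_mart_int_error(1)[OF t])
  also have "\<dots> \<le> (LINT \<omega>|M. ?b * exp ?b)"
  proof (rule integral_mono[OF char_mart_int_error(2)[OF t]])
    fix \<omega> assume \<omega>: "\<omega> \<in> space M"
    have "norm (1 - exp (- cumulant_remainder h t \<omega>)) \<le> norm (cumulant_remainder h t \<omega>) * exp (norm (cumulant_remainder h t \<omega>))"
      using norm_exp_minus_1_le[of "- cumulant_remainder h t \<omega>"] by (simp add: norm_minus_commute)
    also have "\<dots> \<le> ?b * exp ?b"
      using norm_cumulant_remainder_le[OF t \<omega>] c_nonneg t by (intro mult_mono) auto
    finally show "norm (1 - exp (- cumulant_remainder h t \<omega>)) \<le> ?b * exp ?b" .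
  qed simp
  also have "\<dots> = ?b * exp ?b" by (simp add: prob_space)
  finally show ?thesis .
qed

end

section \<open>Second moment and limit of the characteristic function\<close>

context
  fixes h :: "real \<times> 'a \<Rightarrow> real" and C :: real
  assumes h: "h \<in> borel_measurable P"
    and h_le: "\<And>t \<omega>. 0 \<le> t \<Longrightarrow> \<omega> \<in> space M \<Longrightarrow> \<bar>h (t, \<omega>)\<bar> \<le> C"
begin

text \<open>Closing and reopening the context frees the preceding lemmas from the fixed
  \<open>h\<close>, so that they can be applied to multiples and to the square of
  \<open>h\<close>.\<close>

lemma scaled_le: "0 \<le> t \<Longrightarrow> \<omega> \<in> space M \<Longrightarrow> \<bar>\<theta> * h (t, \<omega>)\<bar> \<le> \<bar>\<theta>\<bar> * C"
  using h_le by (simp add: abs_mult mult_left_mono)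

lemma scaled_measurable: "(\<lambda>x. \<theta> * h x) \<in> borel_measurable P"
  using h by simp

text \<open>The second moment is read off the characteristic function: \<open>2 (1 - cos (\<theta> w)) / \<theta>\<^sup>2\<close> tends to
  \<open>w\<^sup>2\<close> as \<open>\<theta>\<close> tends to 0, so Fatou's lemma applies.\<close>

lemma mart_int_second_moment:
  assumes t: "0 \<le> t"
  shows "integrable M (\<lambda>\<omega>. (mart_int h t \<omega>)\<^sup>2)" "(LINT \<omega>|M. (mart_int h t \<omega>)\<^sup>2) \<le> C\<^sup>2 * c * t"
proof -
  note [measurable] = mart_int_measurable[OF h h_le t]
  define f where "f n \<omega> = 2 * (real n + 1)\<^sup>2 * (1 - cos (mart_int h t \<omega> / (real n + 1)))" for n \<omega>
  \<comment> \<open>This is the bound on the cumulant remainder for the scale \<theta> = 1 / (n +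
    1).\<close>
  define b where "b n = C\<^sup>2 / 2 * c * t / (real n + 1)\<^sup>2" for n
  have f0: "0 \<le> f n \<omega>" for n \<omega> by (simp add: f_def)
  have fm [measurable]: "f n \<in> borel_measurable M" for n unfolding f_def[abs_def] by measurable
  have fb: "norm (f n \<omega>) \<le> 2 * (real n + 1)\<^sup>2 * 2" for n \<omega>
  proof -
    have "1 - cos (mart_int h t \<omega> / (real n + 1)) \<le> 2"
      using cos_ge_minus_one[of "mart_int h t \<omega> / (real n + 1)"] by linarith
    then have "f n \<omega> \<le> 2 * (real n + 1)\<^sup>2 * 2" unfolding f_def by (intro mult_left_mono) auto
    then show ?thesis using f0[of n \<omega>] by simp
  qed
  have fi: "integrable M (f n)" for n
    by (rule integrable_const_bound[OF AE_I2[OF fb] fm])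
  have fE: "(LINT \<omega>|M. f n \<omega>) \<le> C\<^sup>2 * c * t * exp (b n)" for n
  proof -
    let ?\<theta> = "1 / (real n + 1)"
    have "(LINT \<omega>|M. 1 - cos (mart_int (\<lambda>x. ?\<theta> * h x) t \<omega>))
        \<le> (\<bar>?\<theta>\<bar> * C)\<^sup>2 / 2 * c * t * exp ((\<bar>?\<theta>\<bar> * C)\<^sup>2 / 2 * c * t)"
      by (rule mean_one_minus_cos_le[OF scaled_measurable scaled_le t])
    also have "(\<bar>?\<theta>\<bar> * C)\<^sup>2 / 2 * c * t = b n"
      by (simp add: b_def power_divide power_mult_distrib)
    finally have "(LINT \<omega>|M. 1 - cos (?\<theta> * mart_int h t \<omega>)) \<le> b n * exp (b n)"
      by (simp only: mart_int_scale)
    then have le: "(LINT \<omega>|M. 1 - cos (mart_int h t \<omega> / (real n + 1))) \<le> b n * exp (b n)"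
      by simp
    have "(LINT \<omega>|M. f n \<omega>) = 2 * (real n + 1)\<^sup>2 * (LINT \<omega>|M. 1 - cos (mart_int h t \<omega> / (real n + 1)))"
      unfolding f_def by simp
    also have "\<dots> \<le> 2 * (real n + 1)\<^sup>2 * (b n * exp (b n))"
      by (intro mult_left_mono le) auto
    \<comment> \<open>The squared scale in \<open>b n\<close> cancels the factor of
      \<open>f n\<close>; what is left over, \<open>exp (b n)\<close>, tends to 1.\<close>
    also have "\<dots> = C\<^sup>2 * c * t * exp (b n)"
      by (simp add: b_def)
    finally show ?thesis .
  qed
  have b_lim: "(\<lambda>n. C\<^sup>2 * c * t * exp (b n)) \<longlonglongrightarrow> C\<^sup>2 * c * t"
  proof -
    have "(\<lambda>n. C\<^sup>2 / 2 * c * t * (inverse (real (Suc n)))\<^sup>2) \<longlonglongrightarrow> C\<^sup>2 / 2 * c * t * 0\<^sup>2"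
      by (intro tendsto_intros LIMSEQ_inverse_real_of_nat)
    then have "b \<longlonglongrightarrow> 0" unfolding b_def[abs_def] by (simp add: field_simps)
    then have "(\<lambda>n. C\<^sup>2 * c * t * exp (b n)) \<longlonglongrightarrow> C\<^sup>2 * c * t * exp 0" by (intro tendsto_intros)
    then show ?thesis by simp
  qed
  have "(\<integral>\<^sup>+\<omega>. ennreal ((mart_int h t \<omega>)\<^sup>2) \<partial>M) = (\<integral>\<^sup>+\<omega>. liminf (\<lambda>n. ennreal (f n \<omega>)) \<partial>M)"
  proof (intro nn_integral_cong)
    fix \<omega>
    have "(\<lambda>n. ennreal (f n \<omega>)) \<longlonglongrightarrow> ennreal ((mart_int h t \<omega>)\<^sup>2)"
      unfolding f_def by (intro tendsto_ennrealI tendsto_scaled_cos)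
    then show "ennreal ((mart_int h t \<omega>)\<^sup>2) = liminf (\<lambda>n. ennreal (f n \<omega>))"
      by (simp add: lim_imp_Liminf)
  qed
  also have "\<dots> \<le> liminf (\<lambda>n. \<integral>\<^sup>+\<omega>. ennreal (f n \<omega>) \<partial>M)"
    by (intro nn_integral_liminf) simp
  also have "\<dots> \<le> liminf (\<lambda>n. ennreal (C\<^sup>2 * c * t * exp (b n)))"
  proof (intro Liminf_mono always_eventually allI)
    fix n
    have "(\<integral>\<^sup>+\<omega>. ennreal (f n \<omega>) \<partial>M) = ennreal (LINT \<omega>|M. f n \<omega>)"
      using fi f0 by (intro nn_integral_eq_integral) auto
    then show "(\<integral>\<^sup>+\<omega>. ennreal (f n \<omega>) \<partial>M) \<le> ennreal (C\<^sup>2 * c * t * exp (b n))"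
      using fE by (simp add: ennreal_leI)
  qed
  also have "\<dots> = ennreal (C\<^sup>2 * c * t)"
    using b_lim by (intro lim_imp_Liminf tendsto_ennrealI) auto
  finally have le: "(\<integral>\<^sup>+\<omega>. ennreal ((mart_int h t \<omega>)\<^sup>2) \<partial>M) \<le> ennreal (C\<^sup>2 * c * t)" .
  show i: "integrable M (\<lambda>\<omega>. (mart_int h t \<omega>)\<^sup>2)"
    using le by (intro integrableI_nonneg) (auto simp: less_top[symmetric] top_unique)
  have "ennreal (LINT \<omega>|M. (mart_int h t \<omega>)\<^sup>2) \<le> ennreal (C\<^sup>2 * c * t)"
    using i le by (subst nn_integral_eq_integral[symmetric]) auto
  then show "(LINT \<omega>|M. (mart_int h t \<omega>)\<^sup>2) \<le> C\<^sup>2 * c * t"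
    using c_nonneg t by simp
qed

text \<open>Chebyshev's inequality: the second moment grows only linearly in \<open>t\<close>,
  against \<open>t\<^sup>2\<close> from the normalisation.\<close>

lemma mart_int_tail:
  assumes t: "0 < t" and d: "0 < d"
  shows "measure M {\<omega> \<in> space M. \<bar>mart_int h t \<omega> / t\<bar> > d} \<le> C\<^sup>2 * c / (d\<^sup>2 * t)"
proof -
  have t0: "0 \<le> t" using t by simp
  note [measurable] = mart_int_measurable[OF h h_le t0]
  let ?A = "{\<omega> \<in> space M. \<bar>mart_int h t \<omega> / t\<bar> > d}"
  have A: "?A \<in> sets M" by measurable
  have "(d * t)\<^sup>2 * measure M ?A = (LINT \<omega>|M. (d * t)\<^sup>2 * indicator ?A \<omega>)"
    using A by simp
  also have "\<dots> \<le> (LINT \<omega>|M. (mart_int h t \<omega>)\<^sup>2)"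
  proof (rule integral_mono[OF _ mart_int_second_moment(1)[OF t0]])
    show "integrable M (\<lambda>\<omega>. (d * t)\<^sup>2 * indicator ?A \<omega>)"
      using A by (intro integrable_mult_right integrable_real_indicator) (simp_all add: less_top[symmetric])
    fix \<omega> assume "\<omega> \<in> space M"
    have "(d * t)\<^sup>2 \<le> (mart_int h t \<omega>)\<^sup>2" if "d < \<bar>mart_int h t \<omega> / t\<bar>"
    proof -
      have "d * t \<le> \<bar>mart_int h t \<omega>\<bar>" using that t by (simp add: field_simps)
      then have "(d * t)\<^sup>2 \<le> \<bar>mart_int h t \<omega>\<bar>\<^sup>2" using d t by (intro power_mono) auto
      then show ?thesis by simp
    qed
    then show "(d * t)\<^sup>2 * indicator ?A \<omega> \<le> (mart_int h t \<omega>)\<^sup>2"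
      by (auto simp: indicator_def)
  qed
  also have "\<dots> \<le> C\<^sup>2 * c * t" by (rule mart_int_second_moment(2)[OF t0])
  finally have "measure M ?A \<le> C\<^sup>2 * c * t / (d * t)\<^sup>2"
    using t d by (simp add: field_simps)
  also have "\<dots> = C\<^sup>2 * c / (d\<^sup>2 * t)" using t by (simp add: power2_eq_square field_simps)
  finally show ?thesis .
qed

lemma mart_int_law_of_large_numbers:
  "converges_in_prob M (\<lambda>t \<omega>. mart_int h t \<omega> / t) (\<lambda>_. 0) at_top"
  unfolding converges_in_prob_def
proof (intro allI impI)
  fix d :: real assume d: "0 < d"
  show "((\<lambda>t. measure M {\<omega> \<in> space M. \<bar>mart_int h t \<omega> / t - 0\<bar> > d}) \<longlongrightarrow> 0) at_top"
  proof (rule tendsto_sandwich[where f="\<lambda>_. 0" and h="\<lambda>t. C\<^sup>2 * c / d\<^sup>2 * inverse t"])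
    show "\<forall>\<^sub>F t in at_top. measure M {\<omega> \<in> space M. \<bar>mart_int h t \<omega> / t - 0\<bar> > d} \<le> C\<^sup>2 * c / d\<^sup>2 * inverse t"
      using eventually_gt_at_top[of 0]
      by eventually_elim (use mart_int_tail[OF _ d] in \<open>simp add: field_simps\<close>)
    have "((\<lambda>t. C\<^sup>2 * c / d\<^sup>2 * inverse t) \<longlongrightarrow> C\<^sup>2 * c / d\<^sup>2 * 0) at_top"
      by (intro tendsto_intros tendsto_inverse_0_at_top filterlim_ident)
    then show "((\<lambda>t. C\<^sup>2 * c / d\<^sup>2 * inverse t) \<longlongrightarrow> 0) at_top" by simp
  qed (auto)
qed

text \<open>Applied to \<open>u / sqrt t * h\<close>, \<open>char_mart_int_error\<close> reduces the
  claim to convergence in mean of the cumulant remainder to \<open>- (u\<^sup>2 * v / 2)\<close>.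
  One error is the deviation of the averaged compensator of the square from \<open>v\<close>, the
  other the cubic Taylor term.\<close>

lemma char_mart_int_limit:
  assumes conv: "converges_in_prob M (\<lambda>t \<omega>. comp_int (\<lambda>x. (h x)\<^sup>2) t \<omega> / t) (\<lambda>_. v) at_top"
    and v: "0 \<le> v"
  shows "((\<lambda>t. LINT \<omega>|M. exp (\<i> * complex_of_real (u * (mart_int h t \<omega> / sqrt t))))
    \<longlongrightarrow> complex_of_real (exp (- (u\<^sup>2 * v / 2)))) at_top"
proof -
  define V where "V t \<omega> = comp_int (\<lambda>x. (h x)\<^sup>2) t \<omega> / t" for t \<omega>
  define k where "k = exp (complex_of_real (u\<^sup>2 * v / 2))"
  \<comment> \<open>A Lipschitz constant of \<open>exp\<close> on the values that occur:
    \<open>u\<^sup>2 * C\<^sup>2 / 2 * c\<close> bounds the remainder of the scaled integrand for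
    every \<open>t\<close>.\<close>
  define K where "K = exp (norm (complex_of_real (u\<^sup>2 * v / 2)) + 2 * (u\<^sup>2 * C\<^sup>2 / 2 * c))"
  let ?\<phi> = "\<lambda>t. LINT \<omega>|M. exp (\<i> * complex_of_real (u * (mart_int h t \<omega> / sqrt t)))"
  let ?g = "\<lambda>t. K * (u\<^sup>2 / 2 * (LINT \<omega>|M. \<bar>V t \<omega> - v\<bar>) + \<bar>u\<bar> ^ 3 * C ^ 3 / 6 * c * inverse (sqrt t))"
  have Vm: "V t \<in> borel_measurable M" if "0 < t" for t
    using measurable_F_M[OF _ comp_int_measurable[OF square_predictable_bounded[OF h h_le]]] that unfolding V_def[abs_def] by simp
  have Vb: "\<bar>V t \<omega> - v\<bar> \<le> C\<^sup>2 * c + v" if "0 < t" "\<omega> \<in> space M" for t \<omega>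
  proof -
    have "\<bar>V t \<omega>\<bar> \<le> C\<^sup>2 * c"
      using abs_comp_int_le[OF square_predictable_bounded[OF h h_le], of t \<omega>] that by (simp add: V_def field_simps)
    then show ?thesis using v by linarith
  qed
  have L1: "((\<lambda>t. LINT \<omega>|M. \<bar>V t \<omega> - v\<bar>) \<longlongrightarrow> 0) at_top"
    using converges_in_prob_imp_L1[OF conv[folded V_def] Vm Vb] .
  have bound: "norm (k * ?\<phi> t - 1) \<le> ?g t" if t: "0 < t" for t
  proof -
    have t0: "0 \<le> t" using t by simp
    let ?\<theta> = "u / sqrt t"
    let ?h = "\<lambda>x. ?\<theta> * h x"
    let ?R = "cumulant_remainder ?h t"
    \<comment> \<open>The square of the scale cancels the factor \<open>t\<close> in the
      second-order bound; its cube leaves a decay of \<open>1 / sqrt t\<close> in the third-order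
      one.\<close>
    have \<theta>2: "\<bar>?\<theta>\<bar>\<^sup>2 = u\<^sup>2 / t" using t by (simp add: power_divide)
    have \<theta>3: "\<bar>?\<theta>\<bar> ^ 3 * t = \<bar>u\<bar> ^ 3 * inverse (sqrt t)"
    proof -
      have "sqrt t * sqrt t = t" using t by simp
      then have "(sqrt t) ^ 3 = t * sqrt t" by (simp add: numeral_3_eq_3)
      then show ?thesis using t by (simp add: power_divide field_simps)
    qed
    have "norm (k * (LINT \<omega>|M. exp (\<i> * mart_int ?h t \<omega>)) - 1) \<le> (LINT \<omega>|M. norm (k - exp (- ?R \<omega>)))"
      by (rule char_mart_int_error(1)[OF scaled_measurable scaled_le t0])
    also have "\<dots> \<le> (LINT \<omega>|M. K * (u\<^sup>2 / 2 * \<bar>V t \<omega> - v\<bar> + \<bar>u\<bar> ^ 3 * C ^ 3 / 6 * c * inverse (sqrt t)))"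
    proof (rule integral_mono[OF char_mart_int_error(2)[OF scaled_measurable scaled_le t0]])
      show "integrable M (\<lambda>\<omega>. K * (u\<^sup>2 / 2 * \<bar>V t \<omega> - v\<bar> + \<bar>u\<bar> ^ 3 * C ^ 3 / 6 * c * inverse (sqrt t)))"
        using Vm[OF t] Vb[OF t]
        by (intro integrable_mult_right Bochner_Integration.integrable_add integrable_const
            integrable_const_bound[where B="C\<^sup>2 * c + v"]) auto
      fix \<omega> assume \<omega>: "\<omega> \<in> space M"
      have R: "norm (?R \<omega>) \<le> u\<^sup>2 * C\<^sup>2 / 2 * c"
      proof -
        have "norm (?R \<omega>) \<le> (\<bar>?\<theta>\<bar> * C)\<^sup>2 / 2 * c * t"
          by (rule norm_cumulant_remainder_le[OF scaled_measurable scaled_le t0 \<omega>])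
        also have "\<dots> = u\<^sup>2 * C\<^sup>2 / 2 * c" unfolding power_mult_distrib \<theta>2 using t by simp
        finally show ?thesis .
      qed
      have "comp_int (\<lambda>x. (?h x)\<^sup>2) t \<omega> = u\<^sup>2 / t * comp_int (\<lambda>x. (h x)\<^sup>2) t \<omega>"
        unfolding power_mult_distrib comp_int_def using t by (simp add: power_divide)
      also have "\<dots> = u\<^sup>2 * V t \<omega>" by (simp add: V_def)
      finally have ci: "comp_int (\<lambda>x. (?h x)\<^sup>2) t \<omega> = u\<^sup>2 * V t \<omega>" .
      have "norm (?R \<omega> + comp_int (\<lambda>x. (?h x)\<^sup>2) t \<omega> / 2) \<le> (\<bar>?\<theta>\<bar> * C) ^ 3 / 6 * c * t"
        by (rule cumulant_remainder_approx[OF scaled_measurable scaled_le t0 \<omega>])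
      also have "\<dots> = (\<bar>?\<theta>\<bar> ^ 3 * t) * C ^ 3 / 6 * c"
        unfolding power_mult_distrib by (simp add: ac_simps)
      also have "\<dots> = \<bar>u\<bar> ^ 3 * C ^ 3 / 6 * c * inverse (sqrt t)" unfolding \<theta>3 by simp
      finally have A: "norm (?R \<omega> + complex_of_real (u\<^sup>2 * V t \<omega>) / 2) \<le> \<bar>u\<bar> ^ 3 * C ^ 3 / 6 * c * inverse (sqrt t)"
        unfolding ci by simp
      have "complex_of_real (u\<^sup>2 * v / 2) - (- ?R \<omega>)
          = complex_of_real (u\<^sup>2 / 2 * (v - V t \<omega>)) + (?R \<omega> + complex_of_real (u\<^sup>2 * V t \<omega>) / 2)"
        by (simp add: algebra_simps diff_divide_distrib)
      then have "norm (complex_of_real (u\<^sup>2 * v / 2) - (- ?R \<omega>))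
          \<le> norm (complex_of_real (u\<^sup>2 / 2 * (v - V t \<omega>))) + norm (?R \<omega> + complex_of_real (u\<^sup>2 * V t \<omega>) / 2)"
        by (metis norm_triangle_ineq)
      also have "\<dots> \<le> u\<^sup>2 / 2 * \<bar>V t \<omega> - v\<bar> + \<bar>u\<bar> ^ 3 * C ^ 3 / 6 * c * inverse (sqrt t)"
        using A unfolding norm_of_real by (simp add: abs_mult abs_minus_commute)
      finally have D: "norm (complex_of_real (u\<^sup>2 * v / 2) - (- ?R \<omega>)) \<le> \<dots>" .
      have "norm (k - exp (- ?R \<omega>)) \<le> exp (norm (complex_of_real (u\<^sup>2 * v / 2)) + 2 * norm (- ?R \<omega>))
          * norm (complex_of_real (u\<^sup>2 * v / 2) - (- ?R \<omega>))"
        unfolding k_def by (rule norm_exp_diff_le)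
      also have "\<dots> \<le> K * (u\<^sup>2 / 2 * \<bar>V t \<omega> - v\<bar> + \<bar>u\<bar> ^ 3 * C ^ 3 / 6 * c * inverse (sqrt t))"
        unfolding K_def using D R by (intro mult_mono) auto
      finally show "norm (k - exp (- ?R \<omega>)) \<le> \<dots>" .
    qed
    also have "\<dots> = ?g t"
    proof -
      have "integrable M (\<lambda>\<omega>. \<bar>V t \<omega> - v\<bar>)"
        using Vm[OF t] Vb[OF t] by (intro integrable_const_bound[where B="C\<^sup>2 * c + v"]) auto
      then show ?thesis by (simp add: prob_space)
    qed
    finally have le: "norm (k * (LINT \<omega>|M. exp (\<i> * mart_int ?h t \<omega>)) - 1) \<le> ?g t" .
    have "mart_int ?h t \<omega> = u * (mart_int h t \<omega> / sqrt t)" for \<omega>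
      unfolding mart_int_scale by simp
    from le[unfolded this] show ?thesis .
  qed
  have g0: "(?g \<longlongrightarrow> K * (u\<^sup>2 / 2 * 0 + \<bar>u\<bar> ^ 3 * C ^ 3 / 6 * c * 0)) at_top"
    by (intro tendsto_intros L1 tendsto_inverse_0_at_top sqrt_at_top)
  have "((\<lambda>t. k * ?\<phi> t - 1) \<longlongrightarrow> 0) at_top"
  proof (rule Lim_null_comparison)
    show "\<forall>\<^sub>F t in at_top. norm (k * ?\<phi> t - 1) \<le> ?g t"
      using eventually_gt_at_top[of 0] by eventually_elim (rule bound)
    show "(?g \<longlongrightarrow> 0) at_top" using g0 by simp
  qed
  then have "((\<lambda>t. (k * ?\<phi> t - 1 + 1) / k) \<longlongrightarrow> (0 + 1) / k) at_top"
    by (intro tendsto_intros) (simp_all add: k_def)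
  moreover have "(0 + 1) / k = complex_of_real (exp (- (u\<^sup>2 * v / 2)))"
    unfolding k_def exp_of_real by (simp add: exp_minus inverse_eq_divide)
  moreover have "(k * z - 1 + 1) / k = z" for z by (simp add: k_def)
  ultimately show ?thesis by simp
qed

end

section \<open>Replacing the variance by its estimator\<close>

context
  fixes h :: "real \<times> 'a \<Rightarrow> real" and C :: real
  assumes h: "h \<in> borel_measurable P"
    and h_le: "\<And>t \<omega>. 0 \<le> t \<Longrightarrow> \<omega> \<in> space M \<Longrightarrow> \<bar>h (t, \<omega>)\<bar> \<le> C"
begin

text \<open>The integral of the square against dN differs from that against d\<Lambda> by
  \<open>mart_int\<close> of the square, to which the law of large numbers applies because the
  square is again bounded and predictable.\<close>

lemma quadratic_variation_consistent:
  assumes conv: "converges_in_prob M (\<lambda>t \<omega>. comp_int (\<lambda>x. (h x)\<^sup>2) t \<omega> / t) (\<lambda>_. v) at_top"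
  shows "converges_in_prob M (\<lambda>t \<omega>. stoch_int (\<lambda>x. (h x)\<^sup>2) t \<omega> / t) (\<lambda>_. v) at_top"
  unfolding converges_in_prob_def
proof (intro allI impI)
  fix d :: real assume d: "0 < d"
  let ?W = "\<lambda>t \<omega>. mart_int (\<lambda>x. (h x)\<^sup>2) t \<omega> / t"
  let ?V = "\<lambda>t \<omega>. comp_int (\<lambda>x. (h x)\<^sup>2) t \<omega> / t"
  let ?Q = "\<lambda>t \<omega>. stoch_int (\<lambda>x. (h x)\<^sup>2) t \<omega> / t"
  let ?p = "\<lambda>t. measure M {\<omega> \<in> space M. \<bar>?W t \<omega> - 0\<bar> > d / 2} + measure M {\<omega> \<in> space M. \<bar>?V t \<omega> - v\<bar> > d / 2}"
  have "converges_in_prob M ?W (\<lambda>_. 0) at_top"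
    by (rule mart_int_law_of_large_numbers[OF square_predictable_bounded[OF h h_le]])
  from this[unfolded converges_in_prob_def, rule_format, of "d / 2"]
  have p: "(?p \<longlongrightarrow> 0 + 0) at_top"
    using conv[unfolded converges_in_prob_def, rule_format, of "d / 2"] d
    by (intro tendsto_add) simp_all
  show "((\<lambda>t. measure M {\<omega> \<in> space M. \<bar>?Q t \<omega> - v\<bar> > d}) \<longlongrightarrow> 0) at_top"
  proof (rule tendsto_sandwich[where f="\<lambda>_. 0" and h="?p"])
    show "\<forall>\<^sub>F t in at_top. measure M {\<omega> \<in> space M. \<bar>?Q t \<omega> - v\<bar> > d} \<le> ?p t"
      using eventually_gt_at_top[of 0]
    proof eventually_elim
      case (elim t)
      then have t: "0 \<le> t" by simp
      note [measurable] = mart_int_measurable[OF square_predictable_bounded[OF h h_le] t]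
        measurable_F_M[OF t comp_int_measurable[OF square_predictable_bounded[OF h h_le] t]]
      have "measure M {\<omega> \<in> space M. \<bar>?Q t \<omega> - v\<bar> > d}
          \<le> measure M ({\<omega> \<in> space M. \<bar>?W t \<omega> - 0\<bar> > d / 2} \<union> {\<omega> \<in> space M. \<bar>?V t \<omega> - v\<bar> > d / 2})"
      proof (rule finite_measure_mono)
        have Q: "?Q t \<omega> = ?W t \<omega> + ?V t \<omega>" for \<omega> by (simp add: mart_int_def diff_divide_distrib)
        show "{\<omega> \<in> space M. \<bar>?Q t \<omega> - v\<bar> > d}
          \<subseteq> {\<omega> \<in> space M. \<bar>?W t \<omega> - 0\<bar> > d / 2} \<union> {\<omega> \<in> space M. \<bar>?V t \<omega> - v\<bar> > d / 2}"
        proof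
          fix \<omega> assume \<omega>: "\<omega> \<in> {\<omega> \<in> space M. \<bar>?Q t \<omega> - v\<bar> > d}"
          then have "\<bar>?Q t \<omega> - v\<bar> > d" by blast
          then have "\<bar>?W t \<omega> - 0\<bar> > d / 2 \<or> \<bar>?V t \<omega> - v\<bar> > d / 2" unfolding Q by arith
          then show "\<omega> \<in> {\<omega> \<in> space M. \<bar>?W t \<omega> - 0\<bar> > d / 2} \<union> {\<omega> \<in> space M. \<bar>?V t \<omega> - v\<bar> > d / 2}"
            using \<omega> by blast
        qed
      qed measurable
      also have "\<dots> \<le> ?p t" by (rule measure_Un_le) measurable
      finally show ?case .
    qed
    show "(?p \<longlongrightarrow> 0) at_top" using p by simp
  qed auto
qed

text \<open>Slutsky's theorem at the level of characteristic functions. Off an event of small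
  probability the random factor \<open>1 / sqrt (Q t \<omega>)\<close> is within \<eta> of
  \<open>1 / sqrt v\<close>, and the second moment of \<open>W t\<close>, bounded uniformly in
  \<open>t\<close>, controls the product with this small difference.\<close>

lemma char_studentized_limit:
  assumes conv: "converges_in_prob M (\<lambda>t \<omega>. comp_int (\<lambda>x. (h x)\<^sup>2) t \<omega> / t) (\<lambda>_. v) at_top"
    and v: "0 < v"
  shows "((\<lambda>t. LINT \<omega>|M. exp (\<i> * complex_of_real (u * (mart_int h t \<omega> / sqrt (stoch_int (\<lambda>x. (h x)\<^sup>2) t \<omega>)))))
    \<longlongrightarrow> complex_of_real (exp (- (u\<^sup>2) / 2))) at_top"
proof -
  define Q where "Q t \<omega> = stoch_int (\<lambda>x. (h x)\<^sup>2) t \<omega> / t" for t \<omega>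
  define T where "T t \<omega> = u * (mart_int h t \<omega> / sqrt (stoch_int (\<lambda>x. (h x)\<^sup>2) t \<omega>))" for t \<omega>
  define W where "W t \<omega> = mart_int h t \<omega> / sqrt t" for t \<omega>
  define U where "U t \<omega> = u / sqrt v * W t \<omega>" for t \<omega>
  let ?E = "\<lambda>Y t. LINT \<omega>|M. exp (\<i> * complex_of_real (Y t \<omega>))"
  have Qm: "stoch_int (\<lambda>x. (h x)\<^sup>2) t \<in> borel_measurable M" if "0 < t" for t
    using measurable_F_M[OF _ stoch_int_measurable[OF square_predictable_bounded[OF h h_le]]] that by simp
  have Wm: "mart_int h t \<in> borel_measurable M" if "0 < t" for t
    using mart_int_measurable[OF h h_le] that by simp
  have "((\<lambda>t. ?E T t - ?E U t) \<longlongrightarrow> 0) at_top"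
  proof (rule tendstoI)
    fix e :: real assume e: "0 < e"
    \<comment> \<open>The summand 1 keeps \<open>m\<close> positive even for \<open>u = 0\<close>
      and makes the inequality \<open>small\<close> strict.\<close>
    define m where "m = \<bar>u\<bar> * (1 + C\<^sup>2 * c) + 1"
    define \<eta> where "\<eta> = e / (2 * m)"
    have m: "0 < m" using c_nonneg by (auto simp: m_def intro!: add_nonneg_pos)
    have \<eta>: "0 < \<eta>" using m e by (simp add: \<eta>_def)
    have "\<bar>u\<bar> * \<eta> * (1 + C\<^sup>2 * c) = \<eta> * (m - 1)" by (simp add: m_def algebra_simps)
    also have "\<dots> < \<eta> * m" using \<eta> by simp
    also have "\<dots> = e / 2" using m by (simp add: \<eta>_def)
    finally have small: "\<bar>u\<bar> * \<eta> * (1 + C\<^sup>2 * c) < e / 2" .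
    \<comment> \<open>Continuity at \<open>v\<close> rests on \<open>0 < v\<close>: a vanishing
      limit variance would leave the normalisation uncontrolled.\<close>
    have "isCont (\<lambda>x. 1 / sqrt x) v" using v by (intro continuous_intros) auto
    then obtain d where d: "0 < d" "\<And>x. \<bar>x - v\<bar> < d \<Longrightarrow> \<bar>1 / sqrt x - 1 / sqrt v\<bar> < \<eta>"
      using \<eta> unfolding continuous_at_eps_delta dist_real_def by blast
    have "((\<lambda>t. 2 * measure M {\<omega> \<in> space M. \<bar>Q t \<omega> - v\<bar> > d / 2}) \<longlongrightarrow> 2 * 0) at_top"
      using quadratic_variation_consistent[OF conv, folded Q_def, unfolded converges_in_prob_def, rule_format, of "d / 2"] d(1)
      by (intro tendsto_mult tendsto_const) simp
    then have "\<forall>\<^sub>F t in at_top. 2 * measure M {\<omega> \<in> space M. \<bar>Q t \<omega> - v\<bar> > d / 2} < e / 2"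
      using e by (intro order_tendstoD(2)) auto
    then show "\<forall>\<^sub>F t in at_top. dist (?E T t - ?E U t) 0 < e"
      using eventually_gt_at_top[of 0]
    proof eventually_elim
      case (elim t)
      note t = elim(2)
      note [measurable] = Qm[OF t] Wm[OF t]
      define A where "A = {\<omega> \<in> space M. \<bar>Q t \<omega> - v\<bar> > d / 2}"
      have A: "A \<in> sets M" unfolding A_def Q_def by measurable
      have iA: "integrable M (indicator A :: 'a \<Rightarrow> real)"
        using A by (intro integrable_real_indicator) (simp_all add: less_top[symmetric])
      have iW: "integrable M (\<lambda>\<omega>. (W t \<omega>)\<^sup>2)" "(LINT \<omega>|M. (W t \<omega>)\<^sup>2) \<le> C\<^sup>2 * c"
        using mart_int_second_moment[OF h h_le, of t] t by (simp_all add: W_def power_divide divide_le_eq)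
      have m1 [measurable]: "T t \<in> borel_measurable M" "U t \<in> borel_measurable M"
        unfolding T_def[abs_def] U_def[abs_def] W_def by measurable
      have i: "integrable M (\<lambda>\<omega>. exp (\<i> * complex_of_real (T t \<omega>)))" "integrable M (\<lambda>\<omega>. exp (\<i> * complex_of_real (U t \<omega>)))"
        by (auto intro!: integrable_const_bound[where B=1])
      have "norm (?E T t - ?E U t)
          = norm (LINT \<omega>|M. exp (\<i> * complex_of_real (T t \<omega>)) - exp (\<i> * complex_of_real (U t \<omega>)))"
        using i by simp
      also have "\<dots> \<le> (LINT \<omega>|M. norm (exp (\<i> * complex_of_real (T t \<omega>)) - exp (\<i> * complex_of_real (U t \<omega>))))"
        by (rule integral_norm_bound)
      also have "\<dots> \<le> (LINT \<omega>|M. 2 * indicator A \<omega> + \<bar>u\<bar> * \<eta> * (1 + (W t \<omega>)\<^sup>2))"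
      proof (rule integral_mono)
        show "integrable M (\<lambda>\<omega>. norm (exp (\<i> * complex_of_real (T t \<omega>)) - exp (\<i> * complex_of_real (U t \<omega>))))"
          using i by (intro integrable_norm Bochner_Integration.integrable_diff)
        show "integrable M (\<lambda>\<omega>. 2 * indicator A \<omega> + \<bar>u\<bar> * \<eta> * (1 + (W t \<omega>)\<^sup>2))"
          using iA iW(1) by simp
        fix \<omega> assume \<omega>: "\<omega> \<in> space M"
        show "norm (exp (\<i> * complex_of_real (T t \<omega>)) - exp (\<i> * complex_of_real (U t \<omega>)))
            \<le> 2 * indicator A \<omega> + \<bar>u\<bar> * \<eta> * (1 + (W t \<omega>)\<^sup>2)"
        proof (cases "\<omega> \<in> A")
          case True
          \<comment> \<open>Two unit vectors differ by at most 2, whatever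
            \<open>T t \<omega>\<close> is, in particular when the estimator is 0 and the division
            returns 0.\<close>
          have "norm (exp (\<i> * complex_of_real (T t \<omega>)) - exp (\<i> * complex_of_real (U t \<omega>))) \<le> 1 + 1"
            by (rule order_trans[OF norm_triangle_ineq4]) simp
          moreover have "0 \<le> \<bar>u\<bar> * \<eta> * (1 + (W t \<omega>)\<^sup>2)" using \<eta> by simp
          ultimately show ?thesis using True by simp
        next
          case False
          then have "\<bar>Q t \<omega> - v\<bar> < d" using \<omega> d(1) unfolding A_def by auto
          then have c: "\<bar>1 / sqrt (Q t \<omega>) - 1 / sqrt v\<bar> \<le> \<eta>" using d(2) by (simp add: less_imp_le)
          have "sqrt (stoch_int (\<lambda>x. (h x)\<^sup>2) t \<omega>) = sqrt t * sqrt (Q t \<omega>)"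
            using t by (simp add: Q_def real_sqrt_mult[symmetric])
          then have "T t \<omega> - U t \<omega> = u * W t \<omega> * (1 / sqrt (Q t \<omega>) - 1 / sqrt v)"
            by (simp add: T_def U_def W_def algebra_simps diff_divide_distrib)
          then have "\<bar>T t \<omega> - U t \<omega>\<bar> = \<bar>u\<bar> * \<bar>W t \<omega>\<bar> * \<bar>1 / sqrt (Q t \<omega>) - 1 / sqrt v\<bar>"
            by (simp add: abs_mult)
          \<comment> \<open>The first absolute moment is traded for the second, for which a bound is
            available.\<close>
          also have "\<dots> \<le> \<bar>u\<bar> * (1 + (W t \<omega>)\<^sup>2) * \<eta>"
          proof (intro mult_mono mult_left_mono c)
            have "0 \<le> (\<bar>W t \<omega>\<bar> - 1)\<^sup>2" by simp
            then have "2 * \<bar>W t \<omega>\<bar> \<le> 1 + (W t \<omega>)\<^sup>2" by (simp add: power2_diff)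
            then show "\<bar>W t \<omega>\<bar> \<le> 1 + (W t \<omega>)\<^sup>2" using abs_ge_zero[of "W t \<omega>"] by linarith
          qed auto
          finally show ?thesis
            using norm_iexp_diff_le[of "T t \<omega>" "U t \<omega>"] False by (simp add: mult.assoc mult.commute[of \<eta>])
        qed
      qed
      also have "\<dots> = 2 * measure M A + \<bar>u\<bar> * \<eta> * (1 + (LINT \<omega>|M. (W t \<omega>)\<^sup>2))"
        using iA iW(1) A by (simp add: prob_space)
      also have "\<dots> \<le> 2 * measure M A + \<bar>u\<bar> * \<eta> * (1 + C\<^sup>2 * c)"
        using iW(2) \<eta> by (intro add_left_mono mult_left_mono) auto
      also have "\<dots> < e" using elim(1) small unfolding A_def by simp
      finally show ?case by (simp add: dist_norm)
    qed
  qed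
  moreover have "(?E U \<longlongrightarrow> complex_of_real (exp (- (u\<^sup>2) / 2))) at_top"
    using char_mart_int_limit[OF h h_le conv, of "u / sqrt v"] v by (simp add: U_def W_def power_divide)
  ultimately have "((\<lambda>t. (?E T t - ?E U t) + ?E U t) \<longlongrightarrow> 0 + complex_of_real (exp (- (u\<^sup>2) / 2))) at_top"
    by (rule tendsto_add)
  then show ?thesis by (simp add: T_def)
qed

end

end

subsection \<open>The natural filtration\<close>

lemma space_natural_filtration: "space (natural_filtration M E N X t) = space M"
  unfolding natural_filtration_def by (rule space_measure_of) auto

lemma sets_natural_filtration:
  "sets (natural_filtration M E N X t) = sigma_sets (space M)
     ({N s -` B \<inter> space M | s B. s \<in> {0..t}} \<union>
      {X s -` B \<inter> space M | s B. s \<in> {0..t} \<and> B \<in> sets E})"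
  unfolding natural_filtration_def by (rule sets_measure_of) auto

lemma natural_filtration_mono:
  assumes "s \<le> t"
  shows "sets (natural_filtration M E N X s) \<subseteq> sets (natural_filtration M E N X t)"
  unfolding sets_natural_filtration
proof (intro sigma_sets_mono' Un_mono subsetI)
  have I: "u \<in> {0..t}" if "u \<in> {0..s}" for u using that assms by auto
  show "A \<in> {N u -` B \<inter> space M | u B. u \<in> {0..t}}" if "A \<in> {N u -` B \<inter> space M | u B. u \<in> {0..s}}" for A
    using that I by blast
  show "A \<in> {X u -` B \<inter> space M | u B. u \<in> {0..t} \<and> B \<in> sets E}"
    if "A \<in> {X u -` B \<inter> space M | u B. u \<in> {0..s} \<and> B \<in> sets E}" for A
    using that I by blast
qed

lemma natural_filtration_adapted:
  assumes "0 \<le> t" shows "N t \<in> natural_filtration M E N X t \<rightarrow>\<^sub>M count_space UNIV"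
proof (rule measurableI)
  fix B :: "nat set"
  show "N t -` B \<inter> space (natural_filtration M E N X t) \<in> sets (natural_filtration M E N X t)"
    unfolding space_natural_filtration sets_natural_filtration
    using assms by (intro sigma_sets.Basic) auto
qed simp

lemma natural_filtration_subalgebra:
  assumes "\<And>s. 0 \<le> s \<Longrightarrow> N s \<in> M \<rightarrow>\<^sub>M count_space UNIV" and "\<And>s. 0 \<le> s \<Longrightarrow> X s \<in> M \<rightarrow>\<^sub>M E"
  shows "subalgebra M (natural_filtration M E N X t)"
  unfolding subalgebra_def space_natural_filtration sets_natural_filtration
proof (intro conjI refl sets.sigma_sets_subset subsetI)
  fix A assume "A \<in> {N s -` B \<inter> space M | s B. s \<in> {0..t}} \<union>
      {X s -` B \<inter> space M | s B. s \<in> {0..t} \<and> B \<in> sets E}"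
  then consider s B where "0 \<le> s" "A = N s -` B \<inter> space M"
    | s B where "0 \<le> s" "A = X s -` B \<inter> space M" "B \<in> sets E" by auto
  then show "A \<in> sets M"
  proof cases
    case 1
    then show ?thesis using measurable_sets[OF assms(1)[of s], of B] by simp
  next
    case 2
    then show ?thesis using measurable_sets[OF assms(2)[of s], of B] by simp
  qed
qed

lemma predictable_at_covariate:
  assumes X: "predictable_process M F E X" and g: "predictable_function_process M F E g"
  shows "(\<lambda>(t, \<omega>). g t \<omega> (X t \<omega>)) \<in> borel_measurable (predictable_sigma M F)"
proof -
  have "(\<lambda>p. (p, (\<lambda>(t, \<omega>). X t \<omega>) p)) \<in> predictable_sigma M F \<rightarrow>\<^sub>M predictable_sigma M F \<Otimes>\<^sub>M E"
    using X unfolding predictable_process_def by (intro measurable_Pair) auto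
  from measurable_compose[OF this g[unfolded predictable_function_process_def]]
  show ?thesis by (simp add: case_prod_unfold)
qed

theorem proposition1:
  fixes M :: "'a measure" and E :: "'x measure"
    and N :: "real \<Rightarrow> 'a \<Rightarrow> nat" and X :: "real \<Rightarrow> 'a \<Rightarrow> 'x"
    and F :: "real \<Rightarrow> 'a measure"
    and g0 :: "'x \<Rightarrow> real" and g g' :: "real \<Rightarrow> 'a \<Rightarrow> 'x \<Rightarrow> real"
    and \<sigma> :: real
  defines "F \<equiv> natural_filtration M E N X"
  assumes "prob_space M"
    and "counting_process M N"
    and "\<And>t. t \<ge> 0 \<Longrightarrow> X t \<in> M \<rightarrow>\<^sub>M E"
    and "predictable_process M F E X"
    and "g0 \<in> borel_measurable E" and "\<exists>C. \<forall>x\<in>space E. \<bar>g0 x\<bar> \<le> C"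
    and "has_intensity M F N X g0"
    and "predictable_function_process M F E g" and "bounded_function_process M E g"
    and "predictable_function_process M F E g'" and "bounded_function_process M E g'"
    and null: "\<And>S. S \<ge> 0 \<Longrightarrow> AE \<omega> in M. predictable_part g0 X g g' S \<omega> = 0"
    and "\<sigma>\<^sup>2 > 0"
    and "converges_in_prob M
          (\<lambda>S \<omega>. 1 / S * (LINT t:{0..S}|intensity_measure g0 X \<omega>.
                            (g t \<omega> (X t \<omega>) - g' t \<omega> (X t \<omega>))\<^sup>2))
          (\<lambda>\<omega>. \<sigma>\<^sup>2) at_top"
  shows "converges_in_dist_at_top M
          (\<lambda>S \<omega>. loglik_ratio N X g g' S \<omega> / sqrt (S * variance_estimator N X g g' S \<omega>))
          std_normal_distribution"
proof -
  interpret prob_space M by fact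
  note counting = \<open>counting_process M N\<close>
  note X_meas = \<open>\<And>t. t \<ge> 0 \<Longrightarrow> X t \<in> M \<rightarrow>\<^sub>M E\<close>
  note pred_X = \<open>predictable_process M F E X\<close>
  have X_space: "X t \<omega> \<in> space E" if "0 \<le> t" "\<omega> \<in> space M" for t \<omega>
    using measurable_space[OF X_meas] that by blast
  obtain C0 where C0: "\<And>x. x \<in> space E \<Longrightarrow> \<bar>g0 x\<bar> \<le> C0" using assms(7) by blast
  interpret filtered_prob_space M F
  proof
    show "subalgebra M (F t)" if "0 \<le> t" for t
      unfolding F_def using counting X_meas
      by (intro natural_filtration_subalgebra) (auto simp: counting_process_def)
    show "sets (F s) \<subseteq> sets (F t)" if "0 \<le> s" "s \<le> t" for s t
      unfolding F_def using that by (intro natural_filtration_mono)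
  qed
  let ?lam = "\<lambda>t \<omega>. exp (g0 (X t \<omega>))"
  interpret counting_intensity M F N ?lam "exp C0"
  proof
    show "N t \<in> F t \<rightarrow>\<^sub>M count_space UNIV" if "0 \<le> t" for t
      unfolding F_def using that by (rule natural_filtration_adapted)
    have "(\<lambda>p. exp (g0 ((\<lambda>(t, \<omega>). X t \<omega>) p))) \<in> borel_measurable P"
      using measurable_compose[OF pred_X[unfolded predictable_process_def] assms(6)] by measurable
    then show "(\<lambda>(t, \<omega>). exp (g0 (X t \<omega>))) \<in> borel_measurable P"
      by (simp add: case_prod_unfold)
    show "exp (g0 (X t \<omega>)) \<le> exp C0" if "0 \<le> t" "\<omega> \<in> space M" for t \<omega>
      using C0[OF X_space[OF that]] by simp
    show "martingale M F (\<lambda>t \<omega>. real (N t \<omega>) -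
        measure (density lborel (\<lambda>u. indicator {0..} u * ennreal (exp (g0 (X u \<omega>))))) {0..t})"
      using assms(8) unfolding has_intensity_def intensity_measure_def by blast
  qed (use counting in auto)
  have Lam: "intensity_measure g0 X = Lam"
    by (simp add: fun_eq_iff Lam_def intensity_measure_def)
  obtain C1 where C1: "\<And>t \<omega> x. 0 \<le> t \<Longrightarrow> \<omega> \<in> space M \<Longrightarrow> x \<in> space E \<Longrightarrow> \<bar>g t \<omega> x\<bar> \<le> C1"
    using assms(10) unfolding bounded_function_process_def by blast
  obtain C2 where C2: "\<And>t \<omega> x. 0 \<le> t \<Longrightarrow> \<omega> \<in> space M \<Longrightarrow> x \<in> space E \<Longrightarrow> \<bar>g' t \<omega> x\<bar> \<le> C2"
    using assms(12) unfolding bounded_function_process_def by blast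
  define h where "h p = (case p of (t, \<omega>) \<Rightarrow> g t \<omega> (X t \<omega>) - g' t \<omega> (X t \<omega>))" for p
  define k where "k p = (case p of (t, \<omega>) \<Rightarrow> exp (g t \<omega> (X t \<omega>)) - exp (g' t \<omega> (X t \<omega>)))" for p
  note pm = predictable_at_covariate[OF pred_X assms(9)] predictable_at_covariate[OF pred_X assms(11)]
  have h: "h \<in> borel_measurable P"
    using borel_measurable_diff[OF pm] by (simp add: h_def[abs_def] case_prod_unfold)
  have k: "k \<in> borel_measurable P"
    using borel_measurable_diff[OF measurable_compose[OF pm(1) borel_measurable_exp] measurable_compose[OF pm(2) borel_measurable_exp]]
    by (simp add: k_def[abs_def] case_prod_unfold)
  have h_le: "\<bar>h (t, \<omega>)\<bar> \<le> C1 + C2" if "0 \<le> t" "\<omega> \<in> space M" for t \<omega>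
    using C1[OF that X_space[OF that]] C2[OF that X_space[OF that]] by (simp add: h_def)
  have k_le: "norm (k (t, \<omega>)) \<le> exp C1 + exp C2" if "0 \<le> t" "\<omega> \<in> space M" for t \<omega>
  proof -
    have "exp (g t \<omega> (X t \<omega>)) \<le> exp C1" "exp (g' t \<omega> (X t \<omega>)) \<le> exp C2"
      using C1[OF that X_space[OF that]] C2[OF that X_space[OF that]] by auto
    moreover have "0 < exp (g t \<omega> (X t \<omega>))" "0 < exp (g' t \<omega> (X t \<omega>))" by auto
    ultimately show ?thesis unfolding k_def split_conv real_norm_def by linarith
  qed
  let ?L = "\<lambda>S \<omega>. LINT t:{0..S}|lborel. k (t, \<omega>)"
  let ?Y = "\<lambda>S \<omega>. loglik_ratio N X g g' S \<omega> / sqrt (S * variance_estimator N X g g' S \<omega>)"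
  let ?T = "\<lambda>S \<omega>. mart_int h S \<omega> / sqrt (stoch_int (\<lambda>x. (h x)\<^sup>2) S \<omega>)"
  have LR: "loglik_ratio N X g g' S \<omega> = stoch_int h S \<omega> - ?L S \<omega>" for S \<omega>
    by (simp add: loglik_ratio_def stoch_int_def h_def k_def)
  have VE: "variance_estimator N X g g' S \<omega> = 1 / S * stoch_int (\<lambda>x. (h x)\<^sup>2) S \<omega>" for S \<omega>
    by (simp add: variance_estimator_def stoch_int_def h_def)
  \<comment> \<open>The Lebesgue integral \<open>?L\<close> is common to the likelihood ratio and
    its predictable part, so the null hypothesis identifies it with \<open>comp_int h S\<close>
    almost surely.\<close>
  have PP: "predictable_part g0 X g g' S \<omega> = comp_int h S \<omega> - ?L S \<omega>" for S \<omega>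
    by (simp add: predictable_part_def comp_int_def h_def k_def Lam)
  have Y_meas: "?Y S \<in> borel_measurable M" for S
  proof (cases "0 \<le> S")
    case True
    \<comment> \<open>Lebesgue measure counts as a constant random measure, so the general lemma
      also yields measurability of the drift term.\<close>
    have "adapted_kernel (\<lambda>_. lborel)" by (auto simp: adapted_kernel_def)
    then have "(\<lambda>\<omega>. ?L S \<omega>) \<in> borel_measurable M"
      by (intro measurable_F_M[OF True] kernel_integral_measurable_real[OF _ True k k_le]) auto
    moreover have "stoch_int h S \<in> borel_measurable M" "stoch_int (\<lambda>x. (h x)\<^sup>2) S \<in> borel_measurable M"
      using stoch_int_measurable[OF h h_le True] stoch_int_measurable[OF square_predictable_bounded[OF h h_le] True]
      by (auto intro: measurable_F_M[OF True])
    ultimately show ?thesis unfolding LR VE by measurable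
  next
    \<comment> \<open>A sequence of times tending to infinity may begin with negative ones, and
      their laws must be distributions too. There \<open>{0..S}\<close> is empty and the ratio is
      0.\<close>
    case False
    then have "?Y S = (\<lambda>_. 0)"
      by (simp add: fun_eq_iff loglik_ratio_def set_lebesgue_integral_def)
    then show ?thesis by simp
  qed
  \<comment> \<open>The exceptional set may depend on \<open>S\<close>, which does no harm: only the
    law at each single time matters. In the denominator, \<open>S\<close> cancels the averaging
    factor of the estimator.\<close>
  have Y_T: "AE \<omega> in M. ?Y S \<omega> = ?T S \<omega>" if "0 < S" for S
    using null[of S] that by (auto simp: LR VE PP mart_int_def)
  have conv: "converges_in_prob M (\<lambda>t \<omega>. comp_int (\<lambda>x. (h x)\<^sup>2) t \<omega> / t) (\<lambda>_. \<sigma>\<^sup>2) at_top"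
    using assms(15) by (simp add: comp_int_def h_def Lam)
  have char_Y: "char (distr M borel (?Y S)) u = (LINT \<omega>|M. exp (\<i> * complex_of_real (u * ?T S \<omega>)))"
    if S: "0 < S" for S u
  proof -
    have S0: "0 \<le> S" using S by simp
    have T_meas: "mart_int h S \<in> borel_measurable M" "stoch_int (\<lambda>x. (h x)\<^sup>2) S \<in> borel_measurable M"
      using mart_int_measurable[OF h h_le S0] stoch_int_measurable[OF square_predictable_bounded[OF h h_le] S0]
      by (auto intro: measurable_F_M[OF S0])
    have "char (distr M borel (?Y S)) u = (LINT \<omega>|M. exp (\<i> * complex_of_real (u * ?Y S \<omega>)))"
      unfolding char_def using Y_meas by (subst integral_distr) auto
    also have "\<dots> = (LINT \<omega>|M. exp (\<i> * complex_of_real (u * ?T S \<omega>)))"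
    proof (rule integral_cong_AE)
      show "(\<lambda>\<omega>. exp (\<i> * complex_of_real (u * ?Y S \<omega>))) \<in> borel_measurable M"
        using Y_meas[of S] by measurable
      show "(\<lambda>\<omega>. exp (\<i> * complex_of_real (u * ?T S \<omega>))) \<in> borel_measurable M"
        using T_meas by measurable
      show "AE \<omega> in M. exp (\<i> * complex_of_real (u * ?Y S \<omega>)) = exp (\<i> * complex_of_real (u * ?T S \<omega>))"
        using Y_T[OF S] by eventually_elim simp
    qed
    finally show ?thesis .
  qed
  show ?thesis
    unfolding converges_in_dist_at_top_def
  proof (intro allI impI)
    fix s :: "nat \<Rightarrow> real" assume s: "filterlim s at_top sequentially"
    show "weak_conv_m (\<lambda>n. distr M borel (?Y (s n))) std_normal_distribution"
    proof (rule levy_continuity)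
      show "real_distribution (distr M borel (?Y (s n)))" for n
        by (rule real_distribution_distr[OF Y_meas])
      show "real_distribution std_normal_distribution" by (rule real_dist_normal_dist)
      fix u
      have "(\<lambda>n. LINT \<omega>|M. exp (\<i> * complex_of_real (u * ?T (s n) \<omega>))) \<longlonglongrightarrow> complex_of_real (exp (- (u\<^sup>2) / 2))"
        by (rule filterlim_compose[OF char_studentized_limit[OF h h_le conv \<open>\<sigma>\<^sup>2 > 0\<close>] s])
      \<comment> \<open>The characteristic functions coincide at positive times, hence for all but
        finitely many \<open>n\<close>.\<close>
      moreover have "\<forall>\<^sub>F n in sequentially. (LINT \<omega>|M. exp (\<i> * complex_of_real (u * ?T (s n) \<omega>)))
          = char (distr M borel (?Y (s n))) u"
        using filterlim_at_top_dense[THEN iffD1, OF s, rule_format, of 0]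
        by eventually_elim (simp only: char_Y)
      ultimately show "(\<lambda>n. char (distr M borel (?Y (s n))) u) \<longlonglongrightarrow> char std_normal_distribution u"
        unfolding char_std_normal_distribution by (rule Lim_transform_eventually)
    qed
  qed
qed

end
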